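(* For all positive integers $k$, we have $$T_{ш}^{\mathcal S}(2,\{1\}^k)-(-1)^kT_{ш}^{\mathcal S}(1,k+1)=\begin{cases}\displaystyle2\sum_{n=1}^{\frac{k-1}{2}}\zeta(2n)\,T(k+2-2n),&k\text{ odd},\\(k+2)\,T(k+2),&k\text{ even}.\end{cases}$$ In particular, $$T_{ш}^{\mathcal S}(2,\{1\}^k)\equiv(-1)^kT_{ш}^{\mathcal S}(1,k+1)\pmod{\zeta(2)\,\mathsf{ES}_k}.$$
   Context: Notation: $\{1\}^k$ denotes the string $1,\dots,1$ of length $k$. $\zeta$ is the Riemann zeta function, and for an integer $m\ge2$, $T(m)=\sum_{n\ge1,\ n\text{ odd}}\frac{2}{n^m}$. $\mathsf{ES}_w$ is the $\mathbb Q$-vector space generated by all (convergent) Euler sums of weight $w$, i.e. by the numbers $\sum_{n_1>\dots>n_d>0}\frac{\varepsilon_1^{n_1}\cdots\varepsilon_d^{n_d}}{n_1^{s_1}\cdots n_d^{s_d}}$ with $d\ge1$, positive integers $s_j$ with $s_1+\dots+s_d=w$, $\varepsilon_j\in\{\pm1\}$, $(s_1,\varepsilon_1)\ne(1,1)$. A congruence modulo $\zeta(2)V$ means that the difference lies in $\{\zeta(2)v:v\in V\}$. Shuffle-regularized values: put $\omega_0=\frac{dt}{t}$, $\omega_1=\frac{2t\,dt}{1-t^2}$, $\omega_{-1}=\frac{2\,dt}{1-t^2}$. For a word $\eta_1\cdots\eta_m$ in these forms, $\eta_i=f_i(t)\,dt$, and $0<x\le1$, set $\int_0^x\eta_1\cdots\eta_m=\int_{x>t_1>\cdots>t_m>0}f_1(t_1)\cdots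 f_m(t_m)\,dt_1\cdots dt_m$. To a tuple of positive integers $\mathbf s=(s_1,\dots,s_d)$ associate the words $W_T(\mathbf s)=\omega_0^{s_1-1}\omega_{-1}\cdots\omega_0^{s_d-1}\omega_{-1}$ and $W_S(\mathbf s)=\omega_0^{s_1-1}\omega_{-1}\cdots\omega_0^{s_{d-1}-1}\omega_{-1}\,\omega_0^{s_d-1}\omega_1$. For $F\in\{S,T\}$, as $\epsilon\to0^+$ one has $\int_0^{1-\epsilon}W_F(\mathbf s)=P_{F,\mathbf s}(-\log\epsilon)+o(1)$ for a unique real polynomial $P_{F,\mathbf s}$; set $F_{ш}(\mathbf s)=P_{F,\mathbf s}(X)$, with $X$ a formal variable. If $s_1\ge2$ this is the constant $\int_0^1W_F(\mathbf s)$. For the empty index ($d=0$) set $F_{ш}=1$. Symmetric multiple $T$-values: $$T_{ш}^{\mathcal S}(s_1,\dots,s_d)=\begin{cases}\sum_{i=0}^d\big(\prod_{\ell=1}^i(-1)^{s_\ell}\big)T_{ш}(s_i,\dots,s_1)\,T_{ш}(s_{i+1},\dots,s_d), & d\text{ even},\\ \sum_{i=0}^d\big(\prod_{\ell=1}^i(-1)^{s_\ell}\big)S_{ш}(s_i,\dots,s_1)\,T_{ш}(s_{i+1},\dots,s_d), & d\text{ odd}.\end{cases}$$ This is a real number (it does not depend on $X$). *)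

theory Defs
  imports
    "HOL-Analysis.Analysis"
    "HOL-Computational_Algebra.Polynomial"
begin

section \<open>Zeta values, single T-values and Euler sums\<close>

text \<open>Only integer arguments \<open>m \<ge> 2\<close> occur, where the Dirichlet series converges.\<close>

definition zeta_val :: "nat \<Rightarrow> real" where
  "zeta_val m = (\<Sum>n. 1 / real (Suc n) ^ m)"

definition T_val :: "nat \<Rightarrow> real" where
  "T_val m = (\<Sum>n. 2 / real (2 * n + 1) ^ m)"

text \<open>
  An Euler sum is given by the list of its pairs (exponent, sign).  It may converge only
  conditionally (exponent 1 and sign -1 in first position), so it is the limit of the partial
  sums over the decreasing tuples \<open>N \<ge> n\<^sub>1 > \<dots> > n\<^sub>d > 0\<close>.
\<close>

definition euler_sum :: "(nat \<times> int) list \<Rightarrow> real" where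
  "euler_sum p = lim (\<lambda>N::nat.
     \<Sum>ns | length ns = length p \<and> set ns \<subseteq> {1..N} \<and> sorted_wrt (>) ns.
       \<Prod>j<length p. real_of_int (snd (p ! j)) ^ (ns ! j) / real (ns ! j) ^ fst (p ! j))"

definition euler_index :: "nat \<Rightarrow> (nat \<times> int) list \<Rightarrow> bool" where
  "euler_index w p \<longleftrightarrow>
     p \<noteq> [] \<and> (\<forall>(s, e) \<in> set p. s \<ge> 1 \<and> e \<in> {1, -1}) \<and>
     sum_list (map fst p) = w \<and> hd p \<noteq> (1, 1)"

definition ES :: "nat \<Rightarrow> real set" where
  "ES w = module.span (\<lambda>(q::rat) (x::real). of_rat q * x) (euler_sum ` {p. euler_index w p})"

definition cong_mod_zeta2 :: "real \<Rightarrow> real \<Rightarrow> real set \<Rightarrow> bool" where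
  "cong_mod_zeta2 x y V \<longleftrightarrow> x - y \<in> {zeta_val 2 * v | v. v \<in> V}"


section \<open>Iterated integrals and their shuffle regularization\<close>

text \<open>
  A word in the differential forms \<open>f\<^sub>i(t) dt\<close> is the list of the functions \<open>f\<^sub>i\<close>.  The letter at
  list position \<open>i\<close> belongs to the variable \<open>t i\<close>, so the head of the list carries the largest
  variable.
\<close>

definition omega_0 :: "real \<Rightarrow> real" where
  "omega_0 t = 1 / t"

definition omega_1 :: "real \<Rightarrow> real" where
  "omega_1 t = 2 * t / (1 - t\<^sup>2)"

definition omega_m1 :: "real \<Rightarrow> real" where
  "omega_m1 t = 2 / (1 - t\<^sup>2)"

definition open_simplex :: "nat \<Rightarrow> real \<Rightarrow> (nat \<Rightarrow> real) set" where
  "open_simplex m x =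
     {t \<in> space (\<Pi>\<^sub>M i\<in>{..<m}. lborel).
        (\<forall>i<m. 0 < t i \<and> t i < x) \<and> (\<forall>i j. i < j \<and> j < m \<longrightarrow> t j < t i)}"

definition iterated_integral :: "(real \<Rightarrow> real) list \<Rightarrow> real \<Rightarrow> real" where
  "iterated_integral fs x =
     set_lebesgue_integral (\<Pi>\<^sub>M i\<in>{..<length fs}. lborel) (open_simplex (length fs) x)
       (\<lambda>t. \<Prod>i<length fs. (fs ! i) (t i))"

definition word_T :: "nat list \<Rightarrow> (real \<Rightarrow> real) list" where
  "word_T s = concat (map (\<lambda>a. replicate (a - 1) omega_0 @ [omega_m1]) s)"

text \<open>Only used for nonempty indices.\<close>

definition word_S :: "nat list \<Rightarrow> (real \<Rightarrow> real) list" where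
  "word_S s = word_T (butlast s) @ replicate (last s - 1) omega_0 @ [omega_1]"

definition reg_integral :: "(real \<Rightarrow> real) list \<Rightarrow> real poly" where
  "reg_integral fs =
     (THE P. ((\<lambda>\<epsilon>. iterated_integral fs (1 - \<epsilon>) - poly P (- ln \<epsilon>)) \<longlongrightarrow> 0) (at_right 0))"

text \<open>The polynomial variable of \<open>T_sh\<close> and \<open>S_sh\<close> is the formal variable \<open>X\<close>.\<close>

definition T_sh :: "nat list \<Rightarrow> real poly" where
  "T_sh s = (if s = [] then 1 else reg_integral (word_T s))"

definition S_sh :: "nat list \<Rightarrow> real poly" where
  "S_sh s = (if s = [] then 1 else reg_integral (word_S s))"


section \<open>Symmetric multiple T-values\<close>

definition T_sym_poly :: "nat list \<Rightarrow> real poly" where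
  "T_sym_poly s =
     (\<Sum>i\<le>length s.
        (\<Prod>l<i. (-1) ^ (s ! l)) *
        (if even (length s) then T_sh (rev (take i s)) else S_sh (rev (take i s))) *
        T_sh (drop i s))"

text \<open>The defining expression is a constant polynomial; the symmetric value is that constant.\<close>

definition T_sym :: "nat list \<Rightarrow> real" where
  "T_sym s = (THE c. T_sym_poly s = [:c:])"

end

theory Submission
  imports Defs "HOL-Probability.Probability"
begin

text \<open>
  Let \<open>A\<close> and \<open>B\<close> be the primitives of \<open>omega_m1\<close> and \<open>omega_1\<close> that vanish at 0 (\<open>T_log\<close> and \<open>S_log\<close>
  below), and write \<open>Y = X + log 2\<close>, so that \<open>A(1 - \<epsilon>)\<close> is \<open>Y\<close> at \<open>X = - log \<epsilon>\<close> up to an error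
  of order \<open>\<epsilon>\<close>.

  \<^bold>\<open>The value at (2, 1, ..., 1).\<close>  If the integral of a word \<open>w\<close> up to \<open>x\<close> is
  \<open>\<integral>\<^sub>0\<^sup>x g(t) dt\<close>, then that of \<open>omega_m1\<^sup>j w\<close> is \<open>\<integral>\<^sub>0\<^sup>x (A(x) - A(t))\<^sup>j / j! g(t) dt\<close>
  (\<open>nn_iter_replicate_omega_m1\<close>).  By the binomial theorem it is a polynomial in \<open>A(x)\<close> whose
  coefficients are the truncated moments \<open>\<integral>\<^sub>0\<^sup>x A\<^sup>l g\<close>, and regularization replaces \<open>A(x)\<close> by \<open>Y\<close> and
  the truncated moments by the full ones (\<open>reg_integral_replicate_omega_m1\<close>).  In the definition
  of the symmetric value these polynomials meet the factors \<open>Y\<^sup>k\<^sup>-\<^sup>j / (k - j)!\<close> coming from the strings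
  of ones, and the binomial theorem, used backwards, leaves a single moment
  (\<open>alternating_sum_reg_poly\<close>).  Hence the value is \<open>T(k + 2) + 1/k! \<integral>\<^sub>0\<^sup>1 A\<^sup>k g\<close> with \<open>g = A/t\<close> for odd \<open>k\<close>
  and \<open>g = B/t\<close> for even \<open>k\<close>.  The substitution \<open>t = tanh (v/2)\<close> turns \<open>A\<close> into \<open>v\<close> and \<open>dt/t\<close> into
  \<open>dv / sinh v\<close>, and the moments become Mellin transforms of exponential series.  For odd \<open>k\<close> the
  result is \<open>(k + 2) T(k + 2)\<close>.

  \<^bold>\<open>The value at (1, k + 1).\<close>  The same formula with \<open>j = 1\<close> gives \<open>(-1)\<^sup>k M - Q\<close>
  (\<open>T_sym_1_single\<close>), where \<open>Q\<close> and \<open>M\<close> are the sums of \<open>4 c(N) / N\<^sup>k\<^sup>+\<^sup>1\<close> over odd and over even \<open>N\<close>,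
  and \<open>c(N)\<close> is the sum of \<open>1/m - 1/(m + N)\<close> over odd \<open>m\<close>.  The recurrence \<open>c(N + 2) = c(N) + 1/(N + 1)\<close>
  yields the generating function \<open>(log 2 - log (1 - s)) / (1 - s\<^sup>2)\<close> of the \<open>c(N)\<close>.  At \<open>s = - e\<^sup>-\<^sup>v\<close> the
  numerator is half the logarithm by which \<open>B\<close> differs from \<open>A\<close> after the substitution, so for even \<open>k\<close>
  the value at \<open>(2, 1, ..., 1)\<close> is \<open>(k + 2) T(k + 2) - (Q - M)\<close>, and \<open>Q - M\<close> cancels.

  \<^bold>\<open>Odd k.\<close>  Here \<open>Q + M\<close> has to be evaluated.  With \<open>k = 2r + 1\<close>, sum the absolutely convergent
  double series of \<open>1 / (a N\<^sup>2\<^sup>r (a\<^sup>2 - N\<^sup>2))\<close> over odd \<open>a\<close> and all \<open>N \<noteq> a\<close> in both orders.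
  Summing over \<open>a\<close> first produces \<open>- c(N) / N\<^sup>k\<^sup>+\<^sup>1\<close> and a multiple of \<open>T(k + 2)\<close>; summing over \<open>N\<close> first
  produces the products \<open>\<zeta>(2n) T(k + 2 - 2n)\<close>, because a finite geometric sum in \<open>N\<^sup>-\<^sup>2\<close> and \<open>a\<^sup>-\<^sup>2\<close> has
  the denominator \<open>a\<^sup>2 - N\<^sup>2\<close> (\<open>odd_harm_series_value\<close>).

  \<^bold>\<open>The congruence.\<close>  The same double series over all \<open>a\<close> and without the factor \<open>1/a\<close> gives
  Euler's convolution formula for \<open>\<zeta>(2n)\<close> (\<open>zeta_even_convolution\<close>), so \<open>\<zeta>(2n)\<close> is a positive rational
  multiple of \<open>\<zeta>(2)\<^sup>n\<close> and a factor \<open>\<zeta>(2)\<close> splits off every term.  What remains is a rational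
  combination of products of two Euler sums of depth one, which the stuffle product
  (\<open>euler_sum_stuffle\<close>) writes in depth at most two.
\<close>

section \<open>Iterated integrals as nested integrals\<close>

text \<open>The head of the word carries the outermost integration, and \<open>g\<close> is a function placed behind the
  innermost one.  With values in \<open>ennreal\<close> the interchanges of integrals below need no integrability;
  the general \<open>g\<close> lets a last letter be absorbed, which is what the induction on the dimension of
  the simplex needs.\<close>

primrec nn_iter :: "(real \<Rightarrow> real) list \<Rightarrow> (real \<Rightarrow> ennreal) \<Rightarrow> real \<Rightarrow> ennreal" where
  "nn_iter [] g = g"
| "nn_iter (f # fs) g = (\<lambda>x. \<integral>\<^sup>+t\<in>{0<..<x}. ennreal (f t) * nn_iter fs g t \<partial>lborel)"

lemma measurable_nn_integral_upto [measurable]: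
  fixes h :: "real \<Rightarrow> ennreal"
  assumes [measurable]: "h \<in> borel_measurable borel"
  shows "(\<lambda>x. \<integral>\<^sup>+t\<in>{0<..<x}. h t \<partial>lborel) \<in> borel_measurable borel"
proof -
  have "(\<lambda>x. \<integral>\<^sup>+t\<in>{0<..<x}. h t \<partial>lborel) = (\<lambda>x. \<integral>\<^sup>+t. (if 0 < t \<and> t < x then h t else 0) \<partial>lborel)"
    by (intro ext nn_integral_cong) (auto simp: indicator_def)
  also have "\<dots> \<in> borel_measurable borel"
    by measurable
  finally show ?thesis .
qed

lemma measurable_nn_iter:
  assumes "\<forall>f\<in>set fs. f \<in> borel_measurable borel" "g \<in> borel_measurable borel"
  shows "nn_iter fs g \<in> borel_measurable borel"
  using assms by (induction fs) auto

lemma nn_iter_append: "nn_iter (fs @ gs) h = nn_iter fs (nn_iter gs h)"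
  by (induction fs) auto

lemma open_simplex_Suc:
  assumes "t \<in> space (\<Pi>\<^sub>M i\<in>{..<m}. lborel)"
  shows "t(m := y) \<in> open_simplex (Suc m) x \<longleftrightarrow>
    t \<in> open_simplex m x \<and> 0 < y \<and> y < (if m = 0 then x else t (m - 1))"
proof -
  have sp: "t(m := y) \<in> space (\<Pi>\<^sub>M i\<in>{..<Suc m}. lborel)"
    using assms by (auto simp: space_PiM PiE_iff extensional_def)
  show ?thesis
  proof (cases "m = 0")
    case True
    then show ?thesis using sp assms by (auto simp: open_simplex_def)
  next
    case False
    have "(\<forall>i<Suc m. 0 < (t(m := y)) i \<and> (t(m := y)) i < x) \<longleftrightarrow>
        (\<forall>i<m. 0 < t i \<and> t i < x) \<and> 0 < y \<and> y < x"
      by (auto simp: less_Suc_eq)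
    moreover have "(\<forall>i j. i < j \<and> j < Suc m \<longrightarrow> (t(m := y)) j < (t(m := y)) i) \<longleftrightarrow>
        (\<forall>i j. i < j \<and> j < m \<longrightarrow> t j < t i) \<and> (\<forall>i<m. y < t i)"
      by (auto simp: less_Suc_eq)
    moreover have "(\<forall>i<m. 0 < t i \<and> t i < x) \<and> (\<forall>i j. i < j \<and> j < m \<longrightarrow> t j < t i) \<Longrightarrow>
        (\<forall>i<m. y < t i) \<and> y < x \<longleftrightarrow> y < t (m - 1)"
    proof -
      assume a: "(\<forall>i<m. 0 < t i \<and> t i < x) \<and> (\<forall>i j. i < j \<and> j < m \<longrightarrow> t j < t i)"
      have "t (m - 1) \<le> t i" if "i < m" for i
        using a that False by (cases "i = m - 1") (auto intro!: less_imp_le)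
      then show ?thesis using a False
        by (meson diff_less le_less_trans less_le_trans less_trans neq0_conv zero_less_one)
    qed
    ultimately show ?thesis using False sp assms unfolding open_simplex_def by auto
  qed
qed

lemma open_simplex_measurable [measurable]:
  "open_simplex m x \<in> sets (\<Pi>\<^sub>M i\<in>{..<m}. lborel)"
proof -
  have "open_simplex m x = {t \<in> space (\<Pi>\<^sub>M i\<in>{..<m}. lborel).
     (\<forall>i\<in>{..<m}. 0 < t i \<and> t i < x) \<and> (\<forall>i\<in>{..<m}. \<forall>j\<in>{..<m}. i < j \<longrightarrow> t j < t i)}"
    unfolding open_simplex_def by (intro Collect_cong) (auto dest: less_trans)
  also have "\<dots> \<in> sets (\<Pi>\<^sub>M i\<in>{..<m}. lborel)"
    by measurable
  finally show ?thesis .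
qed

text \<open>Integrating out the smallest variable, which has the last index, keeps the remaining index set
  of the form \<open>{..<m}\<close>; the letter that disappears is moved into \<open>g\<close>.\<close>

lemma nn_integral_open_simplex:
  assumes "\<forall>f\<in>set fs. f \<in> borel_measurable borel" "g \<in> borel_measurable borel"
  shows "(\<integral>\<^sup>+t\<in>open_simplex (length fs) x.
             (\<Prod>i<length fs. ennreal ((fs ! i) (t i))) * g (if fs = [] then x else t (length fs - 1))
           \<partial>(\<Pi>\<^sub>M i\<in>{..<length fs}. lborel)) = nn_iter fs g x"
  using assms
proof (induction fs arbitrary: g rule: rev_induct)
  case Nil
  interpret product_sigma_finite "\<lambda>_::nat. lborel :: real measure" by standard
  have "open_simplex 0 x = {\<lambda>_. undefined}"
    by (auto simp: open_simplex_def space_PiM)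
  then show ?case
    by (simp add: nn_integral_empty)
next
  case (snoc f fs)
  interpret product_sigma_finite "\<lambda>_::nat. lborel :: real measure" by standard
  define m where "m = length fs"
  have [measurable]: "f \<in> borel_measurable borel" "g \<in> borel_measurable borel"
    using snoc.prems by auto
  have fsm: "\<forall>f\<in>set fs. f \<in> borel_measurable borel" using snoc.prems by auto
  have nthm [measurable]: "i < m \<Longrightarrow> (fs ! i) \<in> borel_measurable borel" for i
    using fsm by (auto simp: m_def)
  define z where "z = (\<lambda>t::nat \<Rightarrow> real. if m = 0 then x else t (m - 1))"
  have "(\<integral>\<^sup>+t\<in>open_simplex (length (fs @ [f])) x.
             (\<Prod>i<length (fs @ [f]). ennreal (((fs @ [f]) ! i) (t i))) *
               g (if fs @ [f] = [] then x else t (length (fs @ [f]) - 1))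
           \<partial>(\<Pi>\<^sub>M i\<in>{..<length (fs @ [f])}. lborel))
     = (\<integral>\<^sup>+t\<in>open_simplex (Suc m) x. (\<Prod>i<m. ennreal ((fs ! i) (t i))) * (ennreal (f (t m)) * g (t m))
           \<partial>(\<Pi>\<^sub>M i\<in>insert m {..<m}. lborel))" (is "_ = integral\<^sup>N _ ?F")
    by (simp add: m_def[symmetric] nth_append lessThan_Suc[symmetric] mult.assoc)
  also have "\<dots> = (\<integral>\<^sup>+t. (\<integral>\<^sup>+y. ?F (t(m := y)) \<partial>lborel) \<partial>(\<Pi>\<^sub>M i\<in>{..<m}. lborel))"
  proof (rule product_nn_integral_insert)
    have [measurable]: "open_simplex (Suc m) x \<in> sets (\<Pi>\<^sub>M i\<in>insert m {..<m}. lborel)"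
      using open_simplex_measurable[of "Suc m" x] by (simp only: lessThan_Suc)
    show "?F \<in> borel_measurable (\<Pi>\<^sub>M i\<in>insert m {..<m}. lborel)"
      by measurable
  qed auto
  also have "\<dots> = (\<integral>\<^sup>+t\<in>open_simplex m x. (\<Prod>i<m. ennreal ((fs ! i) (t i))) * nn_iter [f] g (z t)
       \<partial>(\<Pi>\<^sub>M i\<in>{..<m}. lborel))"
  proof (rule nn_integral_cong)
    fix t assume t: "t \<in> space (\<Pi>\<^sub>M i\<in>{..<m}. (lborel :: real measure))"
    have "(\<integral>\<^sup>+y. ?F (t(m := y)) \<partial>lborel) =
       (\<integral>\<^sup>+y. ((\<Prod>i<m. ennreal ((fs ! i) (t i))) * indicator (open_simplex m x) t) *
             (ennreal (f y) * g y * indicator {0<..<z t} y) \<partial>lborel)"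
      by (intro nn_integral_cong)
         (auto simp: indicator_def open_simplex_Suc[OF t] z_def intro!: prod.cong)
    also have "\<dots> = ((\<Prod>i<m. ennreal ((fs ! i) (t i))) * indicator (open_simplex m x) t) * nn_iter [f] g (z t)"
      by (subst nn_integral_cmult) auto
    finally show "(\<integral>\<^sup>+y. ?F (t(m := y)) \<partial>lborel) =
        (\<Prod>i<m. ennreal ((fs ! i) (t i))) * nn_iter [f] g (z t) * indicator (open_simplex m x) t"
      by (simp add: mult_ac)
  qed
  also have "\<dots> = nn_iter fs (nn_iter [f] g) x"
  proof -
    have "nn_iter [f] g \<in> borel_measurable borel" by (intro measurable_nn_iter) auto
    from snoc.IH[OF fsm this] show ?thesis by (simp add: m_def z_def cong: if_cong)
  qed
  finally show ?case by (simp add: nn_iter_append)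
qed

lemma omega_measurable [measurable]:
  "omega_0 \<in> borel_measurable borel" "omega_1 \<in> borel_measurable borel"
  "omega_m1 \<in> borel_measurable borel"
proof -
  have "omega_0 = (\<lambda>t. 1 / t)" "omega_1 = (\<lambda>t. 2 * t / (1 - t\<^sup>2))" "omega_m1 = (\<lambda>t. 2 / (1 - t\<^sup>2))"
    by (auto simp: omega_0_def omega_1_def omega_m1_def)
  note eqs = this
  show "omega_0 \<in> borel_measurable borel" unfolding eqs by measurable
  show "omega_1 \<in> borel_measurable borel" unfolding eqs by measurable
  show "omega_m1 \<in> borel_measurable borel" unfolding eqs by measurable
qed

lemma omega_nonneg:
  assumes "0 < t" "t < 1"
  shows "omega_0 t \<ge> 0" "omega_1 t \<ge> 0" "omega_m1 t \<ge> 0"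
  using assms by (auto simp: omega_0_def omega_1_def omega_m1_def power_le_one)

text \<open>All three forms are nonnegative on \<open>(0, 1)\<close>, so the Bochner integral is \<open>enn2real\<close> of the
  nonnegative integral, whether or not the latter is finite.\<close>

lemma iterated_integral_eq_nn_iter:
  assumes "set fs \<subseteq> {omega_0, omega_1, omega_m1}" "x \<le> 1"
  shows "iterated_integral fs x = enn2real (nn_iter fs (\<lambda>_. 1) x)"
proof -
  let ?M = "(\<Pi>\<^sub>M i\<in>{..<length fs}. lborel) :: (nat \<Rightarrow> real) measure"
  let ?S = "open_simplex (length fs) x"
  have m [measurable]: "i < length fs \<Longrightarrow> (fs ! i) \<in> borel_measurable borel" for i
    using assms(1) nth_mem[of i fs] omega_measurable by (metis empty_iff insert_iff subsetD)
  have nn: "0 \<le> (fs ! i) (t i)" if "t \<in> ?S" "i < length fs" for t i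
  proof -
    have "0 < t i" "t i < 1" using that assms(2) by (auto simp: open_simplex_def less_le_trans)
    then show ?thesis using assms(1) nth_mem[OF that(2)] omega_nonneg
      by (metis empty_iff insert_iff subsetD)
  qed
  have "iterated_integral fs x = enn2real (\<integral>\<^sup>+t. ennreal (indicator ?S t *\<^sub>R (\<Prod>i<length fs. (fs ! i) (t i))) \<partial>?M)"
    unfolding iterated_integral_def set_lebesgue_integral_def
    by (rule integral_eq_nn_integral) (auto simp: indicator_def intro!: prod_nonneg nn)
  also have "(\<integral>\<^sup>+t. ennreal (indicator ?S t *\<^sub>R (\<Prod>i<length fs. (fs ! i) (t i))) \<partial>?M) =
    (\<integral>\<^sup>+t\<in>?S. (\<Prod>i<length fs. ennreal ((fs ! i) (t i))) * 1 \<partial>?M)"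
    by (intro nn_integral_cong) (auto simp: indicator_def nn intro!: prod_ennreal[symmetric])
  also have "\<dots> = nn_iter fs (\<lambda>_. 1) x"
    by (rule nn_integral_open_simplex) (use assms(1) omega_measurable in auto)
  finally show ?thesis .
qed

section \<open>Words beginning with copies of \<open>omega_m1\<close>\<close>

definition T_log :: "real \<Rightarrow> real" where
  "T_log x = ln (1 + x) - ln (1 - x)"

definition S_log :: "real \<Rightarrow> real" where
  "S_log x = - ln (1 - x\<^sup>2)"

lemma T_log_measurable [measurable]: "T_log \<in> borel_measurable borel"
  unfolding T_log_def[abs_def] by measurable

lemma S_log_measurable [measurable]: "S_log \<in> borel_measurable borel"
  unfolding S_log_def[abs_def] by measurable

lemma T_log_0 [simp]: "T_log 0 = 0"
  by (simp add: T_log_def)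

lemma T_log_mono: "0 \<le> x \<Longrightarrow> x \<le> y \<Longrightarrow> y < 1 \<Longrightarrow> T_log x \<le> T_log y"
  unfolding T_log_def by (intro diff_mono) auto

lemma T_log_nonneg: "0 \<le> x \<Longrightarrow> x < 1 \<Longrightarrow> T_log x \<ge> 0"
  using T_log_mono[of 0 x] by simp

lemma T_log_deriv:
  assumes "-1 < x" "x < 1"
  shows "(T_log has_real_derivative omega_m1 x) (at x within S)"
proof -
  have "(1 - x) * (1 + x) = 1 - x\<^sup>2" by (simp add: algebra_simps power2_eq_square)
  then have "1 / (1 + x) + 1 / (1 - x) = omega_m1 x"
    using assms unfolding omega_m1_def by (simp add: field_simps)
  moreover have "((\<lambda>x. ln (1 + x) - ln (1 - x)) has_real_derivative 1 / (1 + x) + 1 / (1 - x)) (at x within S)"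
    using assms by (auto intro!: derivative_eq_intros)
  ultimately show ?thesis unfolding T_log_def[abs_def] by simp
qed

lemma S_log_deriv:
  assumes "-1 < x" "x < 1"
  shows "(S_log has_real_derivative omega_1 x) (at x within S)"
proof -
  have "x\<^sup>2 < 1" using assms by (simp add: abs_square_less_1)
  then show ?thesis unfolding S_log_def[abs_def] omega_1_def
    by (auto intro!: derivative_eq_intros)
qed

lemma S_log_nonneg: "0 \<le> x \<Longrightarrow> x < 1 \<Longrightarrow> S_log x \<ge> 0"
  by (auto simp: S_log_def abs_square_less_1 ln_le_zero_iff)

lemma S_log_le_T_log:
  assumes "0 \<le> x" "x < 1"
  shows "S_log x \<le> T_log x"
proof -
  have "1 - x\<^sup>2 = (1 + x) * (1 - x)" by (simp add: algebra_simps power2_eq_square)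
  then have "S_log x = - ln (1 + x) - ln (1 - x)"
    using assms by (simp add: S_log_def ln_mult)
  moreover have "ln (1 + x) \<ge> 0" using assms by simp
  ultimately show ?thesis by (simp add: T_log_def)
qed

lemma omega_m1_nonneg: "0 \<le> t \<Longrightarrow> t < 1 \<Longrightarrow> omega_m1 t \<ge> 0"
  by (auto simp: omega_m1_def power_le_one)

lemma omega_1_nonneg: "0 \<le> t \<Longrightarrow> t < 1 \<Longrightarrow> omega_1 t \<ge> 0"
  by (auto simp: omega_1_def power_le_one)

lemma nn_integral_FTC_Ioo:
  fixes f F :: "real \<Rightarrow> real"
  assumes "f \<in> borel_measurable borel" "a \<le> b"
    and "\<And>t. t \<in> {a..b} \<Longrightarrow> (F has_real_derivative f t) (at t)"
    and "\<And>t. t \<in> {a..b} \<Longrightarrow> f t \<ge> 0"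
  shows "(\<integral>\<^sup>+t\<in>{a<..<b}. ennreal (f t) \<partial>lborel) = ennreal (F b - F a)"
proof -
  \<comment> \<open>The open interval differs from the closed one by a null set.\<close>
  have "AE t in lborel. t \<noteq> a" "AE t in lborel. t \<noteq> b" by (rule AE_lborel_singleton)+
  then have "AE t in lborel. ennreal (f t) * indicator {a<..<b} t = ennreal (f t) * indicator {a..b} t"
    by eventually_elim (auto simp: indicator_def)
  then have "(\<integral>\<^sup>+t\<in>{a<..<b}. ennreal (f t) \<partial>lborel) = (\<integral>\<^sup>+t\<in>{a..b}. ennreal (f t) \<partial>lborel)"
    by (rule nn_integral_cong_AE)
  also have "\<dots> = ennreal (F b - F a)"
    by (rule nn_integral_FTC_Icc)
       (use assms in \<open>auto simp: has_real_derivative_iff_has_vector_derivative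
          intro: has_vector_derivative_at_within\<close>)
  finally show ?thesis .
qed

lemma nn_iter_omega_m1:
  assumes "0 < x" "x < 1"
  shows "nn_iter [omega_m1] (\<lambda>_. 1) x = ennreal (T_log x)"
proof -
  have "(\<integral>\<^sup>+t\<in>{0<..<x}. ennreal (omega_m1 t) \<partial>lborel) = ennreal (T_log x - T_log 0)"
    by (rule nn_integral_FTC_Ioo)
       (use assms in \<open>auto intro!: T_log_deriv simp: omega_m1_nonneg\<close>)
  then show ?thesis by simp
qed

lemma nn_iter_omega_1:
  assumes "0 < x" "x < 1"
  shows "nn_iter [omega_1] (\<lambda>_. 1) x = ennreal (S_log x)"
proof -
  have "(\<integral>\<^sup>+t\<in>{0<..<x}. ennreal (omega_1 t) \<partial>lborel) = ennreal (S_log x - S_log 0)"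
    by (rule nn_integral_FTC_Ioo)
       (use assms in \<open>auto intro!: S_log_deriv simp: omega_1_nonneg\<close>)
  then show ?thesis by (simp add: S_log_def)
qed

lemma nn_integral_T_log_kernel:
  assumes "0 \<le> t" "t \<le> x" "x < 1"
  shows "(\<integral>\<^sup>+s\<in>{t<..<x}. ennreal (omega_m1 s * ((T_log s - T_log t) ^ j / fact j)) \<partial>lborel)
    = ennreal ((T_log x - T_log t) ^ Suc j / fact (Suc j))"
proof -
  have "(\<integral>\<^sup>+s\<in>{t<..<x}. ennreal (omega_m1 s * ((T_log s - T_log t) ^ j / fact j)) \<partial>lborel)
    = ennreal ((T_log x - T_log t) ^ Suc j / fact (Suc j) - (T_log t - T_log t) ^ Suc j / fact (Suc j))"
  proof (rule nn_integral_FTC_Ioo)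
    fix s assume s: "s \<in> {t..x}"
    show "((\<lambda>s. (T_log s - T_log t) ^ Suc j / fact (Suc j)) has_real_derivative
        omega_m1 s * ((T_log s - T_log t) ^ j / fact j)) (at s)"
      by (rule derivative_eq_intros T_log_deriv refl | use s assms in simp)+
    show "0 \<le> omega_m1 s * ((T_log s - T_log t) ^ j / fact j)"
      using s assms T_log_mono[of t s] by (auto simp: omega_m1_nonneg)
  qed (use assms in auto)
  then show ?thesis by simp
qed

text \<open>Interchanging the outer integration with the one over \<open>t\<close> leaves
  \<open>\<integral>\<^sub>t\<^sup>x (A(s) - A(t))\<^sup>j / j! dA(s)\<close>, which raises the exponent of the kernel by one.\<close>

lemma nn_iter_replicate_omega_m1:
  fixes g :: "real \<Rightarrow> real"
  assumes [measurable]: "g \<in> borel_measurable borel"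
    and w: "\<And>x. 0 < x \<Longrightarrow> x < 1 \<Longrightarrow> nn_iter w (\<lambda>_. 1) x = (\<integral>\<^sup>+t\<in>{0<..<x}. ennreal (g t) \<partial>lborel)"
    and x: "0 < x" "x < 1"
  shows "nn_iter (replicate j omega_m1 @ w) (\<lambda>_. 1) x =
    (\<integral>\<^sup>+t\<in>{0<..<x}. ennreal ((T_log x - T_log t) ^ j / fact j) * ennreal (g t) \<partial>lborel)"
  using x
proof (induction j arbitrary: x)
  case 0
  then show ?case by (simp add: w)
next
  case (Suc j)
  let ?K = "\<lambda>s t. (T_log s - T_log t) ^ j / fact j"
  have "nn_iter (replicate (Suc j) omega_m1 @ w) (\<lambda>_. 1) x =
     (\<integral>\<^sup>+s\<in>{0<..<x}. ennreal (omega_m1 s) *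
        (\<integral>\<^sup>+t\<in>{0<..<s}. ennreal (?K s t) * ennreal (g t) \<partial>lborel) \<partial>lborel)"
    using Suc by (auto intro!: nn_integral_cong simp: indicator_def)
  also have "\<dots> = (\<integral>\<^sup>+s. \<integral>\<^sup>+t. (if 0 < t \<and> t < s \<and> s < x
        then ennreal (omega_m1 s) * ennreal (?K s t) * ennreal (g t) else 0) \<partial>lborel \<partial>lborel)"
  proof (rule nn_integral_cong)
    fix s :: real
    have "ennreal (omega_m1 s) * (\<integral>\<^sup>+t\<in>{0<..<s}. ennreal (?K s t) * ennreal (g t) \<partial>lborel)
          * indicator {0<..<x} s =
        (\<integral>\<^sup>+t. (ennreal (omega_m1 s) * indicator {0<..<x} s) * (ennreal (?K s t) * ennreal (g t) * indicator {0<..<s} t) \<partial>lborel)"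
      by (subst nn_integral_cmult) (auto simp: mult_ac)
    also have "\<dots> = (\<integral>\<^sup>+t. (if 0 < t \<and> t < s \<and> s < x
        then ennreal (omega_m1 s) * ennreal (?K s t) * ennreal (g t) else 0) \<partial>lborel)"
      by (intro nn_integral_cong) (auto simp: indicator_def mult_ac)
    finally show "ennreal (omega_m1 s) * (\<integral>\<^sup>+t\<in>{0<..<s}. ennreal (?K s t) * ennreal (g t) \<partial>lborel)
          * indicator {0<..<x} s = \<dots>" .
  qed
  also have "\<dots> = (\<integral>\<^sup>+t. \<integral>\<^sup>+s. (if 0 < t \<and> t < s \<and> s < x
        then ennreal (omega_m1 s) * ennreal (?K s t) * ennreal (g t) else 0) \<partial>lborel \<partial>lborel)"
    by (rule lborel_pair.Fubini') measurable
  also have "\<dots> = (\<integral>\<^sup>+t\<in>{0<..<x}. ennreal ((T_log x - T_log t) ^ Suc j / fact (Suc j)) * ennreal (g t) \<partial>lborel)"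
  proof (rule nn_integral_cong)
    fix t :: real
    show "(\<integral>\<^sup>+s. (if 0 < t \<and> t < s \<and> s < x
        then ennreal (omega_m1 s) * ennreal (?K s t) * ennreal (g t) else 0) \<partial>lborel) =
       ennreal ((T_log x - T_log t) ^ Suc j / fact (Suc j)) * ennreal (g t) * indicator {0<..<x} t"
    proof (cases "0 < t \<and> t < x")
      case True
      have "(\<integral>\<^sup>+s. (if 0 < t \<and> t < s \<and> s < x
        then ennreal (omega_m1 s) * ennreal (?K s t) * ennreal (g t) else 0) \<partial>lborel) =
        (\<integral>\<^sup>+s. ennreal (g t) * (ennreal (omega_m1 s * ?K s t) * indicator {t<..<x} s) \<partial>lborel)"
      proof (intro nn_integral_cong)
        fix s :: real
        have "0 \<le> omega_m1 s" if "t < s" "s < x"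
          using that True Suc.prems omega_nonneg(3)[of s] by auto
        from ennreal_mult'[OF this, of "?K s t"]
        show "(if 0 < t \<and> t < s \<and> s < x
            then ennreal (omega_m1 s) * ennreal (?K s t) * ennreal (g t) else 0) =
          ennreal (g t) * (ennreal (omega_m1 s * ?K s t) * indicator {t<..<x} s)"
          using True by (auto simp: indicator_def mult.assoc[symmetric] mult.commute[of _ "ennreal (g t)"])
      qed
      also have "\<dots> = ennreal (g t) * ennreal ((T_log x - T_log t) ^ Suc j / fact (Suc j))"
        using nn_integral_T_log_kernel[of t x j] True Suc.prems
        by (subst nn_integral_cmult) auto
      finally show ?thesis using True by (simp add: mult_ac)
    next
      case False
      then have "(\<lambda>s. (if 0 < t \<and> t < s \<and> s < x
        then ennreal (omega_m1 s) * ennreal (?K s t) * ennreal (g t) else 0)) = (\<lambda>s. 0)"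
        by auto
      with False show ?thesis by (simp add: indicator_def)
    qed
  qed
  finally show ?case .
qed

lemma nn_iter_all_omega_m1:
  assumes "0 < x" "x < 1"
  shows "nn_iter (replicate m omega_m1) (\<lambda>_. 1) x = ennreal (T_log x ^ m / fact m)"
  using assms
proof (induction m arbitrary: x)
  case (Suc m)
  have "nn_iter (replicate (Suc m) omega_m1) (\<lambda>_. 1) x =
    (\<integral>\<^sup>+s\<in>{0<..<x}. ennreal (omega_m1 s * ((T_log s - T_log 0) ^ m / fact m)) \<partial>lborel)"
    unfolding replicate_Suc nn_iter.simps
    using Suc by (intro nn_integral_cong)
      (auto simp: indicator_def ennreal_mult'[symmetric] omega_m1_nonneg)
  then show ?case using nn_integral_T_log_kernel[of 0 x m] Suc.prems by simp
qed auto

section \<open>Shuffle regularization\<close>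

lemma poly_tendsto_0_imp_0:
  fixes p :: "real poly"
  assumes "((\<lambda>x. poly p x) \<longlongrightarrow> 0) at_top"
  shows "p = 0"
proof -
  have *: "\<not> lead_coeff q > 0" if "((\<lambda>x. poly q x) \<longlongrightarrow> 0) at_top" for q :: "real poly"
  proof
    assume lc: "lead_coeff q > 0"
    then obtain n where n: "\<forall>x\<ge>n. poly q x \<ge> lead_coeff q" using poly_pinfty_gt_lc by blast
    then have "\<forall>\<^sub>F x in at_top. poly q x \<ge> lead_coeff q"
      unfolding eventually_at_top_linorder by blast
    then have "lead_coeff q \<le> 0"
      using that by (intro tendsto_lowerbound[of _ 0 at_top]) auto
    with lc show False by simp
  qed
  have "((\<lambda>x. poly (- p) x) \<longlongrightarrow> 0) at_top" using tendsto_minus[OF assms] by simp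
  from *[OF this] *[OF assms] show ?thesis
    by (simp add: not_less)
qed

lemma minus_ln_at_right_0: "filterlim (\<lambda>x::real. - ln x) at_top (at_right 0)"
  using ln_at_0 by (simp add: filterlim_uminus_at_top)

text \<open>Uniqueness of the regularization polynomial: a polynomial that tends to 0 along
  \<open>- log \<epsilon> \<rightarrow> \<infinity>\<close> is zero.\<close>

lemma reg_integral_eqI:
  assumes "((\<lambda>\<epsilon>. iterated_integral fs (1 - \<epsilon>) - poly P (- ln \<epsilon>)) \<longlongrightarrow> 0) (at_right 0)"
  shows "reg_integral fs = P"
  unfolding reg_integral_def
proof (rule the_equality[where P = "\<lambda>P. ((\<lambda>\<epsilon>. iterated_integral fs (1 - \<epsilon>) - poly P (- ln \<epsilon>)) \<longlongrightarrow> 0) (at_right 0)"])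
  fix Q :: "real poly"
  assume Q: "((\<lambda>\<epsilon>. iterated_integral fs (1 - \<epsilon>) - poly Q (- ln \<epsilon>)) \<longlongrightarrow> 0) (at_right 0)"
  have "((\<lambda>\<epsilon>. poly (Q - P) (- ln \<epsilon>)) \<longlongrightarrow> 0) (at_right 0)"
    using tendsto_diff[OF assms Q] by (simp add: algebra_simps)
  then have "((\<lambda>v. poly (Q - P) (- ln (exp (- v)))) \<longlongrightarrow> 0) at_top"
  proof (rule filterlim_compose)
    show "filterlim (\<lambda>v::real. exp (- v)) (at_right 0) at_top"
      unfolding filterlim_at
      by (auto intro!: filterlim_compose[OF exp_at_bot] filterlim_uminus_at_bot_at_top)
  qed
  then have "Q - P = 0" by (intro poly_tendsto_0_imp_0) simp
  then show "Q = P" by simp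
qed (rule assms)

lemma T_log_1_minus:
  "0 < \<epsilon> \<Longrightarrow> \<epsilon> < 1 \<Longrightarrow> T_log (1 - \<epsilon>) = ln (2 - \<epsilon>) - ln \<epsilon>"
  by (simp add: T_log_def)

lemma eventually_at_right_0_1: "\<forall>\<^sub>F \<epsilon>::real in at_right 0. 0 < \<epsilon> \<and> \<epsilon> < 1"
  using eventually_at_right_real[of 0 "1::real"] by simp

text \<open>\<open>A(1 - \<epsilon>)\<close> differs from \<open>log 2 - log \<epsilon>\<close> by \<open>O(\<epsilon>)\<close>, which beats every power of the logarithm.\<close>

lemma T_log_power_asymp:
  "((\<lambda>\<epsilon>. T_log (1 - \<epsilon>) ^ p - (ln 2 - ln \<epsilon>) ^ p) \<longlongrightarrow> 0) (at_right 0)"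
proof -
  define D Y :: "real \<Rightarrow> real" where "D = (\<lambda>\<epsilon>. ln (2 - \<epsilon>) - ln 2)" and "Y = (\<lambda>\<epsilon>. ln 2 - ln \<epsilon>)"
  have ev: "\<forall>\<^sub>F \<epsilon>::real in at_right 0. 0 < \<epsilon> \<and> \<epsilon> < 1"
    by (rule eventually_at_right_0_1)
  have D0: "((\<lambda>\<epsilon>. D \<epsilon> * Y \<epsilon> ^ q) \<longlongrightarrow> 0) (at_right 0)" for q
  proof (rule Lim_null_comparison)
    have Ytop: "filterlim Y at_top (at_right 0)"
      unfolding Y_def using minus_ln_at_right_0
      by (simp add: filterlim_tendsto_add_at_top[OF tendsto_const] diff_conv_add_uminus del: add_uminus_conv_diff)
    show "((\<lambda>\<epsilon>. 2 * (Y \<epsilon> ^ q / exp (Y \<epsilon>))) \<longlongrightarrow> 0) (at_right 0)"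
      using tendsto_mult_right_zero[OF filterlim_compose[OF tendsto_power_div_exp_0 Ytop]] by simp
    show "\<forall>\<^sub>F \<epsilon> in at_right 0. norm (D \<epsilon> * Y \<epsilon> ^ q) \<le> 2 * (Y \<epsilon> ^ q / exp (Y \<epsilon>))"
      using ev
    proof eventually_elim
      case (elim \<epsilon>)
      have "ln \<epsilon> \<le> ln 2" using elim by (subst ln_le_cancel_iff) auto
      then have Y: "Y \<epsilon> \<ge> 0" by (simp add: Y_def)
      have "ln 2 - ln (2 - \<epsilon>) = ln (2 / (2 - \<epsilon>))" using elim by (simp add: ln_div)
      also have "\<dots> \<le> 2 / (2 - \<epsilon>) - 1" using elim by (intro ln_le_minus_one) auto
      also have "\<dots> = \<epsilon> / (2 - \<epsilon>)" using elim by (simp add: field_simps)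
      also have "\<dots> \<le> \<epsilon> / 1" using elim by (intro divide_left_mono) auto
      finally have "ln 2 - ln (2 - \<epsilon>) \<le> \<epsilon>" by simp
      moreover have "ln (2 - \<epsilon>) \<le> ln 2" using elim by (subst ln_le_cancel_iff) auto
      ultimately have D: "\<bar>D \<epsilon>\<bar> \<le> \<epsilon>" by (simp add: D_def)
      have "exp (Y \<epsilon>) = 2 / \<epsilon>" using elim by (simp add: Y_def exp_diff)
      then have "2 * (Y \<epsilon> ^ q / exp (Y \<epsilon>)) = \<epsilon> * Y \<epsilon> ^ q" using elim by simp
      then show ?case using D Y by (auto simp: abs_mult intro!: mult_right_mono)
    qed
  qed
  \<comment> \<open>The extra factor \<open>Y\<^sup>q\<close> makes the statement inductive in \<open>p\<close>.\<close>
  have "((\<lambda>\<epsilon>. Y \<epsilon> ^ q * (T_log (1 - \<epsilon>) ^ p - Y \<epsilon> ^ p)) \<longlongrightarrow> 0) (at_right 0)" for q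
  proof (induction p arbitrary: q)
    case (Suc p)
    have "((\<lambda>\<epsilon>. D \<epsilon> * Y \<epsilon> ^ 0 * (Y \<epsilon> ^ q * (T_log (1 - \<epsilon>) ^ p - Y \<epsilon> ^ p)) + D \<epsilon> * Y \<epsilon> ^ (q + p) +
       Y \<epsilon> ^ Suc q * (T_log (1 - \<epsilon>) ^ p - Y \<epsilon> ^ p)) \<longlongrightarrow> 0 * 0 + 0 + 0) (at_right 0)"
      by (intro tendsto_intros D0 Suc.IH)
    moreover have "\<forall>\<^sub>F \<epsilon> in at_right 0. D \<epsilon> * Y \<epsilon> ^ 0 * (Y \<epsilon> ^ q * (T_log (1 - \<epsilon>) ^ p - Y \<epsilon> ^ p)) + D \<epsilon> * Y \<epsilon> ^ (q + p) +
       Y \<epsilon> ^ Suc q * (T_log (1 - \<epsilon>) ^ p - Y \<epsilon> ^ p) = Y \<epsilon> ^ q * (T_log (1 - \<epsilon>) ^ Suc p - Y \<epsilon> ^ Suc p)"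
      using ev
    proof eventually_elim
      case (elim \<epsilon>)
      then have "T_log (1 - \<epsilon>) = D \<epsilon> + Y \<epsilon>" by (simp add: T_log_1_minus D_def Y_def)
      then show ?case by (simp add: algebra_simps power_add)
    qed
    ultimately show ?case by (simp add: tendsto_cong)
  qed simp
  from this[of 0] show ?thesis by (simp add: Y_def)
qed

lemma sum_triangle_swap:
  "(\<Sum>j\<le>k. \<Sum>l\<le>j. f j l) = (\<Sum>l\<le>k. \<Sum>j\<in>{l..k}. f j (l::nat) :: real)"
proof -
  have "(\<Sum>j\<le>k. \<Sum>l\<le>j. f j l) = (\<Sum>j\<le>k. \<Sum>l | l \<in> {..k} \<and> l \<le> j. f j l)"
    by (intro sum.cong) auto
  also have "\<dots> = (\<Sum>l\<le>k. \<Sum>j | j \<in> {..k} \<and> l \<le> j. f j l)"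
    by (rule sum.swap_restrict) auto
  also have "\<dots> = (\<Sum>l\<le>k. \<Sum>j\<in>{l..k}. f j l)"
    by (intro sum.cong) auto
  finally show ?thesis .
qed

text \<open>The binomial theorem for the divided powers \<open>a\<^sup>j / j!\<close>, the form in which it matches the shuffle
  product of powers of one letter.\<close>

lemma divided_power_diff:
  fixes a b :: real
  shows "(a - b) ^ j / fact j = (\<Sum>l\<le>j. (-1) ^ l / (fact l * fact (j - l)) * a ^ (j - l) * b ^ l)"
proof -
  have "(a - b) ^ j / fact j = (- b + a) ^ j / fact j" by simp
  also have "\<dots> = (\<Sum>l\<le>j. real (j choose l) * (- b) ^ l * a ^ (j - l)) / fact j"
    by (subst binomial_ring) simp
  also have "\<dots> = (\<Sum>l\<le>j. (-1) ^ l / (fact l * fact (j - l)) * a ^ (j - l) * b ^ l)"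
    unfolding sum_divide_distrib
  proof (rule sum.cong)
    fix l assume "l \<in> {..j}"
    then have "real (j choose l) = fact j / (fact l * fact (j - l))"
      by (simp add: binomial_fact)
    then show "real (j choose l) * (- b) ^ l * a ^ (j - l) / fact j =
        (-1) ^ l / (fact l * fact (j - l)) * a ^ (j - l) * b ^ l"
      by (simp add: power_minus[of b])
  qed simp
  finally show ?thesis .
qed

definition moment :: "(real \<Rightarrow> real) \<Rightarrow> nat \<Rightarrow> real \<Rightarrow> real" where
  "moment g l x = (LINT t:{0<..<x}|lborel. T_log t ^ l * g t)"

text \<open>The densities to which regularization applies: all moments against powers of \<open>A\<close> are finite,
  so the integral of \<open>g\<close> converges at 1 faster than any power of the logarithm.\<close>

locale log_weight =
  fixes g :: "real \<Rightarrow> real"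
  assumes g_measurable [measurable]: "g \<in> borel_measurable borel"
    and g_nonneg: "\<And>t. 0 < t \<Longrightarrow> t < 1 \<Longrightarrow> g t \<ge> 0"
    and g_integrable: "\<And>l. set_integrable lborel {0<..<1} (\<lambda>t. T_log t ^ l * g t)"
begin

lemma integrable_upto: "x \<le> 1 \<Longrightarrow> set_integrable lborel {0<..<x} (\<lambda>t. T_log t ^ l * g t)"
  by (rule set_integrable_subset[OF g_integrable]) auto

lemma moment_tendsto: "((\<lambda>\<epsilon>. moment g l (1 - \<epsilon>)) \<longlongrightarrow> moment g l 1) (at_right 0)"
  unfolding filterlim_at_right_to_top moment_def set_lebesgue_integral_def
proof (rule integral_dominated_convergence_at_top)
  show "integrable lborel (\<lambda>t. indicator {0<..<1} t *\<^sub>R (T_log t ^ l * g t))"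
    using g_integrable[of l] by (simp add: set_integrable_def)
  show "\<forall>\<^sub>F v in at_top. AE t in lborel. norm (indicator {0<..<1 - inverse v} t *\<^sub>R (T_log t ^ l * g t))
          \<le> indicator {0<..<1} t *\<^sub>R (T_log t ^ l * g t)"
    using eventually_gt_at_top[of 0]
  proof eventually_elim
    case (elim v)
    then have v: "inverse v > 0" by simp
    have "t < 1" if "t < 1 - inverse v" for t using v that by linarith
    then show ?case
      by (intro AE_I2) (auto simp: indicator_def abs_mult g_nonneg T_log_nonneg)
  qed
  show "AE t in lborel. ((\<lambda>v. indicator {0<..<1 - inverse v} t *\<^sub>R (T_log t ^ l * g t)) \<longlongrightarrow>
      indicator {0<..<1} t *\<^sub>R (T_log t ^ l * g t)) at_top"
  proof (rule AE_I2)
    fix t :: real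
    show "((\<lambda>v. indicator {0<..<1 - inverse v} t *\<^sub>R (T_log t ^ l * g t)) \<longlongrightarrow>
      indicator {0<..<1} t *\<^sub>R (T_log t ^ l * g t)) at_top"
    proof (cases "t < 1")
      case True
      have "((\<lambda>v::real. 1 - inverse v) \<longlongrightarrow> 1 - 0) at_top"
        by (intro tendsto_intros tendsto_inverse_0_at_top filterlim_ident)
      then have "\<forall>\<^sub>F v::real in at_top. t < 1 - inverse v"
        using True by (intro order_tendstoD) auto
      then show ?thesis
        by (intro tendsto_eventually) (auto elim!: eventually_mono simp: indicator_def True)
    next
      case False
      have "\<forall>\<^sub>F v::real in at_top. inverse v > 0"
        using eventually_gt_at_top[of 0] by eventually_elim simp
      then have "\<forall>\<^sub>F v::real in at_top. \<not> t < 1 - inverse v"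
        by eventually_elim (use False in linarith)
      then show ?thesis
        using False by (intro tendsto_eventually, elim eventually_mono) (auto simp: indicator_def)
    qed
  qed
qed measurable

lemma moment_diff:
  assumes "0 < x" "x < 1"
  shows "moment g l 1 - moment g l x = (LINT t:{x..<1}|lborel. T_log t ^ l * g t)"
proof -
  have "{0<..<1} = {0<..<x} \<union> {x..<1}" using assms by auto
  moreover have "(LINT t:{0<..<x} \<union> {x..<1}|lborel. T_log t ^ l * g t) =
     (LINT t:{0<..<x}|lborel. T_log t ^ l * g t) + (LINT t:{x..<1}|lborel. T_log t ^ l * g t)"
    by (rule set_integral_Un)
       (use assms in \<open>auto intro: integrable_upto set_integrable_subset[OF g_integrable]\<close>)
  ultimately show ?thesis by (simp add: moment_def)
qed

text \<open>The truncated moment may be completed even when multiplied by a divergent power of \<open>A(x)\<close>: since \<open>A\<close>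
  increases, \<open>A(x)\<^sup>p \<integral>\<^sub>x\<^sup>1 A\<^sup>l g \<le> \<integral>\<^sub>x\<^sup>1 A\<^sup>p\<^sup>+\<^sup>l g\<close>, which is the tail of a convergent integral.\<close>

lemma T_log_power_moment:
  "((\<lambda>\<epsilon>. T_log (1 - \<epsilon>) ^ p * moment g l (1 - \<epsilon>) - (ln 2 - ln \<epsilon>) ^ p * moment g l 1) \<longlongrightarrow> 0) (at_right 0)"
proof -
  have ev: "\<forall>\<^sub>F \<epsilon>::real in at_right 0. 0 < \<epsilon> \<and> \<epsilon> < 1"
    by (rule eventually_at_right_0_1)
  have 1: "((\<lambda>\<epsilon>. T_log (1 - \<epsilon>) ^ p * (moment g l 1 - moment g l (1 - \<epsilon>))) \<longlongrightarrow> 0) (at_right 0)"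
  proof (rule Lim_null_comparison)
    show "((\<lambda>\<epsilon>. moment g (p + l) 1 - moment g (p + l) (1 - \<epsilon>)) \<longlongrightarrow> 0) (at_right 0)"
      using tendsto_diff[OF tendsto_const[of "moment g (p + l) 1"] moment_tendsto[of "p + l"]] by simp
    show "\<forall>\<^sub>F \<epsilon> in at_right 0. norm (T_log (1 - \<epsilon>) ^ p * (moment g l 1 - moment g l (1 - \<epsilon>)))
        \<le> moment g (p + l) 1 - moment g (p + l) (1 - \<epsilon>)"
      using ev
    proof eventually_elim
      case (elim \<epsilon>)
      define x where "x = 1 - \<epsilon>"
      have x: "0 < x" "x < 1" using elim by (auto simp: x_def)
      have nn: "T_log x ^ p * (LINT t:{x..<1}|lborel. T_log t ^ l * g t) \<ge> 0"
        unfolding set_lebesgue_integral_def using x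
        by (intro mult_nonneg_nonneg Bochner_Integration.integral_nonneg)
           (auto simp: indicator_def T_log_nonneg g_nonneg)
      have "T_log x ^ p * (LINT t:{x..<1}|lborel. T_log t ^ l * g t) =
          (LINT t:{x..<1}|lborel. T_log x ^ p * (T_log t ^ l * g t))" by simp
      also have "\<dots> \<le> (LINT t:{x..<1}|lborel. T_log t ^ (p + l) * g t)"
      proof (rule set_integral_mono)
        show "set_integrable lborel {x..<1} (\<lambda>t. T_log x ^ p * (T_log t ^ l * g t))"
          by (intro set_integrable_mult_right set_integrable_subset[OF g_integrable]) (use x in auto)
        show "set_integrable lborel {x..<1} (\<lambda>t. T_log t ^ (p + l) * g t)"
          by (intro set_integrable_subset[OF g_integrable]) (use x in auto)
        fix t assume t: "t \<in> {x..<1}"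
        then have "T_log x ^ p \<le> T_log t ^ p"
          using x by (intro power_mono T_log_mono T_log_nonneg) auto
        then show "T_log x ^ p * (T_log t ^ l * g t) \<le> T_log t ^ (p + l) * g t"
          using t x by (auto simp: power_add mult.assoc T_log_nonneg g_nonneg intro!: mult_right_mono)
      qed
      finally show ?case using nn moment_diff[OF x] by (simp add: x_def)
    qed
  qed
  have "((\<lambda>\<epsilon>. (T_log (1 - \<epsilon>) ^ p - (ln 2 - ln \<epsilon>) ^ p) * moment g l 1 -
      T_log (1 - \<epsilon>) ^ p * (moment g l 1 - moment g l (1 - \<epsilon>))) \<longlongrightarrow> 0 * moment g l 1 - 0) (at_right 0)"
    by (intro tendsto_intros T_log_power_asymp 1)
  then show ?thesis by (simp add: algebra_simps)
qed

definition reg_poly :: "nat \<Rightarrow> real poly" where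
  "reg_poly j = (\<Sum>l\<le>j. smult ((-1) ^ l / (fact l * fact (j - l)) * moment g l 1) ([:ln 2, 1:] ^ (j - l)))"

lemma reg_integral_replicate_omega_m1:
  assumes letters: "set w \<subseteq> {omega_0, omega_1, omega_m1}"
    and w: "\<And>x. 0 < x \<Longrightarrow> x < 1 \<Longrightarrow> nn_iter w (\<lambda>_. 1) x = (\<integral>\<^sup>+t\<in>{0<..<x}. ennreal (g t) \<partial>lborel)"
  shows "reg_integral (replicate j omega_m1 @ w) = reg_poly j"
proof (rule reg_integral_eqI)
  have I: "iterated_integral (replicate j omega_m1 @ w) x =
      (\<Sum>l\<le>j. (-1) ^ l / (fact l * fact (j - l)) * (T_log x ^ (j - l) * moment g l x))"
    if x: "0 < x" "x < 1" for x
  proof -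
    have "iterated_integral (replicate j omega_m1 @ w) x =
       enn2real (\<integral>\<^sup>+t\<in>{0<..<x}. ennreal ((T_log x - T_log t) ^ j / fact j) * ennreal (g t) \<partial>lborel)"
      using letters x
      by (subst iterated_integral_eq_nn_iter) (auto simp: nn_iter_replicate_omega_m1[OF g_measurable w])
    also have "(\<integral>\<^sup>+t\<in>{0<..<x}. ennreal ((T_log x - T_log t) ^ j / fact j) * ennreal (g t) \<partial>lborel) =
       (\<integral>\<^sup>+t. ennreal (indicator {0<..<x} t *\<^sub>R ((T_log x - T_log t) ^ j / fact j * g t)) \<partial>lborel)"
      using x
      by (intro nn_integral_cong) (auto simp: indicator_def ennreal_mult' g_nonneg ennreal_mult''[symmetric])
    also have "enn2real \<dots> = (LINT t:{0<..<x}|lborel. (T_log x - T_log t) ^ j / fact j * g t)"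
      unfolding set_lebesgue_integral_def
      by (rule integral_eq_nn_integral[symmetric])
         (use x in \<open>auto simp: indicator_def g_nonneg T_log_mono intro!: AE_I2\<close>)
    also have "\<dots> = (LINT t:{0<..<x}|lborel. \<Sum>l\<le>j. (-1) ^ l / (fact l * fact (j - l)) * T_log x ^ (j - l) * (T_log t ^ l * g t))"
      by (simp only: divided_power_diff sum_distrib_right mult.assoc)
    also have "\<dots> = (\<Sum>l\<le>j. (LINT t:{0<..<x}|lborel. (-1) ^ l / (fact l * fact (j - l)) * T_log x ^ (j - l) * (T_log t ^ l * g t)))"
      unfolding set_lebesgue_integral_def scaleR_sum_right
      by (rule Bochner_Integration.integral_sum,
          fold set_integrable_def, intro set_integrable_mult_right integrable_upto)
         (use x in simp)
    also have "\<dots> = (\<Sum>l\<le>j. (-1) ^ l / (fact l * fact (j - l)) * (T_log x ^ (j - l) * moment g l x))"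
      by (intro sum.cong refl, subst set_integral_mult_right) (simp add: moment_def)
    finally show ?thesis .
  qed
  have P: "poly (reg_poly j) (- ln \<epsilon>) =
     (\<Sum>l\<le>j. (-1) ^ l / (fact l * fact (j - l)) * ((ln 2 - ln \<epsilon>) ^ (j - l) * moment g l 1))" for \<epsilon>
    by (simp add: reg_poly_def poly_sum mult_ac)
  have "((\<lambda>\<epsilon>. \<Sum>l\<le>j. (-1) ^ l / (fact l * fact (j - l)) *
      (T_log (1 - \<epsilon>) ^ (j - l) * moment g l (1 - \<epsilon>) - (ln 2 - ln \<epsilon>) ^ (j - l) * moment g l 1))
       \<longlongrightarrow> (\<Sum>l\<le>j. (-1) ^ l / (fact l * fact (j - l)) * 0)) (at_right 0)"
    by (intro tendsto_intros T_log_power_moment) auto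
  then have "((\<lambda>\<epsilon>. \<Sum>l\<le>j. (-1) ^ l / (fact l * fact (j - l)) *
      (T_log (1 - \<epsilon>) ^ (j - l) * moment g l (1 - \<epsilon>) - (ln 2 - ln \<epsilon>) ^ (j - l) * moment g l 1))
       \<longlongrightarrow> 0) (at_right 0)" by simp
  moreover have "\<forall>\<^sub>F \<epsilon>::real in at_right 0. 0 < \<epsilon> \<and> \<epsilon> < 1"
    by (rule eventually_at_right_0_1)
  then have "\<forall>\<^sub>F \<epsilon> in at_right 0. (\<Sum>l\<le>j. (-1) ^ l / (fact l * fact (j - l)) *
      (T_log (1 - \<epsilon>) ^ (j - l) * moment g l (1 - \<epsilon>) - (ln 2 - ln \<epsilon>) ^ (j - l) * moment g l 1)) =
      iterated_integral (replicate j omega_m1 @ w) (1 - \<epsilon>) - poly (reg_poly j) (- ln \<epsilon>)"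
    by eventually_elim (simp only: I P sum_subtractf right_diff_distrib, simp add: I)
  ultimately show "((\<lambda>\<epsilon>. iterated_integral (replicate j omega_m1 @ w) (1 - \<epsilon>) - poly (reg_poly j) (- ln \<epsilon>)) \<longlongrightarrow> 0) (at_right 0)"
    by (simp add: tendsto_cong)
qed

text \<open>After interchanging the sums, the coefficient of the \<open>l\<close>-th moment is a multiple of
  \<open>(1 - 1)\<^sup>k\<^sup>-\<^sup>l\<close>, so only \<open>l = k\<close> survives.  This is why the symmetric value is free of \<open>X\<close>.\<close>

lemma alternating_sum_reg_poly:
  "(\<Sum>j\<le>k. (-1) ^ j * reg_poly j * smult (1 / fact (k - j)) ([:ln 2, 1:] ^ (k - j))) = [:moment g k 1 / fact k:]"
proof -
  have "poly (\<Sum>j\<le>k. (-1) ^ j * reg_poly j * smult (1 / fact (k - j)) ([:ln 2, 1:] ^ (k - j))) x = moment g k 1 / fact k"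
    for x
  proof -
    define y where "y = ln 2 + x"
    have "poly (\<Sum>j\<le>k. (-1) ^ j * reg_poly j * smult (1 / fact (k - j)) ([:ln 2, 1:] ^ (k - j))) x
      = (\<Sum>j\<le>k. \<Sum>l\<le>j. (-1) ^ j * ((-1) ^ l / (fact l * fact (j - l)) * moment g l 1 * y ^ (j - l)) * (y ^ (k - j) / fact (k - j)))"
      by (simp add: poly_sum reg_poly_def y_def[symmetric] sum_distrib_left sum_distrib_right mult_ac)
    also have "\<dots> = (\<Sum>j\<le>k. \<Sum>l\<le>j. moment g l 1 / fact l * y ^ (k - l) * ((-1) ^ (j - l) / (fact (j - l) * fact (k - j))))"
    proof (intro sum.cong refl)
      fix j l assume "j \<in> {..k}" "l \<in> {..j}"
      then have "y ^ (j - l) * y ^ (k - j) = y ^ (k - l)" "(-1) ^ j * (-1) ^ l = ((-1) ^ (j - l) :: real)"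
        by (auto simp: power_add[symmetric] minus_one_power_iff)
      then show "(-1) ^ j * ((-1) ^ l / (fact l * fact (j - l)) * moment g l 1 * y ^ (j - l)) * (y ^ (k - j) / fact (k - j))
         = moment g l 1 / fact l * y ^ (k - l) * ((-1) ^ (j - l) / (fact (j - l) * fact (k - j)))"
        by (simp add: field_simps)
    qed
    also have "\<dots> = (\<Sum>l\<le>k. \<Sum>j\<in>{l..k}. moment g l 1 / fact l * y ^ (k - l) * ((-1) ^ (j - l) / (fact (j - l) * fact (k - j))))"
      by (rule sum_triangle_swap)
    also have "\<dots> = (\<Sum>l\<le>k. moment g l 1 / fact l * y ^ (k - l) * (if l = k then 1 else 0))"
    proof (intro sum.cong refl)
      fix l assume l: "l \<in> {..k}"
      have "(\<Sum>j\<in>{l..k}. (-1) ^ (j - l) / (fact (j - l) * fact (k - j))) =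
          (\<Sum>i\<le>k - l. (-1) ^ i / (fact i * fact (k - l - i)) * 1 ^ (k - l - i) * (1::real) ^ i)"
        using l by (intro sum.reindex_bij_witness[of _ "\<lambda>i. i + l" "\<lambda>j. j - l"]) auto
      also have "\<dots> = (1 - 1) ^ (k - l) / fact (k - l)" by (rule divided_power_diff[symmetric])
      also have "\<dots> = (if l = k then 1 else 0)" using l by auto
      finally show "(\<Sum>j\<in>{l..k}. moment g l 1 / fact l * y ^ (k - l) * ((-1) ^ (j - l) / (fact (j - l) * fact (k - j))))
         = moment g l 1 / fact l * y ^ (k - l) * (if l = k then 1 else 0)"
        by (simp only: sum_distrib_left[symmetric])
    qed
    also have "\<dots> = moment g k 1 / fact k"
      by (simp add: if_distrib cong: if_cong)
    finally show ?thesis .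
  qed
  then show ?thesis by (intro poly_eqI_degree_lead_coeff poly_ext) auto
qed

end

lemma reg_integral_all_omega_m1:
  "reg_integral (replicate m omega_m1) = smult (1 / fact m) ([:ln 2, 1:] ^ m)"
proof (rule reg_integral_eqI)
  have "((\<lambda>\<epsilon>. (T_log (1 - \<epsilon>) ^ m - (ln 2 - ln \<epsilon>) ^ m) / fact m) \<longlongrightarrow> 0 / fact m) (at_right 0)"
    by (intro tendsto_intros T_log_power_asymp) simp
  moreover have "\<forall>\<^sub>F \<epsilon>::real in at_right 0. 0 < \<epsilon> \<and> \<epsilon> < 1"
    by (rule eventually_at_right_0_1)
  then have "\<forall>\<^sub>F \<epsilon>::real in at_right 0. (T_log (1 - \<epsilon>) ^ m - (ln 2 - ln \<epsilon>) ^ m) / fact m =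
      iterated_integral (replicate m omega_m1) (1 - \<epsilon>) - poly (smult (1 / fact m) ([:ln 2, 1:] ^ m)) (- ln \<epsilon>)"
  proof eventually_elim
    case (elim \<epsilon>)
    have "iterated_integral (replicate m omega_m1) (1 - \<epsilon>) = T_log (1 - \<epsilon>) ^ m / fact m"
      using elim by (subst iterated_integral_eq_nn_iter) (auto simp: nn_iter_all_omega_m1 T_log_nonneg)
    then show ?case by (simp add: diff_divide_distrib poly_power)
  qed
  ultimately show "((\<lambda>\<epsilon>. iterated_integral (replicate m omega_m1) (1 - \<epsilon>) -
      poly (smult (1 / fact m) ([:ln 2, 1:] ^ m)) (- ln \<epsilon>)) \<longlongrightarrow> 0) (at_right 0)"
    by (simp add: tendsto_cong)
qed

section \<open>Harmonic numbers with odd denominators\<close>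

text \<open>For even \<open>N\<close> this is the sum of \<open>1/m\<close> over the odd \<open>m < N\<close>; for odd \<open>N\<close> it is the interpolating value
  \<open>log 2 + H / 2\<close> with \<open>H\<close> the harmonic number of \<open>(N - 1) / 2\<close>.\<close>

definition odd_harm :: "nat \<Rightarrow> real" where
  "odd_harm N = (\<Sum>m. 1 / real (2 * m + 1) - 1 / real (2 * m + 1 + N))"

lemma odd_harm_telescope:
  "(\<lambda>m. 1 / real (2 * m + 1 + N) - 1 / real (2 * m + 3 + N)) sums (1 / real (N + 1))"
proof -
  have "(\<lambda>m. 1 / real (2 * m + 1 + N)) \<longlonglongrightarrow> 0" by real_asymp
  from telescope_sums'[OF this] show ?thesis by (simp add: add_ac)
qed

lemma odd_harm_sums_aux:
  "\<exists>c. (\<lambda>m. 1 / real (2 * m + 1) - 1 / real (2 * m + 1 + N)) sums c"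
proof (induction N rule: induct_nat_012)
  case 0
  then show ?case by (auto intro!: exI[of _ 0])
next
  case 1
  show ?case using alternating_harmonic_series_sums' by (auto simp: inverse_eq_divide add_ac)
next
  case (ge2 N)
  then obtain c where "(\<lambda>m. 1 / real (2 * m + 1) - 1 / real (2 * m + 1 + N)) sums c" by blast
  from sums_add[OF this odd_harm_telescope[of N]] show ?case by (auto simp: add_ac)
qed

lemma odd_harm_sums: "(\<lambda>m. 1 / real (2 * m + 1) - 1 / real (2 * m + 1 + N)) sums odd_harm N"
  using odd_harm_sums_aux[of N] unfolding odd_harm_def by (auto simp: sums_iff)

lemma odd_harm_0 [simp]: "odd_harm 0 = 0"
  by (simp add: odd_harm_def)

lemma odd_harm_1: "odd_harm (Suc 0) = ln 2"
  using sums_unique2[OF odd_harm_sums[of 1]] alternating_harmonic_series_sums'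
  by (auto simp: inverse_eq_divide add_ac)

lemma odd_harm_add_2: "odd_harm (N + 2) = odd_harm N + 1 / real (N + 1)"
proof -
  from sums_add[OF odd_harm_sums[of N] odd_harm_telescope[of N]]
  have "(\<lambda>m. 1 / real (2 * m + 1) - 1 / real (2 * m + 1 + (N + 2))) sums (odd_harm N + 1 / real (N + 1))"
    by (simp add: add_ac)
  from sums_unique2[OF odd_harm_sums this] show ?thesis .
qed

lemma odd_harm_nonneg: "odd_harm N \<ge> 0"
  by (rule sums_le[OF _ sums_zero odd_harm_sums[of N]]) (simp add: frac_le)

text \<open>The true order is \<open>log N\<close>; a square root is enough for the convergence of the sums of
  \<open>c(N) / N\<^sup>k\<^sup>+\<^sup>1\<close> down to \<open>k = 1\<close>.\<close>

lemma odd_harm_le_sqrt: "odd_harm N \<le> 2 * sqrt N"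
proof (induction N rule: induct_nat_012)
  case 1
  have "ln 2 \<le> (2::real)" using ln_le_minus_one[of "2::real"] by simp
  then show ?case by (simp add: odd_harm_1)
next
  case (ge2 N)
  have "1 / real (N + 1) \<le> 2 * (sqrt (N + 2) - sqrt N)"
  proof -
    have le: "sqrt N \<le> sqrt (N + 2)" by simp
    have "(sqrt (N + 2) - sqrt N) * (sqrt (N + 2) + sqrt N) = 2"
      by (simp add: algebra_simps)
    then have "2 * (sqrt (N + 2) - sqrt N) = 4 / (sqrt (N + 2) + sqrt N)"
      by (simp add: field_simps add_nonneg_eq_0_iff)
    also have "\<dots> \<ge> 4 / (4 * real (N + 1))"
    proof (rule divide_left_mono)
      have "sqrt (N + 2) \<le> sqrt ((real N + 2)\<^sup>2)"
        by (intro real_sqrt_le_mono) (simp add: power2_eq_square algebra_simps)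
      then have le': "sqrt (N + 2) \<le> real N + 2" by simp
      have "sqrt (N + 2) + sqrt N \<le> (real N + 2) + (real N + 2)"
        by (rule add_mono[OF le' order_trans[OF le le']])
      also have "\<dots> \<le> 4 * real (N + 1)" by simp
      finally show "sqrt (N + 2) + sqrt N \<le> 4 * real (N + 1)" .
    qed (auto intro!: mult_pos_pos add_pos_nonneg)
    also have "4 / (4 * real (N + 1)) = 1 / real (N + 1)" by (simp add: field_simps)
    finally show ?thesis .
  qed
  then show ?case using ge2 odd_harm_add_2[of N] by simp
qed auto

lemma summable_odd_harm:
  assumes "k \<ge> 1"
  shows "summable (\<lambda>n. odd_harm (Suc n) / real (Suc n) ^ (k + 1))"
proof (rule summable_comparison_test')
  have "summable (\<lambda>n. 2 * real n powr (- 3 / 2))"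
    by (intro summable_mult) (simp add: summable_real_powr_iff)
  then show "summable (\<lambda>n. 2 * real (Suc n) powr (- 3 / 2))"
    by (subst summable_Suc_iff[of "\<lambda>n. 2 * real n powr (- 3 / 2)"])
  fix n :: nat
  let ?N = "real (Suc n)"
  have N: "?N \<ge> 1" by simp
  have "odd_harm (Suc n) / ?N ^ (k + 1) \<le> 2 * sqrt ?N / ?N ^ 2"
    using odd_harm_le_sqrt[of "Suc n"] assms N
    by (intro frac_le power_increasing) auto
  also have "\<dots> = 2 * ?N powr (1/2 - 2)"
    using N by (subst powr_diff) (simp add: powr_half_sqrt)
  finally show "norm (odd_harm (Suc n) / ?N ^ (k + 1)) \<le> 2 * ?N powr (- 3 / 2)"
    using odd_harm_nonneg[of "Suc n"] by simp
qed

lemma sums_minus_ln_1_minus: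
  fixes s :: real
  assumes "\<bar>s\<bar> < 1"
  shows "(\<lambda>n. s ^ Suc n / real (Suc n)) sums (- ln (1 - s))"
proof -
  have "(\<lambda>n. - ((- (- s)) ^ n) / real n) sums ln (1 + - s)"
    using assms by (intro ln_series') simp
  from sums_minus[OF this] have "(\<lambda>n. s ^ n / real n) sums (- ln (1 - s))" by simp
  then show ?thesis
    using sums_Suc_iff[of "\<lambda>n. s ^ n / real n" "- ln (1 - s)"] by simp
qed

text \<open>Multiplying by \<open>1 - s\<^sup>2\<close> turns the coefficients into \<open>c(N + 2) - c(N) = 1 / (N + 1)\<close>, hence the
  series into a logarithm.\<close>

lemma odd_harm_power_series:
  assumes s: "\<bar>s\<bar> < 1"
  shows "(\<lambda>n. odd_harm (Suc n) * s ^ n) sums ((ln 2 - ln (1 - s)) / (1 - s\<^sup>2))"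
proof -
  have "summable (\<lambda>n. odd_harm (Suc n) * s ^ n)"
  proof (rule summable_comparison_test')
    show "summable (\<lambda>n. 2 * (of_nat (Suc n) * \<bar>s\<bar> ^ n))"
      using geometric_deriv_sums[of "\<bar>s\<bar>"] s by (intro summable_mult) (auto simp: sums_iff)
    fix n :: nat
    have "sqrt (Suc n) \<le> sqrt ((real (Suc n))\<^sup>2)" by (intro real_sqrt_le_mono) (simp add: power2_eq_square)
    then have "sqrt (Suc n) \<le> real (Suc n)" by simp
    then have "\<bar>odd_harm (Suc n)\<bar> \<le> 2 * real (Suc n)"
      using odd_harm_le_sqrt[of "Suc n"] odd_harm_nonneg[of "Suc n"] by simp
    then show "norm (odd_harm (Suc n) * s ^ n) \<le> 2 * (of_nat (Suc n) * \<bar>s\<bar> ^ n)"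
      using mult_right_mono[of "\<bar>odd_harm (Suc n)\<bar>" "2 * real (Suc n)" "\<bar>s\<bar> ^ n"]
      by (simp add: abs_mult power_abs algebra_simps)
  qed
  then obtain S where S: "(\<lambda>n. odd_harm (Suc n) * s ^ n) sums S" by blast
  have s1: "(\<lambda>n. odd_harm n * s ^ n) sums (s * S)"
    using sums_Suc_iff[of "\<lambda>n. odd_harm n * s ^ n" "s * S"] sums_mult[OF S, of s] by (simp add: mult_ac)
  have s2: "(\<lambda>n. odd_harm (Suc (Suc n)) * s ^ Suc n) sums (S - ln 2)"
    using sums_Suc_iff[of "\<lambda>n. odd_harm (Suc n) * s ^ n" "S - ln 2"] S by (simp add: odd_harm_1)
  from sums_diff[OF s2 sums_mult[OF s1, of s]]
  have "(\<lambda>n. s ^ Suc n / real (Suc n)) sums (S - ln 2 - s * (s * S))"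
  proof (rule sums_cong[THEN iffD1, rotated])
    fix n
    show "odd_harm (Suc (Suc n)) * s ^ Suc n - s * (odd_harm n * s ^ n) = s ^ Suc n / real (Suc n)"
      using odd_harm_add_2[of n] by (simp add: field_simps)
  qed
  moreover have "(\<lambda>n. s ^ Suc n / real (Suc n)) sums (- ln (1 - s))"
    by (rule sums_minus_ln_1_minus[OF s])
  ultimately have "S - ln 2 - s * (s * S) = - ln (1 - s)" by (rule sums_unique2)
  moreover have "1 - s\<^sup>2 \<noteq> 0" using s by (metis abs_square_less_1 diff_gt_0_iff_gt less_irrefl)
  ultimately have "S = (ln 2 - ln (1 - s)) / (1 - s\<^sup>2)"
    by (simp add: field_simps power2_eq_square)
  with S show ?thesis by simp
qed

lemma alternating_power_series_parts:
  fixes a :: "nat \<Rightarrow> real"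
  assumes "(\<lambda>n. a n * s ^ n) sums S" "(\<lambda>n. a n * (- s) ^ n) sums S'"
  shows "(\<lambda>n. if even n then 2 * a n * s ^ n else 0) sums (S + S')"
    "(\<lambda>n. if odd n then 2 * a n * s ^ n else 0) sums (S - S')"
proof -
  have "(\<lambda>n. a n * s ^ n + a n * (- s) ^ n) = (\<lambda>n. if even n then 2 * a n * s ^ n else 0)"
    "(\<lambda>n. a n * s ^ n - a n * (- s) ^ n) = (\<lambda>n. if odd n then 2 * a n * s ^ n else 0)"
    by (auto simp: fun_eq_iff)
  with sums_add[OF assms] sums_diff[OF assms]
  show "(\<lambda>n. if even n then 2 * a n * s ^ n else 0) sums (S + S')"
    "(\<lambda>n. if odd n then 2 * a n * s ^ n else 0) sums (S - S')" by simp_all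
qed

section \<open>Moments of the two logarithms\<close>

lemma nn_integral_power_exp:
  assumes "N > 0"
  shows "(\<integral>\<^sup>+v\<in>{0<..}. ennreal (v ^ k / fact k * exp (- (N * v))) \<partial>lborel) = ennreal (1 / N ^ (k + 1))"
proof -
  have "ennreal (fact k) = (\<integral>\<^sup>+v\<in>{0..}. ennreal (v ^ k * exp (- v)) \<partial>lborel)"
    using nn_intergal_power_times_exp_Ici[of k] by simp
  also have "\<dots> = ennreal \<bar>N\<bar> * (\<integral>\<^sup>+v. ennreal ((0 + N * v) ^ k * exp (- (0 + N * v))) * indicator {0..} (0 + N * v) \<partial>lborel)"
    using assms by (subst nn_integral_real_affine[of _ N 0]) auto
  also have "\<dots> = (\<integral>\<^sup>+v. ennreal N * (ennreal ((N * v) ^ k * exp (- (N * v))) * indicator {0..} v) \<partial>lborel)"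
    using assms by (subst nn_integral_cmult) (auto simp: indicator_def zero_le_mult_iff cong: if_cong)
  also have "\<dots> = (\<integral>\<^sup>+v. ennreal (fact k * N ^ (k + 1)) * (ennreal (v ^ k / fact k * exp (- (N * v))) * indicator {0<..} v) \<partial>lborel)"
  proof (rule nn_integral_cong_AE)
    have "AE v in lborel. v \<noteq> (0::real)" by (rule AE_lborel_singleton)
    then show "AE v in lborel. ennreal N * (ennreal ((N * v) ^ k * exp (- (N * v))) * indicator {0..} v) =
       ennreal (fact k * N ^ (k + 1)) * (ennreal (v ^ k / fact k * exp (- (N * v))) * indicator {0<..} v)"
    proof eventually_elim
      case (elim v)
      then show ?case using assms
        by (auto simp: indicator_def ennreal_mult'[symmetric] power_mult_distrib field_simps)
    qed
  qed
  also have "\<dots> = ennreal (fact k * N ^ (k + 1)) * (\<integral>\<^sup>+v\<in>{0<..}. ennreal (v ^ k / fact k * exp (- (N * v))) \<partial>lborel)"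
    by (subst nn_integral_cmult) auto
  finally have *: "ennreal (fact k) = ennreal (fact k * N ^ (k + 1)) * (\<integral>\<^sup>+v\<in>{0<..}. ennreal (v ^ k / fact k * exp (- (N * v))) \<partial>lborel)" .
  define I where "I = (\<integral>\<^sup>+v\<in>{0<..}. ennreal (v ^ k / fact k * exp (- (N * v))) \<partial>lborel)"
  have "I = ennreal (1 / (fact k * N ^ (k + 1))) * (ennreal (fact k * N ^ (k + 1)) * I)"
    using assms by (subst mult.assoc[symmetric], subst ennreal_mult'[symmetric]) auto
  also have "\<dots> = ennreal (1 / (fact k * N ^ (k + 1))) * ennreal (fact k)"
    by (simp add: *[folded I_def])
  also have "\<dots> = ennreal (1 / N ^ (k + 1))"
    using assms by (subst ennreal_mult'[symmetric]) auto
  finally show ?thesis by (simp add: I_def)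
qed

text \<open>The Mellin transform of an exponential series is its Dirichlet series.  Nonnegative coefficients
  allow termwise integration.\<close>

lemma mellin_dirichlet:
  fixes a :: "nat \<Rightarrow> real"
  assumes a: "\<And>n. a n \<ge> 0"
    and F: "\<And>v. v > 0 \<Longrightarrow> (\<lambda>n. a n * exp (- (real (Suc n) * v))) sums F v"
    and [measurable]: "F \<in> borel_measurable borel"
    and S: "(\<lambda>n. a n / real (Suc n) ^ (k + 1)) sums S"
  shows "set_integrable lborel {0<..} (\<lambda>v. v ^ k / fact k * F v)"
    and "(LINT v:{0<..}|lborel. v ^ k / fact k * F v) = S"
proof -
  have S0: "S \<ge> 0" using suminf_nonneg[of "\<lambda>n. a n / real (Suc n) ^ (k + 1)"] S a
    by (auto simp: sums_iff)
  have F0: "F v \<ge> 0" if "v > 0" for v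
    using F[OF that] suminf_nonneg[of "\<lambda>n. a n * exp (- (real (Suc n) * v))"] a
    by (auto simp: sums_iff)
  have "(\<integral>\<^sup>+v. ennreal (indicator {0<..} v *\<^sub>R (v ^ k / fact k * F v)) \<partial>lborel) =
     (\<integral>\<^sup>+v. (\<Sum>n. ennreal (a n) * (ennreal (v ^ k / fact k * exp (- (real (Suc n) * v))) * indicator {0<..} v)) \<partial>lborel)"
  proof (rule nn_integral_cong)
    fix v :: real
    show "ennreal (indicator {0<..} v *\<^sub>R (v ^ k / fact k * F v)) =
       (\<Sum>n. ennreal (a n) * (ennreal (v ^ k / fact k * exp (- (real (Suc n) * v))) * indicator {0<..} v))"
    proof (cases "v > 0")
      case True
      have "(\<lambda>n. v ^ k / fact k * (a n * exp (- (real (Suc n) * v)))) sums (v ^ k / fact k * F v)"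
        by (rule sums_mult[OF F[OF True]])
      then have "(\<Sum>n. ennreal (v ^ k / fact k * (a n * exp (- (real (Suc n) * v))))) = ennreal (v ^ k / fact k * F v)"
        using True a by (intro suminf_ennreal_eq) auto
      also have "(\<lambda>n. ennreal (v ^ k / fact k * (a n * exp (- (real (Suc n) * v))))) =
          (\<lambda>n. ennreal (a n) * ennreal (v ^ k / fact k * exp (- (real (Suc n) * v))))"
        using a by (intro ext) (simp add: ennreal_mult'[symmetric] mult_ac)
      finally show ?thesis using True by simp
    qed simp
  qed
  also have "\<dots> = (\<Sum>n. ennreal (a n) * ennreal (1 / real (Suc n) ^ (k + 1)))"
    by (subst nn_integral_suminf, simp, subst nn_integral_cmult, simp, subst nn_integral_power_exp) simp_all
  also have "\<dots> = (\<Sum>n. ennreal (a n / real (Suc n) ^ (k + 1)))"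
    using a by (simp add: ennreal_mult'[symmetric])
  also have "\<dots> = ennreal S"
    using S a by (intro suminf_ennreal_eq) auto
  finally have nn: "(\<integral>\<^sup>+v. ennreal (indicator {0<..} v *\<^sub>R (v ^ k / fact k * F v)) \<partial>lborel) = ennreal S" .
  have "has_bochner_integral lborel (\<lambda>v. indicator {0<..} v *\<^sub>R (v ^ k / fact k * F v)) S"
    by (rule has_bochner_integral_nn_integral[OF _ _ S0 nn]) (auto simp: indicator_def F0 intro!: AE_I2)
  then show "set_integrable lborel {0<..} (\<lambda>v. v ^ k / fact k * F v)"
    and "(LINT v:{0<..}|lborel. v ^ k / fact k * F v) = S"
    by (auto simp: set_integrable_def set_lebesgue_integral_def has_bochner_integral_iff)
qed

text \<open>\<open>tanh (v / 2)\<close>, the inverse function of \<open>A\<close>.\<close>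

definition half_tanh :: "real \<Rightarrow> real" where
  "half_tanh v = (1 - exp (- v)) / (1 + exp (- v))"

text \<open>\<open>1 / sinh v\<close>, the logarithmic derivative of \<open>tanh (v / 2)\<close>.\<close>

definition half_csch :: "real \<Rightarrow> real" where
  "half_csch v = 2 * exp (- v) / (1 - exp (- (2 * v)))"

lemma half_csch_eq: "half_csch v = 2 * exp (- v) / ((1 - exp (- v)) * (1 + exp (- v)))"
proof -
  have "exp (- (2 * v)) = exp (- v) * exp (- v)" by (simp add: exp_add[symmetric])
  then show ?thesis by (simp add: half_csch_def algebra_simps)
qed

lemma half_tanh_bounds:
  assumes "v > 0"
  shows "0 < half_tanh v" "half_tanh v < 1"
  using assms by (auto simp: half_tanh_def field_simps add_pos_pos)

lemma half_csch_nonneg: "v > 0 \<Longrightarrow> half_csch v \<ge> 0"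
  by (auto simp: half_csch_def)

lemma one_plus_exp_pos: "1 + exp (v::real) > 0"
  by (simp add: add_pos_pos)

lemma half_tanh_deriv:
  assumes "v > 0"
  shows "(half_tanh has_real_derivative half_tanh v * half_csch v) (at v)"
proof -
  have ne: "1 + exp (- v) \<noteq> 0" "1 - exp (- v) \<noteq> 0" using assms one_plus_exp_pos[of "- v"] by auto
  have "(half_tanh has_real_derivative
      (exp (- v) * (1 + exp (- v)) - (1 - exp (- v)) * (- exp (- v))) / ((1 + exp (- v)) * (1 + exp (- v)))) (at v)"
    unfolding half_tanh_def[abs_def]
    by (rule derivative_eq_intros refl | use ne in simp)+
  moreover have "(exp (- v) * (1 + exp (- v)) - (1 - exp (- v)) * (- exp (- v))) / ((1 + exp (- v)) * (1 + exp (- v)))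
      = half_tanh v * half_csch v"
    unfolding half_tanh_def half_csch_eq using ne by (simp add: divide_simps) (simp add: algebra_simps)
  ultimately show ?thesis by simp
qed

lemma T_log_half_tanh: "v > 0 \<Longrightarrow> T_log (half_tanh v) = v"
proof -
  assume v: "v > 0"
  have pos: "1 + exp (- v) > 0" by (rule one_plus_exp_pos)
  have "1 + half_tanh v = 2 / (1 + exp (- v))" "1 - half_tanh v = 2 * exp (- v) / (1 + exp (- v))"
    using pos by (auto simp: half_tanh_def field_simps)
  then show ?thesis
    using pos by (simp add: T_log_def ln_div ln_mult)
qed

lemma S_log_half_tanh: "v > 0 \<Longrightarrow> S_log (half_tanh v) = v - 2 * (ln 2 - ln (1 + exp (- v)))"
proof -
  assume v: "v > 0"
  have pos: "1 + exp (- v) > 0" by (rule one_plus_exp_pos)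
  have "1 - (half_tanh v)\<^sup>2 = 4 * exp (- v) / (1 + exp (- v))\<^sup>2"
  proof -
    have "exp (- v) * 4 + (1 - exp (- v))\<^sup>2 = (1 + exp (- v))\<^sup>2"
      by (simp add: power2_eq_square algebra_simps)
    then show ?thesis
      using pos by (simp add: half_tanh_def power_divide field_simps)
  qed
  moreover have "ln (4::real) = 2 * ln 2" using ln_realpow[of 2 2] by simp
  ultimately show ?thesis
    using pos by (simp add: S_log_def ln_div ln_mult ln_realpow)
qed

lemma half_tanh_limits:
  "((ereal \<circ> half_tanh \<circ> real_of_ereal) \<longlongrightarrow> 0) (at_right 0)"
  "((ereal \<circ> half_tanh \<circ> real_of_ereal) \<longlongrightarrow> 1) (at_left \<infinity>)"
proof -
  have "(half_tanh \<longlongrightarrow> 0) (at_right 0)"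
    unfolding half_tanh_def[abs_def] by real_asymp
  then show "((ereal \<circ> half_tanh \<circ> real_of_ereal) \<longlongrightarrow> 0) (at_right 0)"
    by (simp add: zero_ereal_def ereal_tendsto_simps)
  have "(half_tanh \<longlongrightarrow> 1) at_top"
    unfolding half_tanh_def[abs_def] by real_asymp
  then show "((ereal \<circ> half_tanh \<circ> real_of_ereal) \<longlongrightarrow> 1) (at_left \<infinity>)"
    by (simp add: one_ereal_def ereal_tendsto_simps)
qed

lemma half_tanh_substitution:
  fixes h :: "real \<Rightarrow> real"
  assumes cont: "\<And>t. 0 < t \<Longrightarrow> t < 1 \<Longrightarrow> isCont h t"
    and nn: "\<And>t. 0 < t \<Longrightarrow> t < 1 \<Longrightarrow> h t \<ge> 0"
    and int: "set_integrable lborel {0<..} (\<lambda>v. h (half_tanh v) * half_csch v)"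
  shows "set_integrable lborel {0<..<1} (\<lambda>t. h t / t)"
    and "(LINT t:{0<..<1}|lborel. h t / t) = (LINT v:{0<..}|lborel. h (half_tanh v) * half_csch v)"
proof -
  have e1: "einterval 0 \<infinity> = {0<..}" by (auto simp: einterval_def)
  have e2: "einterval 0 1 = {0<..<1}" by (auto simp: einterval_def one_ereal_def)
  \<comment> \<open>The substitution rule asks for a derivative that is nonnegative at the end points too.\<close>
  define g' where "g' = (\<lambda>v. if v > 0 then half_tanh v * half_csch v else 0)"
  have eq: "h (half_tanh v) / half_tanh v * g' v = h (half_tanh v) * half_csch v" if "v > 0" for v
    using half_tanh_bounds[OF that] that by (simp add: g'_def)
  have int': "set_integrable lborel {0<..} (\<lambda>v. h (half_tanh v) / half_tanh v * g' v)"
    using int by (subst set_integrable_cong[OF refl refl eq]) auto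
  have D: "DERIV half_tanh v :> g' v" if "v > 0" for v
    using half_tanh_deriv[OF that] that by (simp add: g'_def)
  have c: "isCont g' v" if "v > 0" for v
  proof -
    have "1 + exp (- v) \<noteq> 0" "1 - exp (- v) \<noteq> 0" using that one_plus_exp_pos[of "- v"] by auto
    then have "isCont (\<lambda>v. half_tanh v * half_csch v) v"
      unfolding half_tanh_def half_csch_eq by (intro continuous_intros) auto
    moreover have "\<forall>\<^sub>F w in nhds v. g' w = half_tanh w * half_csch w"
      using eventually_nhds_in_open[of "{0<..}" v] that
      by (auto elim!: eventually_mono simp: g'_def)
    ultimately show ?thesis by (simp add: isCont_cong)
  qed
  note subst = interval_integral_substitution_nonneg[of 0 \<infinity> half_tanh g' "\<lambda>t. h t / t" 0 1]
  have prem: "(0::ereal) < \<infinity>" "\<And>x. 0 < ereal x \<Longrightarrow> ereal x < \<infinity> \<Longrightarrow> DERIV half_tanh x :> g' x"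
    "\<And>x. 0 < ereal x \<Longrightarrow> ereal x < \<infinity> \<Longrightarrow> isCont (\<lambda>t. h t / t) (half_tanh x)"
    "\<And>x. 0 < ereal x \<Longrightarrow> ereal x < \<infinity> \<Longrightarrow> isCont g' x"
    "\<And>x. 0 < ereal x \<Longrightarrow> ereal x < \<infinity> \<Longrightarrow> 0 \<le> h (half_tanh x) / half_tanh x"
    "\<And>x. 0 \<le> ereal x \<Longrightarrow> ereal x \<le> \<infinity> \<Longrightarrow> 0 \<le> g' x"
    using half_tanh_bounds half_tanh_bounds(1)[THEN less_imp_neq, THEN not_sym]
    by (auto simp: D c cont nn intro!: continuous_intros divide_nonneg_nonneg less_imp_le[OF half_tanh_bounds(1)])
      (auto simp: g'_def half_csch_nonneg less_imp_le)
  show "set_integrable lborel {0<..<1} (\<lambda>t. h t / t)"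
    using subst(1)[OF prem half_tanh_limits] int' by (simp add: e1 e2)
  have "(LBINT t=0..1. h t / t) = (LBINT v=0..\<infinity>. h (half_tanh v) / half_tanh v * g' v)"
    using subst(2)[OF prem half_tanh_limits] int' by (simp add: e1)
  then have "(LINT t:{0<..<1}|lborel. h t / t) = (LINT v:{0<..}|lborel. h (half_tanh v) / half_tanh v * g' v)"
    by (simp add: interval_lebesgue_integral_def e1 e2)
  also have "\<dots> = (LINT v:{0<..}|lborel. h (half_tanh v) * half_csch v)"
    by (rule set_lebesgue_integral_cong) (simp, metis eq greaterThan_iff)
  finally show "(LINT t:{0<..<1}|lborel. h t / t) = (LINT v:{0<..}|lborel. h (half_tanh v) * half_csch v)" .
qed

lemma sums_even_reindex:
  fixes f :: "nat \<Rightarrow> real"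
  assumes "\<And>n. odd n \<Longrightarrow> f n = 0" "(\<lambda>n. f (2 * n)) sums S"
  shows "f sums S"
proof -
  have "strict_mono (\<lambda>n::nat. 2 * n)" by (auto simp: strict_mono_def)
  moreover have "f n = 0" if "n \<notin> range (\<lambda>n. 2 * n)" for n
    using that assms(1) by (auto elim!: evenE)
  ultimately show ?thesis
    using assms(2) sums_mono_reindex[of "\<lambda>n. 2 * n" f S] by simp
qed

lemma sums_odd_reindex:
  fixes f :: "nat \<Rightarrow> real"
  assumes "\<And>n. even n \<Longrightarrow> f n = 0" "(\<lambda>n. f (2 * n + 1)) sums S"
  shows "f sums S"
proof -
  have "strict_mono (\<lambda>n::nat. 2 * n + 1)" by (auto simp: strict_mono_def)
  moreover have "f n = 0" if "n \<notin> range (\<lambda>n. 2 * n + 1)" for n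
    using that assms(1)[of n] by (cases "even n") (auto elim!: oddE)
  ultimately show ?thesis
    using assms(2) sums_mono_reindex[of "\<lambda>n. 2 * n + 1" f S] by simp
qed

lemma T_val_sums:
  assumes "m \<ge> 2"
  shows "(\<lambda>n. (if even n then 2 else 0) / real (Suc n) ^ m) sums T_val m"
proof -
  have "summable (\<lambda>n. 2 / real (2 * n + 1) ^ m)"
  proof (rule summable_comparison_test')
    show "summable (\<lambda>n. 2 * (inverse (real (Suc n)) ^ m))"
      using inverse_power_summable[OF assms, where 'a = real]
      by (intro summable_mult) (simp only: power_inverse summable_Suc_iff[of "\<lambda>n. inverse (real n ^ m)"])
    fix n :: nat
    have "2 / real (2 * n + 1) ^ m \<le> 2 / real (Suc n) ^ m"
      by (intro divide_left_mono power_mono mult_pos_pos) auto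
    then show "norm (2 / real (2 * n + 1) ^ m) \<le> 2 * (inverse (real (Suc n)) ^ m)"
      by (simp add: field_simps)
  qed
  then have "(\<lambda>n. 2 / real (2 * n + 1) ^ m) sums T_val m"
    unfolding T_val_def by (rule summable_sums)
  then have *: "(\<lambda>n. (if even (2 * n) then 2 else 0) / real (Suc (2 * n)) ^ m) sums T_val m"
    by simp
  show ?thesis
    by (rule sums_even_reindex[where f = "\<lambda>n. (if even n then 2 else 0) / real (Suc n) ^ m", OF _ *]) simp
qed

lemma half_csch_sums:
  assumes "v > 0"
  shows "(\<lambda>n. (if even n then 2 else 0) * exp (- (real (Suc n) * v))) sums half_csch v"
proof -
  have "(\<lambda>n. exp (- (2 * v)) ^ n) sums (1 / (1 - exp (- (2 * v))))"
    using assms by (intro geometric_sums) simp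
  from sums_mult[OF this, of "2 * exp (- v)"]
  have "(\<lambda>n. 2 * exp (- v) * exp (- (2 * v)) ^ n) sums half_csch v"
    by (simp add: half_csch_def)
  also have "(\<lambda>n. 2 * exp (- v) * exp (- (2 * v)) ^ n) =
      (\<lambda>n. (if even (2 * n) then 2 else 0) * exp (- (real (Suc (2 * n)) * v)))"
    by (auto simp: fun_eq_iff exp_of_nat_mult[symmetric] exp_add[symmetric] algebra_simps)
  finally have *: "(\<lambda>n. (if even (2 * n) then 2 else 0) * exp (- (real (Suc (2 * n)) * v))) sums half_csch v" .
  show ?thesis
    by (rule sums_even_reindex[where f = "\<lambda>n. (if even n then 2 else 0) * exp (- (real (Suc n) * v))", OF _ *]) simp
qed

lemma half_csch_measurable [measurable]: "half_csch \<in> borel_measurable borel"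
  unfolding half_csch_def[abs_def] by measurable

lemma half_csch_mellin:
  assumes "k \<ge> 1"
  shows "set_integrable lborel {0<..} (\<lambda>v. v ^ k / fact k * half_csch v)"
    and "(LINT v:{0<..}|lborel. v ^ k / fact k * half_csch v) = T_val (k + 1)"
  using mellin_dirichlet[of "\<lambda>n. if even n then 2 else 0" half_csch k "T_val (k + 1)"]
    half_csch_sums T_val_sums[of "k + 1"] assms by auto

lemma half_csch_mellin':
  assumes "k \<ge> 1"
  shows "set_integrable lborel {0<..} (\<lambda>v. v ^ k * half_csch v)"
    and "(LINT v:{0<..}|lborel. v ^ k * half_csch v) = fact k * T_val (k + 1)"
proof -
  have "(\<lambda>v. v ^ k * half_csch v) = (\<lambda>v. fact k * (v ^ k / fact k * half_csch v))"
    by (auto simp: fun_eq_iff)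
  then show "set_integrable lborel {0<..} (\<lambda>v. v ^ k * half_csch v)"
    "(LINT v:{0<..}|lborel. v ^ k * half_csch v) = fact k * T_val (k + 1)"
    using half_csch_mellin[OF assms] by (simp_all only: set_integrable_mult_right set_integral_mult_right)
qed

lemma T_log_isCont: "0 < t \<Longrightarrow> t < 1 \<Longrightarrow> isCont T_log t"
  by (rule DERIV_isCont[OF T_log_deriv]) auto

lemma S_log_isCont: "0 < t \<Longrightarrow> t < 1 \<Longrightarrow> isCont S_log t"
  by (rule DERIV_isCont[OF S_log_deriv]) auto

lemma T_log_power_integral:
  assumes "p \<ge> 1"
  shows "set_integrable lborel {0<..<1} (\<lambda>t. T_log t ^ p / t)"
    and "(LINT t:{0<..<1}|lborel. T_log t ^ p / t) = fact p * T_val (p + 1)"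
proof -
  have eq: "T_log (half_tanh v) ^ p * half_csch v = v ^ p * half_csch v" if "v \<in> {0<..}" for v
    using that by (simp add: T_log_half_tanh)
  have 1: "isCont (\<lambda>t. T_log t ^ p) t" if "0 < t" "t < 1" for t
    using T_log_isCont[OF that] by (intro continuous_intros)
  have 2: "T_log t ^ p \<ge> 0" if "0 < t" "t < 1" for t
    using T_log_nonneg[of t] that by simp
  have 3: "set_integrable lborel {0<..} (\<lambda>v. T_log (half_tanh v) ^ p * half_csch v)"
    by (subst set_integrable_cong[OF refl refl eq]) (auto intro: half_csch_mellin'[OF assms])
  show "set_integrable lborel {0<..<1} (\<lambda>t. T_log t ^ p / t)"
    by (rule half_tanh_substitution(1)[OF 1 2 3])
  have "(LINT t:{0<..<1}|lborel. T_log t ^ p / t) = (LINT v:{0<..}|lborel. T_log (half_tanh v) ^ p * half_csch v)"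
    by (rule half_tanh_substitution(2)[OF 1 2 3])
  also have "\<dots> = (LINT v:{0<..}|lborel. v ^ p * half_csch v)"
    by (rule set_lebesgue_integral_cong) (auto simp: T_log_half_tanh)
  finally show "(LINT t:{0<..<1}|lborel. T_log t ^ p / t) = fact p * T_val (p + 1)"
    by (simp add: half_csch_mellin'[OF assms])
qed

text \<open>All moments of \<open>A\<^sup>p / t\<close> are finite by the substitution above, so domination of the numerator by a positive
  power of \<open>A\<close> suffices.\<close>

lemma log_weightI:
  assumes [measurable]: "f \<in> borel_measurable borel"
    and f: "\<And>t. 0 < t \<Longrightarrow> t < 1 \<Longrightarrow> 0 \<le> f t \<and> f t \<le> T_log t ^ p"
    and p: "p \<ge> 1"
  shows "log_weight (\<lambda>t. f t / t)"
proof
  show "set_integrable lborel {0<..<1} (\<lambda>t. T_log t ^ l * (f t / t))" for l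
  proof (rule set_integrable_bound[OF T_log_power_integral(1)[of "l + p"]])
    show "AE t in lborel. t \<in> {0<..<1} \<longrightarrow> norm (T_log t ^ l * (f t / t)) \<le> norm (T_log t ^ (l + p) / t)"
    proof (intro AE_I2 impI)
      fix t :: real assume t: "t \<in> {0<..<1}"
      then have "T_log t ^ l * f t \<le> T_log t ^ l * T_log t ^ p" "T_log t \<ge> 0" "f t \<ge> 0"
        using f[of t] T_log_nonneg[of t] by (auto intro!: mult_left_mono)
      then show "norm (T_log t ^ l * (f t / t)) \<le> norm (T_log t ^ (l + p) / t)"
        using t by (auto simp: abs_mult power_add divide_right_mono)
    qed
    show "set_borel_measurable lborel {0<..<1} (\<lambda>t. T_log t ^ l * (f t / t))"
      unfolding set_borel_measurable_def by measurable
  qed (use p in auto)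
qed (use f in auto)

text \<open>This and the next constant are the sums \<open>Q\<close> and \<open>M\<close> of \<open>4 c(N) / N\<^sup>k\<^sup>+\<^sup>1\<close> over odd and over even \<open>N = n + 1\<close>.\<close>

definition odd_harm_odd :: "nat \<Rightarrow> real" where
  "odd_harm_odd k = (\<Sum>n. (if even n then 4 * odd_harm (Suc n) else 0) / real (Suc n) ^ (k + 1))"

definition odd_harm_even :: "nat \<Rightarrow> real" where
  "odd_harm_even k = (\<Sum>n. (if odd n then 4 * odd_harm (Suc n) else 0) / real (Suc n) ^ (k + 1))"

lemma odd_harm_odd_even_sums:
  assumes "k \<ge> 1"
  shows "(\<lambda>n. (if even n then 4 * odd_harm (Suc n) else 0) / real (Suc n) ^ (k + 1)) sums odd_harm_odd k"
    "(\<lambda>n. (if odd n then 4 * odd_harm (Suc n) else 0) / real (Suc n) ^ (k + 1)) sums odd_harm_even k"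
proof -
  have *: "summable (\<lambda>n. 4 * (odd_harm (Suc n) / real (Suc n) ^ (k + 1)))"
    using summable_odd_harm[OF assms] by (rule summable_mult)
  have "summable (\<lambda>n. (if even n then 4 * odd_harm (Suc n) else 0) / real (Suc n) ^ (k + 1))"
    by (rule summable_comparison_test'[OF *]) (auto simp: odd_harm_nonneg)
  then show "(\<lambda>n. (if even n then 4 * odd_harm (Suc n) else 0) / real (Suc n) ^ (k + 1)) sums odd_harm_odd k"
    unfolding odd_harm_odd_def by (rule summable_sums)
  have "summable (\<lambda>n. (if odd n then 4 * odd_harm (Suc n) else 0) / real (Suc n) ^ (k + 1))"
    by (rule summable_comparison_test'[OF *]) (auto simp: odd_harm_nonneg)
  then show "(\<lambda>n. (if odd n then 4 * odd_harm (Suc n) else 0) / real (Suc n) ^ (k + 1)) sums odd_harm_even k"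
    unfolding odd_harm_even_def by (rule summable_sums)
qed

text \<open>The integrand is the generating function of the \<open>c(N)\<close> at \<open>- e\<^sup>-\<^sup>v\<close>, whose coefficients alternate in
  sign.  Splitting it into its parts of odd and even index gives two series with nonnegative
  coefficients, to which termwise integration applies.\<close>

lemma log_csch_mellin:
  assumes "k \<ge> 1"
  shows "set_integrable lborel {0<..} (\<lambda>v. v ^ k / fact k * (2 * (ln 2 - ln (1 + exp (- v))) * half_csch v))"
    and "(LINT v:{0<..}|lborel. v ^ k / fact k * (2 * (ln 2 - ln (1 + exp (- v))) * half_csch v)) =
      odd_harm_odd k - odd_harm_even k"
proof -
  define U where "U = (\<lambda>s::real. (ln 2 - ln (1 - s)) / (1 - s\<^sup>2))"
  define Fo Fe where "Fo = (\<lambda>v. 2 * exp (- v) * (U (exp (- v)) + U (- exp (- v))))"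
    and "Fe = (\<lambda>v. 2 * exp (- v) * (U (exp (- v)) - U (- exp (- v))))"
  have [measurable]: "Fo \<in> borel_measurable borel" "Fe \<in> borel_measurable borel"
    unfolding Fo_def Fe_def U_def by measurable
  have so: "(\<lambda>n. (if even n then 4 * odd_harm (Suc n) else 0) * exp (- (real (Suc n) * v))) sums Fo v" and
    se: "(\<lambda>n. (if odd n then 4 * odd_harm (Suc n) else 0) * exp (- (real (Suc n) * v))) sums Fe v"
    if "v > 0" for v
  proof -
    define s where "s = exp (- v)"
    have s: "0 < s" "s < 1" using that by (auto simp: s_def)
    have p: "exp (- (real (Suc n) * v)) = s * s ^ n" for n
      unfolding s_def by (simp add: exp_of_nat_mult[symmetric] exp_add[symmetric] algebra_simps)
    have 1: "(\<lambda>n. odd_harm (Suc n) * s ^ n) sums U s" "(\<lambda>n. odd_harm (Suc n) * (- s) ^ n) sums U (- s)"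
      using odd_harm_power_series[of s] odd_harm_power_series[of "- s"] s by (auto simp: U_def)
    have "(\<lambda>n. (if even n then 4 * odd_harm (Suc n) else 0) * exp (- (real (Suc n) * v))) =
      (\<lambda>n. 2 * s * (if even n then 2 * odd_harm (Suc n) * s ^ n else 0))"
      unfolding p by (auto simp: fun_eq_iff)
    then show "(\<lambda>n. (if even n then 4 * odd_harm (Suc n) else 0) * exp (- (real (Suc n) * v))) sums Fo v"
      using sums_mult[OF alternating_power_series_parts(1)[OF 1], of "2 * s"] by (simp add: Fo_def s_def)
    have "(\<lambda>n. (if odd n then 4 * odd_harm (Suc n) else 0) * exp (- (real (Suc n) * v))) =
      (\<lambda>n. 2 * s * (if odd n then 2 * odd_harm (Suc n) * s ^ n else 0))"
      unfolding p by (auto simp: fun_eq_iff)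
    then show "(\<lambda>n. (if odd n then 4 * odd_harm (Suc n) else 0) * exp (- (real (Suc n) * v))) sums Fe v"
      using sums_mult[OF alternating_power_series_parts(2)[OF 1], of "2 * s"] by (simp add: Fe_def s_def)
  qed
  \<comment> \<open>\<open>Fo\<close> and \<open>Fe\<close> collect the terms of odd and even \<open>N = n + 1\<close>.\<close>
  have mo: "set_integrable lborel {0<..} (\<lambda>v. v ^ k / fact k * Fo v)"
    "(LINT v:{0<..}|lborel. v ^ k / fact k * Fo v) = odd_harm_odd k"
    by (rule mellin_dirichlet[OF _ so _ odd_harm_odd_even_sums(1)[OF assms]]; simp add: odd_harm_nonneg)+
  have me: "set_integrable lborel {0<..} (\<lambda>v. v ^ k / fact k * Fe v)"
    "(LINT v:{0<..}|lborel. v ^ k / fact k * Fe v) = odd_harm_even k"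
    by (rule mellin_dirichlet[OF _ se _ odd_harm_odd_even_sums(2)[OF assms]]; simp add: odd_harm_nonneg)+
  have eq: "v ^ k / fact k * (2 * (ln 2 - ln (1 + exp (- v))) * half_csch v) =
      v ^ k / fact k * Fo v - v ^ k / fact k * Fe v" for v
  proof -
    have "(exp (- v))\<^sup>2 = exp (- (2 * v))" by (simp add: power2_eq_square exp_add[symmetric])
    moreover have "Fo v - Fe v = 4 * exp (- v) * U (- exp (- v))"
      by (simp add: Fo_def Fe_def algebra_simps)
    ultimately have "Fo v - Fe v = 2 * (ln 2 - ln (1 + exp (- v))) * half_csch v"
      by (simp add: U_def half_csch_def)
    then show ?thesis by (simp only: right_diff_distrib[symmetric])
  qed
  show "set_integrable lborel {0<..} (\<lambda>v. v ^ k / fact k * (2 * (ln 2 - ln (1 + exp (- v))) * half_csch v))"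
    unfolding eq using mo(1) me(1) by (rule set_integral_diff(1))
  show "(LINT v:{0<..}|lborel. v ^ k / fact k * (2 * (ln 2 - ln (1 + exp (- v))) * half_csch v)) =
      odd_harm_odd k - odd_harm_even k"
    by (simp only: eq set_integral_diff(2)[OF mo(1) me(1)] mo(2) me(2))
qed

text \<open>Under the substitution \<open>B = A - 2 (log 2 - log (1 + e\<^sup>-\<^sup>v))\<close>: the first part contributes the T-value
  and the second one the difference of the two harmonic sums.\<close>

lemma S_log_moment:
  assumes "k \<ge> 1"
  shows "moment (\<lambda>t. S_log t / t) k 1 / fact k =
    real (k + 1) * T_val (k + 2) - (odd_harm_odd k - odd_harm_even k)"
proof -
  define h where "h = (\<lambda>t. T_log t ^ k / fact k * S_log t)"
  have 1: "isCont h t" if "0 < t" "t < 1" for t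
    using T_log_isCont[OF that] S_log_isCont[OF that] unfolding h_def by (intro continuous_intros) auto
  have 2: "h t \<ge> 0" if "0 < t" "t < 1" for t
    using T_log_nonneg[of t] S_log_nonneg[of t] that by (simp add: h_def)
  have eq: "h (half_tanh v) * half_csch v = real (k + 1) * (v ^ (k + 1) / fact (k + 1) * half_csch v) -
      v ^ k / fact k * (2 * (ln 2 - ln (1 + exp (- v))) * half_csch v)" if "v \<in> {0<..}" for v
    using that by (simp add: h_def T_log_half_tanh S_log_half_tanh field_simps del: of_nat_Suc)
  have k1: "k + 1 \<ge> 1" by simp
  have i1: "set_integrable lborel {0<..} (\<lambda>v. real (k + 1) * (v ^ (k + 1) / fact (k + 1) * half_csch v))"
    by (intro set_integrable_mult_right half_csch_mellin(1) k1)
  have 3: "set_integrable lborel {0<..} (\<lambda>v. h (half_tanh v) * half_csch v)"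
    by (subst set_integrable_cong[OF refl refl eq], assumption)
       (rule set_integral_diff(1)[OF i1 log_csch_mellin(1)[OF assms]])
  have "moment (\<lambda>t. S_log t / t) k 1 / fact k = (LINT t:{0<..<1}|lborel. (T_log t ^ k * (S_log t / t)) / fact k)"
    by (simp only: moment_def set_integral_divide_zero)
  also have "\<dots> = (LINT t:{0<..<1}|lborel. h t / t)"
    by (intro set_lebesgue_integral_cong) (auto simp: h_def)
  also have "\<dots> = (LINT v:{0<..}|lborel. h (half_tanh v) * half_csch v)"
    by (rule half_tanh_substitution(2)[OF 1 2 3])
  also have "\<dots> = (LINT v:{0<..}|lborel. real (k + 1) * (v ^ (k + 1) / fact (k + 1) * half_csch v) -
      v ^ k / fact k * (2 * (ln 2 - ln (1 + exp (- v))) * half_csch v))"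
    by (rule set_lebesgue_integral_cong) (auto simp: eq)
  also have "\<dots> = (LINT v:{0<..}|lborel. real (k + 1) * (v ^ (k + 1) / fact (k + 1) * half_csch v)) -
      (odd_harm_odd k - odd_harm_even k)"
    by (simp only: set_integral_diff(2)[OF i1 log_csch_mellin(1)[OF assms]] log_csch_mellin(2)[OF assms])
  also have "(LINT v:{0<..}|lborel. real (k + 1) * (v ^ (k + 1) / fact (k + 1) * half_csch v)) =
      real (k + 1) * T_val (k + 2)"
    by (simp only: set_integral_mult_right half_csch_mellin(2)[OF k1]) simp
  finally show ?thesis .
qed

lemma T_log_moment: "moment (\<lambda>t. T_log t / t) l 1 = fact (l + 1) * T_val (l + 2)"
  using T_log_power_integral(2)[of "l + 1"] by (simp add: moment_def mult_ac)

section \<open>Power series of words and their regularized values\<close>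

lemma nn_integral_power_upto:
  assumes "0 < x"
  shows "(\<integral>\<^sup>+t\<in>{0<..<x}. ennreal (t ^ n) \<partial>lborel) = ennreal (x ^ Suc n / real (Suc n))"
proof -
  have "(\<integral>\<^sup>+t\<in>{0<..<x}. ennreal (t ^ n) \<partial>lborel) = ennreal (x ^ Suc n / real (Suc n) - 0 ^ Suc n / real (Suc n))"
  proof (rule nn_integral_FTC_Ioo)
    fix t
    show "((\<lambda>t. t ^ Suc n / real (Suc n)) has_real_derivative t ^ n) (at t)"
      by (rule derivative_eq_intros refl | simp)+
  qed (use assms in auto)
  then show ?thesis by simp
qed

lemma nn_integral_power_series_upto:
  assumes a: "\<And>n. a n \<ge> 0" and x: "0 < x"
  shows "(\<integral>\<^sup>+t\<in>{0<..<x}. (\<Sum>n. ennreal (a n * t ^ n)) \<partial>lborel) = (\<Sum>n. ennreal (a n * x ^ Suc n / real (Suc n)))"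
proof -
  have "(\<integral>\<^sup>+t\<in>{0<..<x}. (\<Sum>n. ennreal (a n * t ^ n)) \<partial>lborel) =
     (\<integral>\<^sup>+t. (\<Sum>n. ennreal (a n) * (ennreal (t ^ n) * indicator {0<..<x} t)) \<partial>lborel)"
    using a by (intro nn_integral_cong) (auto simp: indicator_def ennreal_mult')
  also have "\<dots> = (\<Sum>n. \<integral>\<^sup>+t. ennreal (a n) * (ennreal (t ^ n) * indicator {0<..<x} t) \<partial>lborel)"
    by (rule nn_integral_suminf) measurable
  also have "\<dots> = (\<Sum>n. ennreal (a n) * ennreal (x ^ Suc n / real (Suc n)))"
    using x by (intro suminf_cong, subst nn_integral_cmult) (auto simp: nn_integral_power_upto)
  also have "\<dots> = (\<Sum>n. ennreal (a n * x ^ Suc n / real (Suc n)))"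
    using a by (simp only: ennreal_mult'[symmetric] times_divide_eq_right)
  finally show ?thesis .
qed

text \<open>Words whose integral is a power series with nonnegative coefficients.  Each further letter
  \<open>omega_0\<close> divides the coefficient of \<open>t\<^sup>n\<^sup>+\<^sup>1\<close> by \<open>n + 1\<close>, and the bound by a power of \<open>A\<close> makes all resulting
  densities admissible for regularization.\<close>

locale word_series =
  fixes b :: "nat \<Rightarrow> real" and F :: "real \<Rightarrow> real" and w :: "(real \<Rightarrow> real) list" and p :: nat
  assumes b_nonneg: "\<And>n. b n \<ge> 0"
    and b_sums: "\<And>t. 0 < t \<Longrightarrow> t < 1 \<Longrightarrow> (\<lambda>n. b n * t ^ Suc n) sums F t"
    and nn_iter_w: "\<And>t. 0 < t \<Longrightarrow> t < 1 \<Longrightarrow> nn_iter w (\<lambda>_. 1) t = ennreal (F t)"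
    and F_le: "\<And>t. 0 < t \<Longrightarrow> t < 1 \<Longrightarrow> F t \<le> T_log t ^ p"
    and p: "p \<ge> 1"
    and letters: "set w \<subseteq> {omega_0, omega_1, omega_m1}"
begin

definition polylog :: "nat \<Rightarrow> real \<Rightarrow> real" where
  "polylog j t = (\<Sum>n. b n / real (Suc n) ^ j * t ^ Suc n)"

lemma polylog_summable:
  assumes "0 < t" "t < 1"
  shows "summable (\<lambda>n. b n / real (Suc n) ^ j * t ^ Suc n)"
proof (rule summable_comparison_test'[OF sums_summable[OF b_sums[OF assms]]])
  fix n
  have "b n / real (Suc n) ^ j \<le> b n / 1"
    using b_nonneg[of n] by (intro divide_left_mono) (auto intro!: one_le_power)
  then show "norm (b n / real (Suc n) ^ j * t ^ Suc n) \<le> b n * t ^ Suc n"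
    using b_nonneg[of n] assms by (simp add: abs_mult del: power_Suc of_nat_Suc times_divide_eq_left)
qed

lemma polylog_bounds:
  assumes "0 < t" "t < 1"
  shows "0 \<le> polylog j t" "polylog j t \<le> T_log t ^ p"
proof -
  show "0 \<le> polylog j t"
    unfolding polylog_def using b_nonneg assms by (intro suminf_nonneg polylog_summable) auto
  have "polylog j t \<le> (\<Sum>n. b n * t ^ Suc n)"
    unfolding polylog_def
  proof (intro suminf_le polylog_summable assms sums_summable[OF b_sums[OF assms]])
    fix n
    have "b n / real (Suc n) ^ j \<le> b n / 1"
      using b_nonneg[of n] by (intro divide_left_mono) (auto intro!: one_le_power)
    then show "b n / real (Suc n) ^ j * t ^ Suc n \<le> b n * t ^ Suc n"
      using assms by (intro mult_right_mono) auto
  qed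
  also have "\<dots> = F t" using b_sums[OF assms] by (simp add: sums_iff)
  also have "\<dots> \<le> T_log t ^ p" by (rule F_le[OF assms])
  finally show "polylog j t \<le> T_log t ^ p" .
qed

lemma polylog_measurable [measurable]: "polylog j \<in> borel_measurable borel"
  unfolding polylog_def[abs_def] by measurable

lemma log_weight_polylog: "log_weight (\<lambda>t. polylog j t / t)"
  by (rule log_weightI[OF polylog_measurable _ p]) (use polylog_bounds in auto)

lemma suminf_polylog:
  assumes "0 < t" "t < 1"
  shows "(\<Sum>n. ennreal (b n / real (Suc n) ^ j * t ^ n)) = ennreal (polylog j t / t)"
proof (rule suminf_ennreal_eq)
  show "(\<lambda>n. b n / real (Suc n) ^ j * t ^ n) sums (polylog j t / t)"
    using sums_divide[OF summable_sums[OF polylog_summable[OF assms, of j]], of t] assms by (simp add: polylog_def)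
qed (use assms b_nonneg in auto)

lemma integral_polylog:
  assumes "0 < x" "x \<le> 1"
  shows "(\<integral>\<^sup>+t\<in>{0<..<x}. ennreal (polylog j t / t) \<partial>lborel) = (\<Sum>n. ennreal (b n / real (Suc n) ^ Suc j * x ^ Suc n))"
proof -
  have "(\<integral>\<^sup>+t\<in>{0<..<x}. ennreal (polylog j t / t) \<partial>lborel) =
    (\<integral>\<^sup>+t\<in>{0<..<x}. (\<Sum>n. ennreal (b n / real (Suc n) ^ j * t ^ n)) \<partial>lborel)"
    using assms by (intro nn_integral_cong) (auto simp: indicator_def suminf_polylog simp del: of_nat_Suc times_divide_eq_left)
  also have "\<dots> = (\<Sum>n. ennreal (b n / real (Suc n) ^ j * x ^ Suc n / real (Suc n)))"
    using assms b_nonneg by (intro nn_integral_power_series_upto) auto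
  also have "\<dots> = (\<Sum>n. ennreal (b n / real (Suc n) ^ Suc j * x ^ Suc n))"
    by (simp add: mult_ac)
  finally show ?thesis .
qed

lemma omega_0_polylog: "0 < t \<Longrightarrow> t < 1 \<Longrightarrow> ennreal (omega_0 t) * ennreal (polylog j t) = ennreal (polylog j t / t)"
  by (simp add: omega_0_def ennreal_mult'[symmetric])

lemma nn_iter_polylog:
  assumes "0 < x" "x < 1"
  shows "nn_iter (replicate j omega_0 @ w) (\<lambda>_. 1) x = ennreal (polylog j x)"
  using assms
proof (induction j arbitrary: x)
  case 0
  then show ?case using b_sums[of x] by (simp add: nn_iter_w polylog_def sums_iff)
next
  case (Suc j)
  have "nn_iter (replicate (Suc j) omega_0 @ w) (\<lambda>_. 1) x = (\<integral>\<^sup>+t\<in>{0<..<x}. ennreal (polylog j t / t) \<partial>lborel)"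
    unfolding replicate_Suc append_Cons nn_iter.simps using Suc
    by (intro nn_integral_cong) (auto simp: indicator_def omega_0_polylog)
  also have "\<dots> = (\<Sum>n. ennreal (b n / real (Suc n) ^ Suc j * x ^ Suc n))"
    using Suc by (intro integral_polylog) auto
  also have "\<dots> = ennreal (polylog (Suc j) x)"
    unfolding polylog_def[of "Suc j"] using Suc.prems b_nonneg
    by (intro suminf_ennreal_eq summable_sums polylog_summable) auto
  finally show ?case .
qed

lemma nn_iter_polylog_Suc:
  assumes "0 < x" "x < 1"
  shows "nn_iter (replicate (Suc j) omega_0 @ w) (\<lambda>_. 1) x = (\<integral>\<^sup>+t\<in>{0<..<x}. ennreal (polylog j t / t) \<partial>lborel)"
  unfolding replicate_Suc append_Cons nn_iter.simps using assms
  by (intro nn_integral_cong) (auto simp: indicator_def nn_iter_polylog omega_0_polylog)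

lemma moment_polylog_0:
  assumes S: "(\<lambda>n. b n / real (Suc n) ^ Suc j) sums S"
  shows "moment (\<lambda>t. polylog j t / t) 0 1 = S"
proof -
  have "moment (\<lambda>t. polylog j t / t) 0 1 = enn2real (\<integral>\<^sup>+t. ennreal (indicator {0<..<1} t *\<^sub>R (T_log t ^ 0 * (polylog j t / t))) \<partial>lborel)"
    unfolding moment_def set_lebesgue_integral_def
    by (rule integral_eq_nn_integral) (auto simp: indicator_def polylog_bounds intro!: AE_I2 divide_nonneg_nonneg)
  also have "(\<integral>\<^sup>+t. ennreal (indicator {0<..<1} t *\<^sub>R (T_log t ^ 0 * (polylog j t / t))) \<partial>lborel) =
      (\<integral>\<^sup>+t\<in>{0<..<1}. ennreal (polylog j t / t) \<partial>lborel)"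
    by (intro nn_integral_cong) (auto simp: indicator_def)
  also have "\<dots> = (\<Sum>n. ennreal (b n / real (Suc n) ^ Suc j * 1 ^ Suc n))"
    by (rule integral_polylog) auto
  also have "\<dots> = (\<Sum>n. ennreal (b n / real (Suc n) ^ Suc j))"
    by simp
  also have "\<dots> = ennreal S"
    by (rule suminf_ennreal_eq[OF _ S]) (use b_nonneg in auto)
  finally show ?thesis
    using suminf_nonneg[of "\<lambda>n. b n / real (Suc n) ^ Suc j"] S b_nonneg by (simp add: sums_iff)
qed

lemma letters_polylog: "set (replicate j omega_0 @ w) \<subseteq> {omega_0, omega_1, omega_m1}"
  using letters by auto

lemma reg_integral_polylog:
  "reg_integral (replicate j omega_m1 @ replicate (Suc i) omega_0 @ w) = log_weight.reg_poly (\<lambda>t. polylog i t / t) j"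
  by (rule log_weight.reg_integral_replicate_omega_m1[OF log_weight_polylog letters_polylog nn_iter_polylog_Suc])

lemma reg_integral_polylog_0:
  assumes "(\<lambda>n. b n / real (Suc n) ^ Suc j) sums S"
  shows "reg_integral (replicate (Suc j) omega_0 @ w) = [:S:]"
  using reg_integral_polylog[of 0 j] moment_polylog_0[OF assms]
  by (simp add: log_weight.reg_poly_def[OF log_weight_polylog])

end

lemma T_log_sums:
  assumes "0 < t" "t < 1"
  shows "(\<lambda>n. (if even n then 2 else 0) / real (Suc n) * t ^ Suc n) sums T_log t"
proof -
  from sums_diff[OF sums_minus_ln_1_minus[of t] sums_minus_ln_1_minus[of "- t"]] assms
  have "(\<lambda>n. t ^ Suc n / real (Suc n) - (- t) ^ Suc n / real (Suc n)) sums T_log t"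
    by (simp add: T_log_def)
  also have "(\<lambda>n. t ^ Suc n / real (Suc n) - (- t) ^ Suc n / real (Suc n)) =
      (\<lambda>n. (if even n then 2 else 0) / real (Suc n) * t ^ Suc n)"
    by (auto simp: fun_eq_iff)
  finally show ?thesis .
qed

lemma omega_m1_T_log_sums:
  assumes "0 < t" "t < 1"
  shows "(\<lambda>n. (if odd n then 4 * odd_harm (Suc n) else 0) * t ^ n) sums (omega_m1 t * T_log t)"
proof -
  have 1: "(\<lambda>n. odd_harm (Suc n) * t ^ n) sums ((ln 2 - ln (1 - t)) / (1 - t\<^sup>2))"
    "(\<lambda>n. odd_harm (Suc n) * (- t) ^ n) sums ((ln 2 - ln (1 + t)) / (1 - t\<^sup>2))"
    using odd_harm_power_series[of t] odd_harm_power_series[of "- t"] assms by auto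
  have "2 * ((ln 2 - ln (1 - t)) / (1 - t\<^sup>2) - (ln 2 - ln (1 + t)) / (1 - t\<^sup>2)) = omega_m1 t * T_log t"
    by (simp add: omega_m1_def T_log_def diff_divide_distrib[symmetric])
  moreover have "(\<lambda>n. (if odd n then 4 * odd_harm (Suc n) else 0) * t ^ n) =
      (\<lambda>n. 2 * (if odd n then 2 * odd_harm (Suc n) * t ^ n else 0))"
    by (auto simp: fun_eq_iff)
  ultimately show ?thesis
    using sums_mult[OF alternating_power_series_parts(2)[OF 1], of 2] by simp
qed

definition T_log_coeff :: "nat \<Rightarrow> real" where
  "T_log_coeff n = (if even n then 2 else 0) / real (Suc n)"

definition square_T_log_coeff :: "nat \<Rightarrow> real" where
  "square_T_log_coeff n = (if odd n then 4 * odd_harm (Suc n) else 0) / real (Suc n)"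

interpretation T1: word_series T_log_coeff T_log "[omega_m1]" 1
proof standard
  show "T_log_coeff n \<ge> 0" for n by (simp add: T_log_coeff_def)
  show "(\<lambda>n. T_log_coeff n * t ^ Suc n) sums T_log t" if "0 < t" "t < 1" for t
    using T_log_sums[OF that] unfolding T_log_coeff_def .
  show "nn_iter [omega_m1] (\<lambda>_. 1) t = ennreal (T_log t)" if "0 < t" "t < 1" for t
    by (rule nn_iter_omega_m1[OF that])
qed auto

lemma nn_iter_two_omega_m1:
  assumes "0 < x" "x < 1"
  shows "nn_iter [omega_m1, omega_m1] (\<lambda>_. 1) x = ennreal (T_log x ^ 2 / 2)"
  using nn_iter_all_omega_m1[OF assms, of 2] by (simp add: numeral_2_eq_2)

text \<open>The derivative \<open>omega_m1 A\<close> is, up to a factor, the difference of the generating function of the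
  \<open>c(N)\<close> at \<open>t\<close> and at \<open>- t\<close>; its series is integrated term by term.\<close>

lemma T_log_square_sums:
  assumes "0 < t" "t < 1"
  shows "(\<lambda>n. (if odd n then 4 * odd_harm (Suc n) else 0) / real (Suc n) * t ^ Suc n) sums (T_log t ^ 2 / 2)"
proof -
  define a where "a n = (if odd n then 4 * odd_harm (Suc n) else 0)" for n
  have a: "a n \<ge> 0" for n by (simp add: a_def odd_harm_nonneg)
  have "ennreal (T_log t ^ 2 / 2) = nn_iter [omega_m1, omega_m1] (\<lambda>_. 1) t"
    by (rule nn_iter_two_omega_m1[OF assms, symmetric])
  also have "\<dots> = (\<integral>\<^sup>+s\<in>{0<..<t}. (\<Sum>n. ennreal (a n * s ^ n)) \<partial>lborel)"
  proof -
    have "ennreal (omega_m1 s) * nn_iter [omega_m1] (\<lambda>_. 1) s = (\<Sum>n. ennreal (a n * s ^ n))"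
      if "0 < s" "s < t" for s
    proof -
      have s: "0 < s" "s < 1" using that assms by auto
      have "(\<Sum>n. ennreal (a n * s ^ n)) = ennreal (omega_m1 s * T_log s)"
        by (rule suminf_ennreal_eq) (use omega_m1_T_log_sums[OF s] a s in \<open>auto simp: a_def\<close>)
      also have "\<dots> = ennreal (omega_m1 s) * nn_iter [omega_m1] (\<lambda>_. 1) s"
        using s by (simp only: nn_iter_omega_m1[OF s]) (simp add: ennreal_mult' omega_m1_nonneg)
      finally show ?thesis by simp
    qed
    then show ?thesis
      unfolding nn_iter.simps(2)[of omega_m1 "[omega_m1]"]
      by (intro nn_integral_cong) (auto simp: indicator_def simp del: nn_iter.simps)
  qed
  also have "\<dots> = (\<Sum>n. ennreal (a n * t ^ Suc n / real (Suc n)))"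
    using assms a by (intro nn_integral_power_series_upto) auto
  finally have *: "(\<Sum>n. ennreal (a n * t ^ Suc n / real (Suc n))) = ennreal (T_log t ^ 2 / 2)" by simp
  have nn: "a n * t ^ Suc n / real (Suc n) \<ge> 0" for n using a[of n] assms by simp
  have sm: "summable (\<lambda>n. a n * t ^ Suc n / real (Suc n))"
    by (rule summable_suminf_not_top[OF nn]) (simp only: *, simp)
  have "(\<Sum>n. a n * t ^ Suc n / real (Suc n)) = T_log t ^ 2 / 2"
    using suminf_ennreal2[OF nn sm] * suminf_nonneg[OF sm nn] by (simp del: power_Suc of_nat_Suc)
  with summable_sums[OF sm] have "(\<lambda>n. a n * t ^ Suc n / real (Suc n)) sums (T_log t ^ 2 / 2)"
    by (simp del: power_Suc of_nat_Suc)
  then show ?thesis by (simp add: a_def mult_ac)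
qed

interpretation T2: word_series square_T_log_coeff "\<lambda>t. T_log t ^ 2 / 2" "[omega_m1, omega_m1]" 2
proof standard
  show "square_T_log_coeff n \<ge> 0" for n by (simp add: square_T_log_coeff_def odd_harm_nonneg)
  show "T_log t ^ 2 / 2 \<le> T_log t ^ 2" for t
    using zero_le_power2[of "T_log t"] by linarith
  show "(\<lambda>n. square_T_log_coeff n * t ^ Suc n) sums (T_log t ^ 2 / 2)" if "0 < t" "t < 1" for t
    using T_log_square_sums[OF that] unfolding square_T_log_coeff_def .
  show "nn_iter [omega_m1, omega_m1] (\<lambda>_. 1) t = ennreal (T_log t ^ 2 / 2)" if "0 < t" "t < 1" for t
    by (rule nn_iter_two_omega_m1[OF that])
qed auto

text \<open>Termwise integration gives the sum of \<open>2 / (m (m + N))\<close> over odd \<open>m\<close> with \<open>N = n + 1\<close>, and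
  \<open>N / (m (m + N)) = 1/m - 1/(m + N)\<close>.\<close>

lemma T_log_moment_power:
  "(\<integral>\<^sup>+t\<in>{0<..<1}. ennreal (T_log t * t ^ n) \<partial>lborel) = ennreal (2 * odd_harm (Suc n) / real (Suc n))"
proof -
  define a where "a m = (if even m then 2 else 0) / real (Suc m)" for m :: nat
  have "(\<integral>\<^sup>+t\<in>{0<..<1}. ennreal (T_log t * t ^ n) \<partial>lborel) =
     (\<integral>\<^sup>+t. (\<Sum>m. ennreal (a m) * (ennreal (t ^ (m + n + 1)) * indicator {0<..<1} t)) \<partial>lborel)"
  proof (intro nn_integral_cong)
    fix t :: real
    show "ennreal (T_log t * t ^ n) * indicator {0<..<1} t =
      (\<Sum>m. ennreal (a m) * (ennreal (t ^ (m + n + 1)) * indicator {0<..<1} t))"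
    proof (cases "t \<in> {0<..<1}")
      case True
      have "(\<lambda>m. a m * t ^ Suc m * t ^ n) sums (T_log t * t ^ n)"
        using True unfolding a_def by (intro sums_mult2 T_log_sums) auto
      then have "(\<Sum>m. ennreal (a m * t ^ Suc m * t ^ n)) = ennreal (T_log t * t ^ n)"
        using True by (intro suminf_ennreal_eq) (auto simp: a_def)
      also have "(\<lambda>m. ennreal (a m * t ^ Suc m * t ^ n)) = (\<lambda>m. ennreal (a m) * ennreal (t ^ (m + n + 1)))"
        by (auto simp: fun_eq_iff ennreal_mult'[symmetric] a_def power_add mult_ac)
      finally show ?thesis using True by simp
    qed simp
  qed
  also have "\<dots> = (\<Sum>m. ennreal (a m) * ennreal (1 / real (m + n + 2)))"
    by (subst nn_integral_suminf, simp, subst nn_integral_cmult, simp, subst nn_integral_power_upto)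
       (simp_all add: add_ac)
  also have "\<dots> = (\<Sum>m. ennreal (a m / real (m + n + 2)))"
    by (simp add: ennreal_mult'[symmetric] a_def)
  also have "\<dots> = ennreal (2 * odd_harm (Suc n) / real (Suc n))"
  proof (rule suminf_ennreal_eq)
    have "(\<lambda>m. a (2 * m) / real (2 * m + n + 2)) sums (2 / real (Suc n) * odd_harm (Suc n))"
    proof (rule sums_cong[THEN iffD1, OF _ sums_mult[OF odd_harm_sums[of "Suc n"], of "2 / real (Suc n)"]])
      fix m
      have "1 / real (2 * m + 1) - 1 / real (2 * m + 1 + Suc n) = real (Suc n) / (real (2 * m + 1) * real (2 * m + n + 2))"
        by (simp add: divide_simps)
      then show "2 / real (Suc n) * (1 / real (2 * m + 1) - 1 / real (2 * m + 1 + Suc n)) = a (2 * m) / real (2 * m + n + 2)"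
        by (simp add: a_def del: of_nat_Suc of_nat_add)
    qed
    then show "(\<lambda>m. a m / real (m + n + 2)) sums (2 * odd_harm (Suc n) / real (Suc n))"
      by (intro sums_even_reindex[where f = "\<lambda>m. a m / real (m + n + 2)"]) (auto simp: a_def)
  qed (simp add: a_def)
  finally show ?thesis .
qed

text \<open>This moment is what distinguishes the regularized value at \<open>(1, k + 1)\<close> from the product of the
  values at \<open>(1)\<close> and \<open>(k + 1)\<close>.\<close>

lemma moment_T1_1:
  assumes "k \<ge> 1"
  shows "moment (\<lambda>t. T1.polylog (k - 1) t / t) 1 1 = odd_harm_odd k"
proof -
  obtain j where k: "k = Suc j" using assms by (cases k) auto
  note b = T1.b_nonneg
  have "moment (\<lambda>t. T1.polylog j t / t) 1 1 = enn2real (\<integral>\<^sup>+t. ennreal (indicator {0<..<1} t *\<^sub>R (T_log t ^ 1 * (T1.polylog j t / t))) \<partial>lborel)"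
    unfolding moment_def set_lebesgue_integral_def
    by (rule integral_eq_nn_integral)
       (auto simp: indicator_def T1.polylog_bounds T_log_nonneg intro!: AE_I2 divide_nonneg_nonneg mult_nonneg_nonneg)
  also have "(\<integral>\<^sup>+t. ennreal (indicator {0<..<1} t *\<^sub>R (T_log t ^ 1 * (T1.polylog j t / t))) \<partial>lborel) =
     (\<integral>\<^sup>+t. (\<Sum>n. ennreal (T_log_coeff n / real (Suc n) ^ j) * (ennreal (T_log t * t ^ n) * indicator {0<..<1} t)) \<partial>lborel)"
  proof (intro nn_integral_cong)
    fix t :: real
    show "ennreal (indicator {0<..<1} t *\<^sub>R (T_log t ^ 1 * (T1.polylog j t / t))) =
       (\<Sum>n. ennreal (T_log_coeff n / real (Suc n) ^ j) * (ennreal (T_log t * t ^ n) * indicator {0<..<1} t))"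
    proof (cases "t \<in> {0<..<1}")
      case True
      have "ennreal (T_log t * (T1.polylog j t / t)) = ennreal (T_log t) * (\<Sum>n. ennreal (T_log_coeff n / real (Suc n) ^ j * t ^ n))"
        using True T_log_nonneg[of t] T1.suminf_polylog[of t j]
        by (simp add: ennreal_mult' del: of_nat_Suc times_divide_eq_right times_divide_eq_left)
      also have "\<dots> = (\<Sum>n. ennreal (T_log t) * ennreal (T_log_coeff n / real (Suc n) ^ j * t ^ n))"
        by simp
      also have "\<dots> = (\<Sum>n. ennreal (T_log_coeff n / real (Suc n) ^ j) * ennreal (T_log t * t ^ n))"
        using True T_log_nonneg[of t] b
        by (simp add: ennreal_mult'[symmetric] mult_ac)
      finally show ?thesis using True by simp
    qed simp
  qed
  also have "\<dots> = (\<Sum>n. ennreal (T_log_coeff n / real (Suc n) ^ j) * ennreal (2 * odd_harm (Suc n) / real (Suc n)))"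
    by (subst nn_integral_suminf, simp, subst nn_integral_cmult, simp, subst T_log_moment_power) simp
  also have "\<dots> = (\<Sum>n. ennreal ((if even n then 4 * odd_harm (Suc n) else 0) / real (Suc n) ^ (k + 1)))"
  proof (rule suminf_cong)
    fix n
    have "ennreal (T_log_coeff n / real (Suc n) ^ j) * ennreal (2 * odd_harm (Suc n) / real (Suc n)) =
        ennreal (T_log_coeff n / real (Suc n) ^ j * (2 * odd_harm (Suc n) / real (Suc n)))"
      using b[of n] by (intro ennreal_mult'[symmetric]) simp
    also have "T_log_coeff n / real (Suc n) ^ j * (2 * odd_harm (Suc n) / real (Suc n)) =
        (if even n then 4 * odd_harm (Suc n) else 0) / real (Suc n) ^ (k + 1)"
      by (simp add: T_log_coeff_def k)
    finally show "ennreal (T_log_coeff n / real (Suc n) ^ j) * ennreal (2 * odd_harm (Suc n) / real (Suc n)) =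
        ennreal ((if even n then 4 * odd_harm (Suc n) else 0) / real (Suc n) ^ (k + 1))" .
  qed
  also have "\<dots> = ennreal (odd_harm_odd k)"
    by (rule suminf_ennreal_eq[OF _ odd_harm_odd_even_sums(1)[OF assms]]) (auto simp: odd_harm_nonneg)
  finally have "moment (\<lambda>t. T1.polylog j t / t) 1 1 = enn2real (ennreal (odd_harm_odd k))" .
  moreover have "odd_harm_odd k \<ge> 0"
    by (rule sums_le[OF _ sums_zero odd_harm_odd_even_sums(1)[OF assms]]) (auto simp: odd_harm_nonneg)
  ultimately show ?thesis by (simp add: k)
qed

lemma T1_sums: "k \<ge> 1 \<Longrightarrow> (\<lambda>n. T_log_coeff n / real (Suc n) ^ Suc (k - 1)) sums T_val (k + 1)"
  using T_val_sums[of "k + 1"] unfolding T_log_coeff_def by (cases k) (simp_all add: mult_ac)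

lemma T_sh_single:
  assumes "k \<ge> 1"
  shows "T_sh [k + 1] = [:T_val (k + 1):]"
  using T1.reg_integral_polylog_0[OF T1_sums[OF assms]] assms by (simp add: T_sh_def word_T_def)

text \<open>The case \<open>j = 1\<close> of the regularization formula, with \<open>g\<close> the density of the word of \<open>(k + 1)\<close>.\<close>

lemma T_sh_1_single:
  assumes "k \<ge> 1"
  shows "T_sh [1, k + 1] = smult (T_val (k + 1)) [:ln 2, 1:] - [:odd_harm_odd k:]"
proof -
  have "T_sh [1, k + 1] = reg_integral (replicate 1 omega_m1 @ replicate (Suc (k - 1)) omega_0 @ [omega_m1])"
    using assms by (simp add: T_sh_def word_T_def)
  also have "\<dots> = log_weight.reg_poly (\<lambda>t. T1.polylog (k - 1) t / t) 1"
    by (rule T1.reg_integral_polylog)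
  also have "\<dots> = smult (T_val (k + 1)) [:ln 2, 1:] - [:odd_harm_odd k:]"
    unfolding log_weight.reg_poly_def[OF T1.log_weight_polylog]
    using T1.moment_polylog_0[OF T1_sums[OF assms]] moment_T1_1[OF assms] by simp
  finally show ?thesis .
qed

lemma T_sh_single_1:
  assumes "k \<ge> 1"
  shows "T_sh [k + 1, 1] = [:odd_harm_even k:]"
proof -
  have "(\<lambda>n. square_T_log_coeff n / real (Suc n) ^ Suc (k - 1)) sums odd_harm_even k"
    unfolding square_T_log_coeff_def using odd_harm_odd_even_sums(2)[OF assms] assms by (cases k) (simp_all add: mult_ac)
  from T2.reg_integral_polylog_0[OF this] assms show ?thesis by (simp add: T_sh_def word_T_def)
qed

lemma T_sh_1: "T_sh [1] = [:ln 2, 1:]"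
  using reg_integral_all_omega_m1[of 1] by (simp add: T_sh_def word_T_def)

section \<open>The two symmetric values\<close>

lemma T_symI: "T_sym_poly s = [:c:] \<Longrightarrow> T_sym s = c"
  unfolding T_sym_def by (rule the_equality) auto

lemma T_sym_1_single:
  assumes "k \<ge> 1"
  shows "T_sym [1, k + 1] = (-1) ^ k * odd_harm_even k - odd_harm_odd k"
proof (rule T_symI)
  have "T_sym_poly [1, k + 1] = T_sh [1, k + 1] - T_sh [1] * T_sh [k + 1] + (-1) ^ k * T_sh [k + 1, 1]"
    by (simp add: T_sym_poly_def numeral_2_eq_2 T_sh_def)
  also have "\<dots> = [:(-1) ^ k * odd_harm_even k - odd_harm_odd k:]"
    unfolding T_sh_1_single[OF assms] T_sh_single[OF assms] T_sh_single_1[OF assms] T_sh_1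
    by (cases "even k") (auto simp: mult.commute)
  finally show "T_sym_poly [1, k + 1] = [:(-1) ^ k * odd_harm_even k - odd_harm_odd k:]" .
qed


lemma word_T_replicate_1: "word_T (replicate m 1) = replicate m omega_m1"
  by (induction m) (auto simp: word_T_def)

lemma word_T_append: "word_T (s @ s') = word_T s @ word_T s'"
  by (simp add: word_T_def)

lemma T_sh_replicate_1: "T_sh (replicate m 1) = smult (1 / fact m) ([:ln 2, 1:] ^ m)"
  using reg_integral_all_omega_m1[of m] by (simp add: T_sh_def word_T_replicate_1[simplified])

lemma log_weight_T: "log_weight (\<lambda>t. T_log t / t)"
  by (rule log_weightI[of T_log 1]) (auto simp: T_log_nonneg)

lemma log_weight_S: "log_weight (\<lambda>t. S_log t / t)"
  by (rule log_weightI[of S_log 1]) (auto simp: S_log_nonneg S_log_le_T_log)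

lemma nn_iter_omega_0_Cons:
  assumes "\<And>t. 0 < t \<Longrightarrow> t < 1 \<Longrightarrow> nn_iter w (\<lambda>_. 1) t = ennreal (F t)" "0 < x" "x < 1"
  shows "nn_iter (omega_0 # w) (\<lambda>_. 1) x = (\<integral>\<^sup>+t\<in>{0<..<x}. ennreal (F t / t) \<partial>lborel)"
proof -
  have "ennreal (omega_0 t) * ennreal (F t) = ennreal (F t / t)" if "0 < t" for t
    using that by (simp add: omega_0_def ennreal_mult'[symmetric])
  then show ?thesis
    unfolding nn_iter.simps using assms by (intro nn_integral_cong) (auto simp: indicator_def)
qed

lemma T_sh_replicate_1_2:
  "T_sh (replicate j 1 @ [2]) = log_weight.reg_poly (\<lambda>t. T_log t / t) j"
proof -
  have "word_T (replicate j 1 @ [2]) = replicate j omega_m1 @ [omega_0, omega_m1]"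
    unfolding word_T_append word_T_replicate_1 by (simp add: word_T_def)
  then have "T_sh (replicate j 1 @ [2]) = reg_integral (replicate j omega_m1 @ [omega_0, omega_m1])"
    by (simp add: T_sh_def)
  also have "\<dots> = log_weight.reg_poly (\<lambda>t. T_log t / t) j"
    by (rule log_weight.reg_integral_replicate_omega_m1[OF log_weight_T _ nn_iter_omega_0_Cons])
       (auto simp: nn_iter_omega_m1 simp del: nn_iter.simps)
  finally show ?thesis .
qed

lemma S_sh_replicate_1_2:
  "S_sh (replicate j 1 @ [2]) = log_weight.reg_poly (\<lambda>t. S_log t / t) j"
proof -
  have "word_S (replicate j 1 @ [2]) = replicate j omega_m1 @ [omega_0, omega_1]"
    unfolding word_S_def butlast_snoc last_snoc word_T_replicate_1 by simp
  then have "S_sh (replicate j 1 @ [2]) = reg_integral (replicate j omega_m1 @ [omega_0, omega_1])"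
    by (simp add: S_sh_def)
  also have "\<dots> = log_weight.reg_poly (\<lambda>t. S_log t / t) j"
    by (rule log_weight.reg_integral_replicate_omega_m1[OF log_weight_S _ nn_iter_omega_0_Cons])
       (auto simp: nn_iter_omega_1 simp del: nn_iter.simps)
  finally show ?thesis .
qed

lemma T_sh_2_replicate_1: "T_sh (2 # replicate k 1) = [:T_val (k + 2):]"
proof -
  define F where "F = (\<lambda>t. T_log t ^ Suc k / fact (Suc k))"
  have [measurable]: "F \<in> borel_measurable borel" unfolding F_def by measurable
  have lw: "log_weight (\<lambda>t. F t / t)"
  proof (rule log_weightI[of F "Suc k"])
    fix t :: real assume t: "0 < t" "t < 1"
    have "T_log t ^ Suc k / fact (Suc k) \<le> T_log t ^ Suc k / 1"
      using T_log_nonneg[of t] t by (intro divide_left_mono) (auto simp del: fact_Suc intro: fact_ge_1)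
    then show "0 \<le> F t \<and> F t \<le> T_log t ^ Suc k"
      using T_log_nonneg[of t] t by (simp add: F_def del: fact_Suc)
  qed auto
  have "word_T (2 # replicate k 1) = omega_0 # replicate (Suc k) omega_m1"
    using word_T_append[of "[2]" "replicate k 1"] word_T_replicate_1[of k] by (simp add: word_T_def)
  then have "T_sh (2 # replicate k 1) = reg_integral (replicate 0 omega_m1 @ (omega_0 # replicate (Suc k) omega_m1))"
    by (simp add: T_sh_def)
  also have "\<dots> = log_weight.reg_poly (\<lambda>t. F t / t) 0"
    by (rule log_weight.reg_integral_replicate_omega_m1[OF lw _ nn_iter_omega_0_Cons])
       (auto simp: nn_iter_all_omega_m1 F_def simp del: nn_iter.simps replicate_Suc fact_Suc)
  also have "\<dots> = [:moment (\<lambda>t. F t / t) 0 1:]"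
    by (simp add: log_weight.reg_poly_def[OF lw])
  also have "moment (\<lambda>t. F t / t) 0 1 = (LINT t:{0<..<1}|lborel. T_log t ^ (k + 1) / t / fact (Suc k))"
    unfolding moment_def by (rule set_lebesgue_integral_cong) (auto simp: F_def)
  also have "\<dots> = T_val (k + 2)"
    using T_log_power_integral(2)[of "k + 1"] by (simp only: set_integral_divide_zero) simp
  finally show ?thesis .
qed

text \<open>Only the density \<open>g\<close> depends on the parity of the depth, so both cases are treated at once.\<close>

lemma T_sym_2_replicate_1_moment:
  assumes "\<And>j. (if odd k then T_sh (replicate j 1 @ [2]) else S_sh (replicate j 1 @ [2])) = log_weight.reg_poly g j"
    and g: "log_weight g"
  shows "T_sym (2 # replicate k 1) = T_val (k + 2) + moment g k 1 / fact k"
proof (rule T_symI)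
  let ?s = "2 # replicate k (1::nat)"
  have p: "(\<Prod>l<Suc j. (-1) ^ (?s ! l)) = ((-1) ^ j :: real poly)" if "j \<le> k" for j
  proof -
    have "(\<Prod>l<Suc j. (-1) ^ (?s ! l)) = (\<Prod>l<j. (-1) ^ (replicate k (1::nat) ! l) :: real poly)"
      by (subst prod.lessThan_Suc_shift) simp
    also have "\<dots> = (\<Prod>l<j. (-1))"
      using that by (intro prod.cong) auto
    finally show ?thesis by simp
  qed
  have t: "rev (take (Suc j) ?s) = replicate j 1 @ [2]" "drop (Suc j) ?s = replicate (k - j) 1" if "j \<le> k" for j
    using that by (auto simp: min_def)
  have "T_sym_poly ?s = T_sh ?s + (\<Sum>j\<le>k. (\<Prod>l<Suc j. (-1) ^ (?s ! l)) *
        (if even (length ?s) then T_sh (rev (take (Suc j) ?s)) else S_sh (rev (take (Suc j) ?s))) *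
        T_sh (drop (Suc j) ?s))"
    unfolding T_sym_poly_def length_Cons length_replicate
    by (subst sum.atMost_Suc_shift) (simp add: T_sh_def S_sh_def)
  also have "(\<Sum>j\<le>k. (\<Prod>l<Suc j. (-1) ^ (?s ! l)) *
        (if even (length ?s) then T_sh (rev (take (Suc j) ?s)) else S_sh (rev (take (Suc j) ?s))) *
        T_sh (drop (Suc j) ?s)) =
     (\<Sum>j\<le>k. (-1) ^ j * log_weight.reg_poly g j * smult (1 / fact (k - j)) ([:ln 2, 1:] ^ (k - j)))"
  proof (rule sum.cong[OF refl])
    fix j assume "j \<in> {..k}"
    then have j: "j \<le> k" by simp
    show "(\<Prod>l<Suc j. (-1) ^ (?s ! l)) *
        (if even (length ?s) then T_sh (rev (take (Suc j) ?s)) else S_sh (rev (take (Suc j) ?s))) *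
        T_sh (drop (Suc j) ?s) =
        (-1) ^ j * log_weight.reg_poly g j * smult (1 / fact (k - j)) ([:ln 2, 1:] ^ (k - j))"
      unfolding p[OF j] t[OF j] T_sh_replicate_1 assms(1)[of j, symmetric] by simp
  qed
  also have "\<dots> = [:moment g k 1 / fact k:]"
    by (rule log_weight.alternating_sum_reg_poly[OF g])
  finally show "T_sym_poly ?s = [:T_val (k + 2) + moment g k 1 / fact k:]"
    by (simp only: T_sh_2_replicate_1) simp
qed

lemma T_sym_2_replicate_1_odd:
  assumes "odd k"
  shows "T_sym (2 # replicate k 1) = real (k + 2) * T_val (k + 2)"
proof -
  have "T_sym (2 # replicate k 1) = T_val (k + 2) + moment (\<lambda>t. T_log t / t) k 1 / fact k"
    by (rule T_sym_2_replicate_1_moment[OF _ log_weight_T])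
       (use assms T_sh_replicate_1_2 in simp)
  also have "\<dots> = real (k + 2) * T_val (k + 2)"
    unfolding T_log_moment by (simp add: divide_simps) (simp add: algebra_simps)
  finally show ?thesis .
qed

lemma T_sym_2_replicate_1_even:
  assumes "even k" "k \<ge> 1"
  shows "T_sym (2 # replicate k 1) = real (k + 2) * T_val (k + 2) - (odd_harm_odd k - odd_harm_even k)"
proof -
  have "T_sym (2 # replicate k 1) = T_val (k + 2) + moment (\<lambda>t. S_log t / t) k 1 / fact k"
    by (rule T_sym_2_replicate_1_moment[OF _ log_weight_S])
       (use assms S_sh_replicate_1_2 in simp)
  also have "\<dots> = real (k + 2) * T_val (k + 2) - (odd_harm_odd k - odd_harm_even k)"
    unfolding S_log_moment[OF assms(2)] by (simp add: algebra_simps)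
  finally show ?thesis .
qed

section \<open>Partial fractions and interchange of double series\<close>

lemma telescope_sums_step:
  fixes v :: "nat \<Rightarrow> real"
  assumes "v \<longlonglongrightarrow> 0"
  shows "(\<lambda>n. v n - v (n + m)) sums (\<Sum>n<m. v n)"
proof (induction m)
  case (Suc m)
  have "(\<lambda>n. v (n + m)) \<longlonglongrightarrow> 0" by (rule LIMSEQ_ignore_initial_segment[OF assms])
  from sums_add[OF Suc telescope_sums'[OF this]] show ?case by simp
qed simp

text \<open>Since \<open>2a / (N\<^sup>2 - a\<^sup>2) = 1/(N - a) - 1/(N + a)\<close>, the series telescopes with step \<open>2a\<close>, and the
  surviving block of reciprocals is antisymmetric around \<open>N = a\<close>.\<close>

lemma sums_inverse_square_diff:
  assumes a: "a \<ge> 1"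
  shows "(\<lambda>N. if N = 0 \<or> N = a then 0 else 1 / ((real N)\<^sup>2 - (real a)\<^sup>2)) sums (3 / (4 * (real a)\<^sup>2))"
proof -
  \<comment> \<open>With \<open>inverse 0 = 0\<close> the difference of reciprocals also has values at \<open>N = 0\<close> and \<open>N = a\<close>, which are corrected afterwards.\<close>
  define v where "v N = inverse (real N - real a)" for N
  have "v \<longlonglongrightarrow> 0" unfolding v_def by real_asymp
  from telescope_sums_step[OF this, of "2 * a"]
  have "(\<lambda>N. v N - v (N + 2 * a)) sums (\<Sum>N<2 * a. v N)" .
  also have "(\<Sum>N<2 * a. v N) = - (1 / real a)"
  proof -
    have "(\<Sum>N\<in>{1..<2 * a}. v N) = (\<Sum>N\<in>{1..<2 * a}. - v N)"
      by (rule sum.reindex_bij_witness[of _ "\<lambda>N. 2 * a - N" "\<lambda>N. 2 * a - N"])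
         (auto simp: v_def of_nat_diff inverse_minus_eq[symmetric])
    then have "(\<Sum>N\<in>{1..<2 * a}. v N) = 0" by (simp add: sum_negf)
    moreover have "{..<2 * a} = insert 0 {1..<2 * a}" using a by auto
    ultimately show ?thesis by (simp add: v_def inverse_eq_divide)
  qed
  finally have "(\<lambda>N. 1 / (2 * real a) * (v N - v (N + 2 * a))) sums (1 / (2 * real a) * (- (1 / real a)))"
    by (rule sums_mult)
  moreover have "(\<lambda>N. (if N \<in> {0, a} then if N = 0 then 1 / (real a)\<^sup>2 else 1 / (4 * (real a)\<^sup>2) else 0)) sums
      (\<Sum>N\<in>{0, a}. if N = 0 then 1 / (real a)\<^sup>2 else 1 / (4 * (real a)\<^sup>2))"
    by (rule sums_If_finite_set) auto
  ultimately have "(\<lambda>N. 1 / (2 * real a) * (v N - v (N + 2 * a)) +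
     (if N \<in> {0, a} then if N = 0 then 1 / (real a)\<^sup>2 else 1 / (4 * (real a)\<^sup>2) else 0)) sums
     (1 / (2 * real a) * (- (1 / real a)) + (\<Sum>N\<in>{0, a}. if N = 0 then 1 / (real a)\<^sup>2 else 1 / (4 * (real a)\<^sup>2)))"
    by (rule sums_add)
  moreover have "1 / (2 * real a) * (- (1 / real a)) + (\<Sum>N\<in>{0, a}. if N = 0 then 1 / (real a)\<^sup>2 else 1 / (4 * (real a)\<^sup>2))
     = 3 / (4 * (real a)\<^sup>2)"
    using a by (simp add: field_simps power2_eq_square)
  moreover have "1 / (2 * real a) * (v N - v (N + 2 * a)) +
     (if N \<in> {0, a} then if N = 0 then 1 / (real a)\<^sup>2 else 1 / (4 * (real a)\<^sup>2) else 0) =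
     (if N = 0 \<or> N = a then 0 else 1 / ((real N)\<^sup>2 - (real a)\<^sup>2))" for N
  proof -
    consider "N = 0" | "N = a" "N \<noteq> 0" | "N \<noteq> 0" "N \<noteq> a" by blast
    then show ?thesis
    proof cases
      case 3
      then have "real N - real a \<noteq> 0" "real N + real a \<noteq> 0" "real a \<noteq> 0" using a by auto
      moreover have "(real N)\<^sup>2 - (real a)\<^sup>2 = (real N - real a) * (real N + real a)"
        by (simp add: algebra_simps power2_eq_square)
      ultimately show ?thesis using 3 by (simp add: v_def field_simps)
    qed (use a in \<open>auto simp: v_def field_simps power2_eq_square\<close>)
  qed
  ultimately show ?thesis by simp
qed

text \<open>With the convention \<open>inverse 0 = 0\<close>, \<open>c\<close> is formally an even function: both sides satisfy the same
  recurrence of step two and agree at 0 and 1.\<close>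

lemma odd_harm_symmetric:
  "(\<lambda>j. inverse (real (2 * j + 1)) - inverse (real (2 * j + 1) - real N)) sums odd_harm N"
proof (induction N rule: induct_nat_012)
  case 1
  have "(\<lambda>n. (- 1) ^ n / real (Suc n)) sums ln 2" by (rule alternating_harmonic_series_sums)
  then have *: "(\<lambda>n. (- 1) ^ Suc n / real (Suc (Suc n))) sums (ln 2 - 1)"
    by (subst sums_Suc_iff) simp
  have "(\<lambda>n. \<Sum>i\<in>{n * 2..<n * 2 + 2}. (- 1) ^ Suc i / real (Suc (Suc i))) sums (ln 2 - 1)"
    by (rule sums_group[OF *]) simp
  moreover have "{n * 2..<n * 2 + 2} = {2 * n, 2 * n + 1}" for n :: nat by auto
  ultimately have "(\<lambda>n. inverse (real (2 * Suc n + 1)) - inverse (real (2 * Suc n + 1) - real (Suc 0))) sums (ln 2 - 1)"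
    by (simp add: inverse_eq_divide add_ac mult.commute)
  then show ?case
    using sums_Suc_iff[of "\<lambda>n. inverse (real (2 * n + 1)) - inverse (real (2 * n + 1) - real (Suc 0))" "ln 2 - 1"]
    by (simp add: odd_harm_1)
next
  case (ge2 N)
  have "(\<lambda>j. inverse (2 * real j - 1 - real N)) \<longlonglongrightarrow> 0" by real_asymp
  from sums_add[OF ge2(1) telescope_sums[OF this]]
  have "(\<lambda>j. inverse (real (2 * j + 1)) - inverse (real (2 * j + 1) - real (Suc (Suc N)))) sums
     (odd_harm N + (0 - inverse (- 1 - real N)))"
    by (simp add: algebra_simps)
  moreover have "- inverse (- 1 - real N) = 1 / real (N + 1)"
    by (simp add: field_simps)
  ultimately show ?case using odd_harm_add_2[of N] by simp
qed simp

text \<open>Partial fractions split the summand into \<open>1/a - 1/(a + N)\<close> and \<open>1/a - 1/(a - N)\<close>, each of which sums to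
  \<open>c(N)\<close>.  The diagonal term \<open>a = N\<close>, present only for odd \<open>N\<close>, has to be taken out.\<close>

lemma sums_odd_partial_fraction:
  assumes N: "N \<ge> 1"
  shows "(\<lambda>a. if odd a \<and> a \<noteq> N then 1 / (real a * ((real a)\<^sup>2 - (real N)\<^sup>2)) else 0) sums
     ((- odd_harm N + (if odd N then 3 / (4 * real N) else 0)) / (real N)\<^sup>2)"
proof -
  define t where "t a = 1 / 2 * ((inverse (real a) - inverse (real a + real N)) +
     (inverse (real a) - inverse (real a - real N)))" for a
  have "(\<lambda>j. 1 / 2 * ((inverse (real (2 * j + 1)) - inverse (real (2 * j + 1) + real N)) +
     (inverse (real (2 * j + 1)) - inverse (real (2 * j + 1) - real N)))) sums (1 / 2 * (odd_harm N + odd_harm N))"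
    using odd_harm_sums[of N] by (intro sums_mult sums_add odd_harm_symmetric) (simp add: inverse_eq_divide add.assoc)
  moreover have "1 / 2 * (odd_harm N + odd_harm N) = odd_harm N" by simp
  ultimately have "(\<lambda>j. t (2 * j + 1)) sums odd_harm N" by (simp only: t_def)
  then have "(\<lambda>a. if odd a then t a else 0) sums odd_harm N"
    by (intro sums_odd_reindex[where f = "\<lambda>a. if odd a then t a else 0"]) simp_all
  moreover have "(\<lambda>a. if a = N then (if odd a then 3 / (4 * real N) else 0) else 0) sums (if odd N then 3 / (4 * real N) else 0)"
    by (rule sums_single)
  ultimately have "(\<lambda>a. (- (if odd a then t a else 0) + (if a = N then (if odd a then 3 / (4 * real N) else 0) else 0)) / (real N)\<^sup>2) sums
     ((- odd_harm N + (if odd N then 3 / (4 * real N) else 0)) / (real N)\<^sup>2)"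
    by (intro sums_divide sums_add sums_minus)
  moreover have "(- (if odd a then t a else 0) + (if a = N then (if odd a then 3 / (4 * real N) else 0) else 0)) / (real N)\<^sup>2 =
     (if odd a \<and> a \<noteq> N then 1 / (real a * ((real a)\<^sup>2 - (real N)\<^sup>2)) else 0)" for a
  proof -
    consider "even a" | "odd a" "a = N" | "odd a" "a \<noteq> N" by blast
    then show ?thesis
    proof cases
      case 3
      then have "real a \<noteq> 0" by (auto elim: oddE)
      with 3 have "real a - real N \<noteq> 0" "real a + real N \<noteq> 0" "real a \<noteq> 0" "real N \<noteq> 0" using N by auto
      moreover have "(real a)\<^sup>2 - (real N)\<^sup>2 = (real a - real N) * (real a + real N)"
        by (simp add: algebra_simps power2_eq_square)
      ultimately have "- t a / (real N)\<^sup>2 = 1 / (real a * ((real a)\<^sup>2 - (real N)\<^sup>2))"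
        by (simp add: t_def divide_simps) (simp add: algebra_simps power2_eq_square)
      with 3 show ?thesis by simp
    qed (use N in \<open>auto simp: t_def field_simps\<close>)
  qed
  ultimately show ?thesis by simp
qed

lemma abs_diff_powr_summable:
  "\<exists>C. \<forall>a. (\<exists>s. (\<lambda>N. \<bar>real a - real N\<bar> powr (- 3 / 2)) sums s \<and> s \<le> C)"
proof -
  have sm: "summable (\<lambda>n. real n powr (- 3 / 2))" by (simp add: summable_real_powr_iff)
  define c where "c = (\<Sum>n. real n powr (- 3 / 2))"
  have "\<exists>s. (\<lambda>N. \<bar>real a - real N\<bar> powr (- 3 / 2)) sums s \<and> s \<le> 2 * c" for a
  proof -
    have "(\<lambda>n. \<bar>real a - real (n + a)\<bar> powr (- 3 / 2)) sums c"
      using summable_sums[OF sm] by (simp add: c_def)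
    then have "(\<lambda>N. \<bar>real a - real N\<bar> powr (- 3 / 2)) sums (c + (\<Sum>N<a. \<bar>real a - real N\<bar> powr (- 3 / 2)))"
      by (rule sums_iff_shift[THEN iffD1])
    moreover have "(\<Sum>N<a. \<bar>real a - real N\<bar> powr (- 3 / 2)) = (\<Sum>n\<in>{1..a}. real n powr (- 3 / 2))"
      by (rule sum.reindex_bij_witness[of _ "\<lambda>n. a - n" "\<lambda>N. a - N"]) (auto simp: of_nat_diff)
    moreover have "(\<Sum>n\<in>{1..a}. real n powr (- 3 / 2)) \<le> c"
      unfolding c_def by (rule sum_le_suminf[OF sm]) auto
    ultimately show ?thesis by (auto intro!: exI)
  qed
  then show ?thesis by blast
qed

text \<open>Fubini for double series with the majorant \<open>(a |a - N|)\<^sup>-\<^sup>3\<^sup>/\<^sup>2\<close>, whose row sums are at most a constant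
  times \<open>a\<^sup>-\<^sup>3\<^sup>/\<^sup>2\<close>.\<close>

lemma sums_swap:
  fixes h :: "nat \<Rightarrow> nat \<Rightarrow> real"
  assumes bound: "\<And>a N. \<bar>h a N\<bar> \<le> real a powr (- 3 / 2) * \<bar>real a - real N\<bar> powr (- 3 / 2)"
    and R: "\<And>a. (\<lambda>N. h a N) sums R a"
    and C: "\<And>N. (\<lambda>a. h a N) sums C N"
  shows "\<exists>S. R sums S \<and> C sums S"
proof -
  obtain K where K: "\<And>a. \<exists>s. (\<lambda>N. \<bar>real a - real N\<bar> powr (- 3 / 2)) sums s \<and> s \<le> K"
    using abs_diff_powr_summable by blast
  have rows: "summable (\<lambda>N. \<bar>h a N\<bar>) \<and> (\<Sum>N. \<bar>h a N\<bar>) \<le> real a powr (- 3 / 2) * K" for a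
  proof -
    from K[of a] obtain s where s: "(\<lambda>N. \<bar>real a - real N\<bar> powr (- 3 / 2)) sums s" "s \<le> K" by blast
    from sums_mult[OF s(1), of "real a powr (- 3 / 2)"]
    have s': "(\<lambda>N. real a powr (- 3 / 2) * \<bar>real a - real N\<bar> powr (- 3 / 2)) sums (real a powr (- 3 / 2) * s)" .
    have sm: "summable (\<lambda>N. \<bar>h a N\<bar>)"
      by (rule summable_comparison_test'[OF sums_summable[OF s']]) (use bound in auto)
    moreover have "(\<Sum>N. \<bar>h a N\<bar>) \<le> real a powr (- 3 / 2) * s"
      using suminf_le[OF bound sm sums_summable[OF s']] s' by (simp add: sums_iff)
    moreover have "real a powr (- 3 / 2) * s \<le> real a powr (- 3 / 2) * K" using s(2) by (intro mult_left_mono) auto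
    ultimately show ?thesis by linarith
  qed
  have rs: "((\<lambda>N. \<bar>h a N\<bar>) has_sum (\<Sum>N. \<bar>h a N\<bar>)) UNIV" for a
    using rows[of a] by (intro sums_nonneg_imp_has_sum summable_sums) auto
  have "summable (\<lambda>a. \<Sum>N. \<bar>h a N\<bar>)"
  proof (rule summable_comparison_test')
    show "summable (\<lambda>a. real a powr (- 3 / 2) * K)"
      by (intro summable_mult2) (simp add: summable_real_powr_iff)
    show "norm (\<Sum>N. \<bar>h a N\<bar>) \<le> real a powr (- 3 / 2) * K" for a
      using rows[of a] suminf_nonneg[of "\<lambda>N. \<bar>h a N\<bar>"] by simp
  qed
  then have "(\<lambda>a. \<Sum>N. \<bar>h a N\<bar>) summable_on UNIV"
    using rows by (subst summable_on_UNIV_nonneg_real_iff) (auto intro!: suminf_nonneg)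
  moreover have "0 \<le> (\<Sum>N. \<bar>h a N\<bar>)" for a using rows[of a] by (intro suminf_nonneg) auto
  moreover have "(\<lambda>N. \<bar>h a N\<bar>) summable_on UNIV" for a using rs[of a] by (auto simp: summable_on_def)
  ultimately have "(\<lambda>x. norm (case x of (a, N) \<Rightarrow> h a N)) summable_on (UNIV \<times> UNIV)"
    by (intro Infinite_Sum.abs_summable_on_Sigma_iff[THEN iffD2] conjI ballI) (simp_all add: infsumI[OF rs])
  then have "(\<lambda>(a, N). h a N) summable_on (UNIV \<times> UNIV)"
    by (rule Infinite_Sum.abs_summable_summable)
  then obtain S where S: "((\<lambda>(a, N). h a N) has_sum S) (UNIV \<times> UNIV)"
    by (auto simp: summable_on_def)
  then have S': "((\<lambda>(N, a). h a N) has_sum S) (UNIV \<times> UNIV)"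
    by (subst has_sum_swap) simp
  have "(R has_sum S) UNIV"
  proof (rule has_sum_SigmaD[OF S])
    show "((\<lambda>N. case (a, N) of (a, N) \<Rightarrow> h a N) has_sum R a) UNIV" for a
      using norm_summable_imp_has_sum[OF _ R[of a]] rows[of a] by simp
  qed
  moreover have "(C has_sum S) UNIV"
  proof (rule has_sum_SigmaD[OF S'])
    fix N
    have "(\<lambda>a. h a N) summable_on UNIV"
      by (rule summable_on_SigmaD1[of "\<lambda>N a. h a N" UNIV "\<lambda>_. UNIV"]) (use S' in \<open>auto simp: summable_on_def\<close>)
    then obtain c where c: "((\<lambda>a. h a N) has_sum c) UNIV" by (auto simp: summable_on_def)
    from has_sum_imp_sums[OF this] C[of N] have "c = C N" by (rule sums_unique2)
    with c show "((\<lambda>a. case (N, a) of (N, a) \<Rightarrow> h a N) has_sum C N) UNIV" by simp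
  qed
  ultimately show ?thesis using has_sum_imp_sums by blast
qed

text \<open>With \<open>d = |a - N|\<close> the denominator is \<open>a d (a + N)\<close>, and \<open>a + N\<close> is at least the geometric mean of
  \<open>a\<close> and \<open>d\<close>.\<close>

lemma inverse_square_diff_bound:
  assumes "a \<ge> 1" "N \<noteq> a"
  shows "1 / (real a * \<bar>(real a)\<^sup>2 - (real N)\<^sup>2\<bar>) \<le> real a powr (- 3 / 2) * \<bar>real a - real N\<bar> powr (- 3 / 2)"
proof -
  define d where "d = \<bar>real a - real N\<bar>"
  have d: "d > 0" "d \<le> real a + real N" using assms by (auto simp: d_def)
  have a: "real a > 0" using assms by simp
  have "real a * d \<le> (real a + real N) * (real a + real N)"
    using d a by (intro mult_mono) auto
  then have "sqrt (real a * d) \<le> sqrt ((real a + real N)\<^sup>2)"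
    by (intro real_sqrt_le_mono) (simp add: power2_eq_square)
  then have "sqrt (real a * d) \<le> real a + real N" by simp
  then have le: "(real a * d) * sqrt (real a * d) \<le> (real a * d) * (real a + real N)"
    using a d by (intro mult_left_mono) auto
  have "(real a)\<^sup>2 - (real N)\<^sup>2 = (real a - real N) * (real a + real N)"
    by (simp add: algebra_simps power2_eq_square)
  then have "real a * \<bar>(real a)\<^sup>2 - (real N)\<^sup>2\<bar> = (real a * d) * (real a + real N)"
    by (simp add: abs_mult d_def)
  then have "1 / (real a * \<bar>(real a)\<^sup>2 - (real N)\<^sup>2\<bar>) \<le> 1 / ((real a * d) * sqrt (real a * d))"
    using le a d by (metis divide_left_mono mult_pos_pos real_sqrt_gt_zero zero_le_one add_pos_nonneg of_nat_0_le_iff)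
  also have "\<dots> = (real a * d) powr (- 3 / 2)"
  proof -
    have "(real a * d) powr (3 / 2) = (real a * d) powr (1 + 1 / 2)" by simp
    also have "\<dots> = (real a * d) * sqrt (real a * d)"
      using a d by (subst powr_add) (simp add: powr_half_sqrt)
    finally show ?thesis by (simp add: powr_minus_divide)
  qed
  also have "\<dots> = real a powr (- 3 / 2) * d powr (- 3 / 2)"
    by (rule powr_mult)
  finally show ?thesis by (simp add: d_def)
qed

section \<open>Double series with values in products of zeta and T-values\<close>

lemma zeta_val_sums:
  assumes "m \<ge> 2"
  shows "(\<lambda>N. 1 / real N ^ m) sums zeta_val m"
proof -
  have "summable (\<lambda>n. 1 / real n ^ m)"
    using inverse_power_summable[OF assms, where 'a = real] by (simp add: inverse_eq_divide)
  then have "summable (\<lambda>n. 1 / real (Suc n) ^ m)" by (subst summable_Suc_iff)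
  then have "(\<lambda>n. 1 / real (Suc n) ^ m) sums zeta_val m"
    unfolding zeta_val_def by (rule summable_sums)
  then show ?thesis
    using sums_Suc_iff[of "\<lambda>n. 1 / real n ^ m" "zeta_val m"] assms by (simp add: power_0_left)
qed

lemma T_val_sums_odd:
  assumes "m \<ge> 2"
  shows "(\<lambda>N. (if odd N then 1 else 0) / real N ^ m) sums (T_val m / 2)"
proof -
  have "(\<lambda>n. (if even n then 2 else 0) / real (Suc n) ^ m / 2) sums (T_val m / 2)"
    by (intro sums_divide T_val_sums assms)
  also have "(\<lambda>n. (if even n then 2 else 0) / real (Suc n) ^ m / 2) = (\<lambda>n. (if odd (Suc n) then 1 else 0) / real (Suc n) ^ m)"
    by (auto simp: fun_eq_iff)
  finally show ?thesis
    using sums_Suc_iff[of "\<lambda>N. (if odd N then 1 else 0) / real N ^ m" "T_val m / 2"] by simp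
qed

lemma two_variable_geometric_sum:
  fixes x y :: real
  shows "(x - y) * (\<Sum>n = 1..r. x ^ n * y ^ (r + 1 - n)) = x * y * (x ^ r - y ^ r)"
proof (induction r)
  case (Suc r)
  have "(\<Sum>n = 1..r. x ^ n * y ^ (Suc r + 1 - n)) = (\<Sum>n = 1..r. y * (x ^ n * y ^ (r + 1 - n)))"
    by (intro sum.cong) (auto simp: Suc_diff_le)
  then have "(\<Sum>n = 1..Suc r. x ^ n * y ^ (Suc r + 1 - n)) = y * (\<Sum>n = 1..r. x ^ n * y ^ (r + 1 - n)) + x ^ Suc r * y"
    by (simp add: sum_distrib_left)
  then have "(x - y) * (\<Sum>n = 1..Suc r. x ^ n * y ^ (Suc r + 1 - n)) =
      y * ((x - y) * (\<Sum>n = 1..r. x ^ n * y ^ (r + 1 - n))) + (x - y) * (x ^ Suc r * y)"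
    by (simp only:) (simp add: algebra_simps)
  then show ?case unfolding Suc by (simp add: algebra_simps)
qed simp

text \<open>With \<open>x = N\<^sup>-\<^sup>2\<close> and \<open>y = a\<^sup>-\<^sup>2\<close>, the finite geometric sum of the \<open>x\<^sup>n y\<^sup>r\<^sup>+\<^sup>1\<^sup>-\<^sup>n\<close> equals
  \<open>(x\<^sup>r - y\<^sup>r) / (a\<^sup>2 - N\<^sup>2)\<close> off the diagonal and \<open>r y\<^sup>r\<^sup>+\<^sup>1\<close> on it.  Summing over \<open>N\<close> produces the zeta
  values; the part with \<open>y\<^sup>r\<close> is \<open>sums_inverse_square_diff\<close>.\<close>

lemma sums_power_square_diff:
  assumes a: "a \<ge> 1"
  shows "(\<lambda>N. if N = 0 \<or> N = a then 0 else 1 / (real N ^ (2 * r) * ((real a)\<^sup>2 - (real N)\<^sup>2))) sums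
    ((\<Sum>n = 1..r. zeta_val (2 * n) / real a ^ (2 * (r + 1 - n))) - (real r + 3 / 4) / real a ^ (2 * (r + 1)))"
proof -
  define G where "G N = (\<Sum>n = 1..r. 1 / real N ^ (2 * n) / real a ^ (2 * (r + 1 - n)))" for N
  define q where "q = 1 / real a ^ (2 * r)"
  have "G sums (\<Sum>n = 1..r. zeta_val (2 * n) / real a ^ (2 * (r + 1 - n)))"
    unfolding G_def by (intro sums_sum sums_divide zeta_val_sums) auto
  moreover have "(\<lambda>N. if N = a then real r / real a ^ (2 * (r + 1)) else 0) sums (real r / real a ^ (2 * (r + 1)))"
    by (rule sums_single)
  ultimately have "(\<lambda>N. G N - (if N = a then real r / real a ^ (2 * (r + 1)) else 0) -
      q * (if N = 0 \<or> N = a then 0 else 1 / ((real N)\<^sup>2 - (real a)\<^sup>2))) sums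
      ((\<Sum>n = 1..r. zeta_val (2 * n) / real a ^ (2 * (r + 1 - n))) - real r / real a ^ (2 * (r + 1)) -
       q * (3 / (4 * (real a)\<^sup>2)))"
    by (intro sums_diff sums_mult sums_inverse_square_diff[OF a])
  moreover have "G N - (if N = a then real r / real a ^ (2 * (r + 1)) else 0) -
      q * (if N = 0 \<or> N = a then 0 else 1 / ((real N)\<^sup>2 - (real a)\<^sup>2)) =
      (if N = 0 \<or> N = a then 0 else 1 / (real N ^ (2 * r) * ((real a)\<^sup>2 - (real N)\<^sup>2)))" for N
  proof -
    consider "N = 0" | "N = a" "N \<noteq> 0" | "N \<noteq> 0" "N \<noteq> a" by blast
    then show ?thesis
    proof cases
      case 1
      then show ?thesis using a by (simp add: G_def power_0_left)
    next
      case 2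
      have "1 / real a ^ (2 * n) / real a ^ (2 * (r + 1 - n)) = 1 / real a ^ (2 * (r + 1))" if "n \<in> {1..r}" for n
      proof -
        have "2 * n + 2 * (r + 1 - n) = 2 * (r + 1)" using that by auto
        then have "real a ^ (2 * n) * real a ^ (2 * (r + 1 - n)) = real a ^ (2 * (r + 1))"
          by (simp only: power_add[symmetric])
        then show ?thesis by simp
      qed
      then have "G a = (\<Sum>n = 1..r. 1 / real a ^ (2 * (r + 1)))"
        unfolding G_def by (intro sum.cong) auto
      then have "G a = real r / real a ^ (2 * (r + 1))" by simp
      with 2 show ?thesis by simp
    next
      case 3
      define x y where "x = 1 / (real N)\<^sup>2" and "y = 1 / (real a)\<^sup>2"
      have xy: "x \<noteq> 0" "y \<noteq> 0" "(real a)\<^sup>2 = 1 / y" "(real N)\<^sup>2 = 1 / x" using 3 a by (auto simp: x_def y_def)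
      have ne: "(real a)\<^sup>2 \<noteq> (real N)\<^sup>2" using 3 by (simp add: power2_eq_iff_nonneg)
      then have d: "x - y \<noteq> 0" using xy by auto
      have G: "G N = (\<Sum>n = 1..r. x ^ n * y ^ (r + 1 - n))"
        unfolding G_def x_def y_def by (simp add: power_mult power_divide)
      have "(real a)\<^sup>2 - (real N)\<^sup>2 = (x - y) / (x * y)" using xy by (simp add: field_simps)
      then have "1 / ((real a)\<^sup>2 - (real N)\<^sup>2) = x * y / (x - y)" by simp
      moreover have "G N = x * y / (x - y) * (x ^ r - y ^ r)"
        using two_variable_geometric_sum[of x y r] d unfolding G by (simp add: field_simps)
      moreover have "x ^ r = 1 / real N ^ (2 * r)" "y ^ r = q"
        by (simp_all add: x_def y_def q_def power_mult power_divide)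
      ultimately have "G N = 1 / ((real a)\<^sup>2 - (real N)\<^sup>2) * (1 / real N ^ (2 * r) - q)" by simp
      moreover have "1 / ((real N)\<^sup>2 - (real a)\<^sup>2) = - (1 / ((real a)\<^sup>2 - (real N)\<^sup>2))"
        by (simp add: minus_divide_right)
      moreover have "w * (1 / z - q) - q * (- w) = w / z" for w z :: real
        by (simp add: algebra_simps)
      ultimately have "G N - q * (1 / ((real N)\<^sup>2 - (real a)\<^sup>2)) =
          1 / ((real a)\<^sup>2 - (real N)\<^sup>2) / real N ^ (2 * r)"
        by (simp only:)
      then show ?thesis using 3 by (simp add: mult.commute)
    qed
  qed
  moreover have "(\<Sum>n = 1..r. zeta_val (2 * n) / real a ^ (2 * (r + 1 - n))) - real r / real a ^ (2 * (r + 1)) -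
       q * (3 / (4 * (real a)\<^sup>2)) =
     (\<Sum>n = 1..r. zeta_val (2 * n) / real a ^ (2 * (r + 1 - n))) - (real r + 3 / 4) / real a ^ (2 * (r + 1))"
    by (simp add: q_def power_add add_divide_distrib power2_eq_square)
  ultimately show ?thesis by (simp only:)
qed

text \<open>Euler's convolution formula, by summing \<open>1 / (N\<^sup>2\<^sup>r (a\<^sup>2 - N\<^sup>2))\<close> over \<open>a \<noteq> N\<close> in both orders.
  The hypothesis \<open>r \<ge> 1\<close> is what makes the double series absolutely convergent.\<close>

lemma zeta_even_convolution:
  assumes r: "r \<ge> 1"
  shows "(\<Sum>n = 1..r. zeta_val (2 * n) * zeta_val (2 * (r + 1 - n))) = (real r + 3 / 2) * zeta_val (2 * (r + 1))"
proof -
  \<comment> \<open>The roles are exchanged here: the outer index of the majorant is \<open>N\<close>, which carries the power.\<close>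
  define h where "h N a = (if N = 0 \<or> a = 0 \<or> N = a then 0 else 1 / (real N ^ (2 * r) * ((real a)\<^sup>2 - (real N)\<^sup>2)))" for N a
  define C where "C a = (\<Sum>n = 1..r. zeta_val (2 * n) / real a ^ (2 * (r + 1 - n))) - (real r + 3 / 4) / real a ^ (2 * (r + 1))" for a :: nat
  define R where "R N = 3 / 4 * (1 / real N ^ (2 * (r + 1)))" for N :: nat
  have "\<exists>S. R sums S \<and> C sums S"
  proof (rule sums_swap)
    fix N a
    show "\<bar>h N a\<bar> \<le> real N powr (- 3 / 2) * \<bar>real N - real a\<bar> powr (- 3 / 2)"
    proof (cases "N = 0 \<or> a = 0 \<or> N = a")
      case False
      then have "\<bar>h N a\<bar> = 1 / (real N ^ (2 * r) * \<bar>(real N)\<^sup>2 - (real a)\<^sup>2\<bar>)"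
        by (simp add: h_def abs_mult abs_minus_commute)
      also have "\<dots> \<le> 1 / (real N ^ 1 * \<bar>(real N)\<^sup>2 - (real a)\<^sup>2\<bar>)"
      proof (intro divide_left_mono mult_right_mono mult_pos_pos)
        show "real N ^ 1 \<le> real N ^ (2 * r)" using False r by (intro power_increasing) auto
        show "0 < \<bar>(real N)\<^sup>2 - (real a)\<^sup>2\<bar>" using False by (simp add: power2_eq_iff_nonneg)
      qed (use False in auto)
      also have "\<dots> \<le> real N powr (- 3 / 2) * \<bar>real N - real a\<bar> powr (- 3 / 2)"
        using inverse_square_diff_bound[of N a] False by simp
      finally show ?thesis .
    qed (auto simp: h_def)
  next
    fix N
    show "(\<lambda>a. h N a) sums R N"
    proof (cases "N = 0")
      case True
      then show ?thesis by (simp add: h_def R_def)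
    next
      case False
      then have "(\<lambda>a. 1 / real N ^ (2 * r) * (if a = 0 \<or> a = N then 0 else 1 / ((real a)\<^sup>2 - (real N)\<^sup>2))) sums
          (1 / real N ^ (2 * r) * (3 / (4 * (real N)\<^sup>2)))"
        by (intro sums_mult sums_inverse_square_diff) auto
      also have "(\<lambda>a. 1 / real N ^ (2 * r) * (if a = 0 \<or> a = N then 0 else 1 / ((real a)\<^sup>2 - (real N)\<^sup>2))) = h N"
        using False by (auto simp: h_def fun_eq_iff)
      also have "1 / real N ^ (2 * r) * (3 / (4 * (real N)\<^sup>2)) = R N"
        by (simp add: R_def power_add power2_eq_square)
      finally show ?thesis .
    qed
  next
    fix a
    show "(\<lambda>N. h N a) sums C a"
    proof (cases "a = 0")
      case True
      have "(\<Sum>n = 1..r. zeta_val (2 * n) / 0 ^ (2 * (r + 1 - n))) = (\<Sum>n = 1..r. 0)"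
        by (intro sum.cong) (auto simp: power_0_left)
      with True show ?thesis by (simp add: h_def C_def)
    next
      case False
      then show ?thesis using sums_power_square_diff[of a r] by (simp add: h_def C_def)
    qed
  qed
  then obtain S where S: "R sums S" "C sums S" by blast
  have "R sums (3 / 4 * zeta_val (2 * (r + 1)))"
    unfolding R_def by (intro sums_mult zeta_val_sums) auto
  with S(1) have S1: "S = 3 / 4 * zeta_val (2 * (r + 1))" by (rule sums_unique2)
  have "(\<lambda>a. (\<Sum>n = 1..r. zeta_val (2 * n) * (1 / real a ^ (2 * (r + 1 - n)))) - (real r + 3 / 4) * (1 / real a ^ (2 * (r + 1)))) sums
     ((\<Sum>n = 1..r. zeta_val (2 * n) * zeta_val (2 * (r + 1 - n))) - (real r + 3 / 4) * zeta_val (2 * (r + 1)))"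
    by (intro sums_diff sums_sum sums_mult zeta_val_sums) auto
  then have "C sums ((\<Sum>n = 1..r. zeta_val (2 * n) * zeta_val (2 * (r + 1 - n))) - (real r + 3 / 4) * zeta_val (2 * (r + 1)))"
    unfolding C_def by simp
  with S(2) have "S = (\<Sum>n = 1..r. zeta_val (2 * n) * zeta_val (2 * (r + 1 - n))) - (real r + 3 / 4) * zeta_val (2 * (r + 1))"
    by (rule sums_unique2)
  with S1 show ?thesis by (simp add: algebra_simps)
qed

text \<open>The double series of \<open>1 / (a N\<^sup>2\<^sup>r (a\<^sup>2 - N\<^sup>2))\<close> over odd \<open>a \<noteq> N\<close>.  The factor \<open>1/a\<close> makes it absolutely
  convergent even for \<open>r = 0\<close>, and it turns the sum over \<open>a\<close> into the numbers \<open>c(N)\<close>.\<close>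

lemma odd_harm_series_value:
  fixes r :: nat
  defines "k \<equiv> 2 * r + 1"
  shows "odd_harm_odd k + odd_harm_even k =
    real (k + 2) * T_val (k + 2) - 2 * (\<Sum>n = 1..r. zeta_val (2 * n) * T_val (k + 2 - 2 * n))"
proof -
  define E where "E = (odd_harm_odd k + odd_harm_even k) / 4"
  define h where "h a N = (if even a \<or> N = 0 \<or> N = a then 0 else 1 / (real a * real N ^ (2 * r) * ((real a)\<^sup>2 - (real N)\<^sup>2)))" for a N
  define R where "R a = (\<Sum>n = 1..r. zeta_val (2 * n) * ((if odd a then 1 else 0) / real a ^ (k + 2 - 2 * n))) -
     (real r + 3 / 4) * ((if odd a then 1 else 0) / real a ^ (k + 2))" for a :: nat
  define C where "C N = - (odd_harm N / real N ^ (k + 1)) + 3 / 4 * ((if odd N then 1 else 0) / real N ^ (k + 2))" for N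
  have "\<exists>S. R sums S \<and> C sums S"
  proof (rule sums_swap)
    fix a N
    show "\<bar>h a N\<bar> \<le> real a powr (- 3 / 2) * \<bar>real a - real N\<bar> powr (- 3 / 2)"
    proof (cases "even a \<or> N = 0 \<or> N = a")
      case False
      then have a: "a \<ge> 1" by (auto elim: oddE)
      have "\<bar>h a N\<bar> = 1 / (real N ^ (2 * r) * (real a * \<bar>(real a)\<^sup>2 - (real N)\<^sup>2\<bar>))"
        using False by (simp add: h_def abs_mult mult_ac)
      also have "\<dots> \<le> 1 / (1 * (real a * \<bar>(real a)\<^sup>2 - (real N)\<^sup>2\<bar>))"
      proof (intro divide_left_mono mult_right_mono mult_pos_pos)
        show "1 \<le> real N ^ (2 * r)" using False by (intro one_le_power) auto
        show "0 < \<bar>(real a)\<^sup>2 - (real N)\<^sup>2\<bar>" "0 < \<bar>(real a)\<^sup>2 - (real N)\<^sup>2\<bar>"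
          using False by (auto simp: power2_eq_iff_nonneg)
      qed (use False a in auto)
      also have "\<dots> \<le> real a powr (- 3 / 2) * \<bar>real a - real N\<bar> powr (- 3 / 2)"
        using inverse_square_diff_bound[of a N] False a by simp
      finally show ?thesis .
    qed (auto simp: h_def)
  next
    fix a
    show "(\<lambda>N. h a N) sums R a"
    proof (cases "even a")
      case True
      then show ?thesis by (simp add: h_def R_def)
    next
      case False
      then have a: "a \<ge> 1" by (auto elim: oddE)
      from sums_mult[OF sums_power_square_diff[OF a, of r], of "1 / real a"]
      have "(\<lambda>N. 1 / real a * (if N = 0 \<or> N = a then 0 else 1 / (real N ^ (2 * r) * ((real a)\<^sup>2 - (real N)\<^sup>2)))) sums
        (1 / real a * ((\<Sum>n = 1..r. zeta_val (2 * n) / real a ^ (2 * (r + 1 - n))) - (real r + 3 / 4) / real a ^ (2 * (r + 1))))" .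
      also have "(\<lambda>N. 1 / real a * (if N = 0 \<or> N = a then 0 else 1 / (real N ^ (2 * r) * ((real a)\<^sup>2 - (real N)\<^sup>2)))) = h a"
        using False by (auto simp: h_def fun_eq_iff)
      also have "1 / real a * ((\<Sum>n = 1..r. zeta_val (2 * n) / real a ^ (2 * (r + 1 - n))) - (real r + 3 / 4) / real a ^ (2 * (r + 1))) = R a"
      proof -
        have "zeta_val (2 * n) / real a ^ (2 * (r + 1 - n)) / real a = zeta_val (2 * n) * (1 / real a ^ (k + 2 - 2 * n))" if "n \<in> {1..r}" for n
        proof -
          have "k + 2 - 2 * n = Suc (2 * (r + 1 - n))" using that by (auto simp: k_def)
          then show ?thesis by simp
        qed
        then have "(\<Sum>n = 1..r. zeta_val (2 * n) / real a ^ (2 * (r + 1 - n)) / real a) =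
            (\<Sum>n = 1..r. zeta_val (2 * n) * (1 / real a ^ (k + 2 - 2 * n)))"
          by (intro sum.cong) auto
        moreover have "(real r + 3 / 4) / real a ^ (2 * (r + 1)) / real a = (real r + 3 / 4) * (1 / real a ^ (k + 2))"
          by (simp add: k_def)
        moreover have "1 / real a * (x - y) = x / real a - y / real a" for x y by (simp add: diff_divide_distrib)
        ultimately show ?thesis using False by (simp only: R_def sum_divide_distrib if_True not_False_eq_True)
      qed
      finally show ?thesis .
    qed
  next
    fix N
    show "(\<lambda>a. h a N) sums C N"
    proof (cases "N = 0")
      case True
      then show ?thesis by (simp add: h_def C_def)
    next
      case False
      then have "(\<lambda>a. 1 / real N ^ (2 * r) * (if odd a \<and> a \<noteq> N then 1 / (real a * ((real a)\<^sup>2 - (real N)\<^sup>2)) else 0)) sums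
        (1 / real N ^ (2 * r) * ((- odd_harm N + (if odd N then 3 / (4 * real N) else 0)) / (real N)\<^sup>2))"
        by (intro sums_mult sums_odd_partial_fraction) auto
      also have "(\<lambda>a. 1 / real N ^ (2 * r) * (if odd a \<and> a \<noteq> N then 1 / (real a * ((real a)\<^sup>2 - (real N)\<^sup>2)) else 0)) = (\<lambda>a. h a N)"
        using False by (auto simp: h_def fun_eq_iff)
      also have "1 / real N ^ (2 * r) * ((- odd_harm N + (if odd N then 3 / (4 * real N) else 0)) / (real N)\<^sup>2) = C N"
        using False by (simp add: C_def k_def power_add power2_eq_square divide_simps)
      finally show ?thesis .
    qed
  qed
  then obtain S where S: "R sums S" "C sums S" by blast
  have "R sums ((\<Sum>n = 1..r. zeta_val (2 * n) * (T_val (k + 2 - 2 * n) / 2)) - (real r + 3 / 4) * (T_val (k + 2) / 2))"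
    unfolding R_def
    by (intro sums_diff sums_sum sums_mult T_val_sums_odd) (auto simp: k_def)
  with S(1) have S1: "S = (\<Sum>n = 1..r. zeta_val (2 * n) * (T_val (k + 2 - 2 * n) / 2)) - (real r + 3 / 4) * (T_val (k + 2) / 2)"
    by (rule sums_unique2)
  have "(\<lambda>N. odd_harm N / real N ^ (k + 1)) sums E"
  proof -
    have k: "k \<ge> 1" by (simp add: k_def)
    have "(\<lambda>n. ((if even n then 4 * odd_harm (Suc n) else 0) / real (Suc n) ^ (k + 1) +
        (if odd n then 4 * odd_harm (Suc n) else 0) / real (Suc n) ^ (k + 1)) / 4) sums E"
      unfolding E_def by (intro sums_divide sums_add odd_harm_odd_even_sums k)
    also have "(\<lambda>n. ((if even n then 4 * odd_harm (Suc n) else 0) / real (Suc n) ^ (k + 1) +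
        (if odd n then 4 * odd_harm (Suc n) else 0) / real (Suc n) ^ (k + 1)) / 4) = (\<lambda>n. odd_harm (Suc n) / real (Suc n) ^ (k + 1))"
      by (auto simp: fun_eq_iff)
    finally show ?thesis
      using sums_Suc_iff[of "\<lambda>N. odd_harm N / real N ^ (k + 1)" E] by simp
  qed
  then have "C sums (- E + 3 / 4 * (T_val (k + 2) / 2))"
    unfolding C_def by (intro sums_add sums_minus sums_mult T_val_sums_odd) (auto simp: k_def)
  with S(2) have S2: "S = - E + 3 / 4 * (T_val (k + 2) / 2)" by (rule sums_unique2)
  have "(\<Sum>n = 1..r. zeta_val (2 * n) * (T_val (k + 2 - 2 * n) / 2)) = (\<Sum>n = 1..r. zeta_val (2 * n) * T_val (k + 2 - 2 * n)) / 2"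
    by (simp add: sum_divide_distrib)
  with S1 S2 have "4 * E = (2 * real r + 3) * T_val (k + 2) - 2 * (\<Sum>n = 1..r. zeta_val (2 * n) * T_val (k + 2 - 2 * n))"
    by (simp add: algebra_simps)
  moreover have "4 * E = odd_harm_odd k + odd_harm_even k" "2 * real r + 3 = real (k + 2)"
    by (simp_all add: E_def k_def)
  ultimately show ?thesis by simp
qed

section \<open>Euler sums of depth at most two\<close>

interpretation rat_real: module "\<lambda>(q::rat) (x::real). of_rat q * x"
  by standard (auto simp: of_rat_add of_rat_mult algebra_simps)

lemma ES_base: "euler_index w p \<Longrightarrow> euler_sum p \<in> ES w"
  unfolding ES_def by (intro rat_real.span_base) auto

lemma ES_add: "x \<in> ES w \<Longrightarrow> y \<in> ES w \<Longrightarrow> x + y \<in> ES w"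
  unfolding ES_def by (rule rat_real.span_add)

lemma ES_diff: "x \<in> ES w \<Longrightarrow> y \<in> ES w \<Longrightarrow> x - y \<in> ES w"
  unfolding ES_def by (rule rat_real.span_diff)

lemma ES_sum: "(\<And>i. i \<in> I \<Longrightarrow> f i \<in> ES w) \<Longrightarrow> sum f I \<in> ES w"
  unfolding ES_def by (rule rat_real.span_sum)

lemma ES_rat_mult: "q \<in> \<rat> \<Longrightarrow> x \<in> ES w \<Longrightarrow> q * x \<in> ES w"
  unfolding ES_def by (auto elim!: Rats_cases intro: rat_real.span_scale)

definition euler_term :: "nat \<Rightarrow> int \<Rightarrow> nat \<Rightarrow> real" where
  "euler_term s e n = real_of_int e ^ n / real n ^ s"

lemma euler_term_abs:
  assumes "e \<in> {1, -1}"
  shows "\<bar>euler_term s e n\<bar> = 1 / real n ^ s"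
  using assms by (auto simp: euler_term_def power_abs)

lemma summable_euler_term:
  assumes "e \<in> {1, -1}" "s \<ge> 2"
  shows "summable (\<lambda>n. \<bar>euler_term s e n\<bar>)" "summable (euler_term s e)"
proof -
  show "summable (\<lambda>n. \<bar>euler_term s e n\<bar>)"
    using zeta_val_sums[OF assms(2)] by (simp add: euler_term_abs[OF assms(1)] sums_iff)
  then show "summable (euler_term s e)" by (rule summable_rabs_cancel)
qed

lemma euler_sum_depth_1:
  assumes "e \<in> {1, -1}" "s \<ge> 2"
  shows "(\<lambda>N. \<Sum>n\<in>{1..N}. euler_term s e n) \<longlonglongrightarrow> euler_sum [(s, e)]"
proof -
  have "(\<Sum>ns | length ns = length [(s, e)] \<and> set ns \<subseteq> {1..N} \<and> sorted_wrt (>) ns.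
       \<Prod>j<length [(s, e)]. real_of_int (snd ([(s, e)] ! j)) ^ (ns ! j) / real (ns ! j) ^ fst ([(s, e)] ! j)) =
     (\<Sum>n\<in>{1..N}. euler_term s e n)" for N
    by (rule sum.reindex_bij_witness[of _ "\<lambda>n. [n]" hd])
       (auto simp: length_Suc_conv euler_term_def)
  then have eq: "euler_sum [(s, e)] = lim (\<lambda>N. \<Sum>n\<in>{1..N}. euler_term s e n)"
    unfolding euler_sum_def by simp
  have "(\<lambda>N. \<Sum>n\<le>N. euler_term s e n) \<longlonglongrightarrow> (\<Sum>n. euler_term s e n)"
    using summable_euler_term(2)[OF assms] by (rule summable_LIMSEQ')
  moreover have "(\<Sum>n\<le>N. euler_term s e n) = (\<Sum>n\<in>{1..N}. euler_term s e n)" for N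
  proof -
    have "{..N} = insert 0 {1..N}" by auto
    then show ?thesis using assms(2) by (simp add: euler_term_def)
  qed
  ultimately have "(\<lambda>N. \<Sum>n\<in>{1..N}. euler_term s e n) \<longlonglongrightarrow> (\<Sum>n. euler_term s e n)" by simp
  then show ?thesis unfolding eq by (simp add: limI)
qed

lemma euler_sum_depth_2:
  assumes "e \<in> {1, -1}" "s \<ge> 2" "e' \<in> {1, -1}" "s' \<ge> 2"
  shows "(\<lambda>N. \<Sum>n\<in>{1..N}. \<Sum>m\<in>{1..<n}. euler_term s e n * euler_term s' e' m) \<longlonglongrightarrow> euler_sum [(s, e), (s', e')]"
proof -
  let ?p = "[(s, e), (s', e')]"
  have "(\<Sum>ns | length ns = length ?p \<and> set ns \<subseteq> {1..N} \<and> sorted_wrt (>) ns.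
       \<Prod>j<length ?p. real_of_int (snd (?p ! j)) ^ (ns ! j) / real (ns ! j) ^ fst (?p ! j)) =
     (\<Sum>n\<in>{1..N}. \<Sum>m\<in>{1..<n}. euler_term s e n * euler_term s' e' m)" for N
  proof -
    have "(\<Sum>n\<in>{1..N}. \<Sum>m\<in>{1..<n}. euler_term s e n * euler_term s' e' m) =
        (\<Sum>(n, m)\<in>Sigma {1..N} (\<lambda>n. {1..<n}). euler_term s e n * euler_term s' e' m)"
      by (rule sum.Sigma) auto
    also have "\<dots> = (\<Sum>ns | length ns = length ?p \<and> set ns \<subseteq> {1..N} \<and> sorted_wrt (>) ns.
       \<Prod>j<length ?p. real_of_int (snd (?p ! j)) ^ (ns ! j) / real (ns ! j) ^ fst (?p ! j))"
      by (rule sum.reindex_bij_witness[of _ "\<lambda>ns. (ns ! 0, ns ! 1)" "\<lambda>(n, m). [n, m]"])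
         (auto simp: length_Suc_conv numeral_2_eq_2 euler_term_def lessThan_Suc mult.commute)
    finally show ?thesis by simp
  qed
  then have eq: "euler_sum ?p = lim (\<lambda>N. \<Sum>n\<in>{1..N}. \<Sum>m\<in>{1..<n}. euler_term s e n * euler_term s' e' m)"
    unfolding euler_sum_def by simp
  define c where "c n = (\<Sum>m\<in>{1..<n}. euler_term s e n * euler_term s' e' m)" for n
  have "summable c"
  proof (rule summable_comparison_test')
    show "summable (\<lambda>n. \<bar>euler_term s e n\<bar> * (\<Sum>m. \<bar>euler_term s' e' m\<bar>))"
      by (intro summable_mult2 summable_euler_term assms)
    fix n
    have "norm (c n) \<le> (\<Sum>m\<in>{1..<n}. \<bar>euler_term s e n\<bar> * \<bar>euler_term s' e' m\<bar>)"
      unfolding c_def by (rule order_trans[OF norm_sum]) (simp add: abs_mult)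
    also have "\<dots> = \<bar>euler_term s e n\<bar> * (\<Sum>m\<in>{1..<n}. \<bar>euler_term s' e' m\<bar>)"
      by (simp add: sum_distrib_left)
    also have "\<dots> \<le> \<bar>euler_term s e n\<bar> * (\<Sum>m. \<bar>euler_term s' e' m\<bar>)"
      by (intro mult_left_mono sum_le_suminf summable_euler_term assms) auto
    finally show "norm (c n) \<le> \<bar>euler_term s e n\<bar> * (\<Sum>m. \<bar>euler_term s' e' m\<bar>)" .
  qed
  then have "(\<lambda>N. \<Sum>n\<le>N. c n) \<longlonglongrightarrow> (\<Sum>n. c n)" by (rule summable_LIMSEQ')
  moreover have "(\<Sum>n\<le>N. c n) = (\<Sum>n\<in>{1..N}. c n)" for N
  proof -
    have "{..N} = insert 0 {1..N}" by auto
    then show ?thesis by (simp add: c_def)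
  qed
  ultimately have "(\<lambda>N. \<Sum>n\<in>{1..N}. c n) \<longlonglongrightarrow> (\<Sum>n. c n)" by simp
  then show ?thesis unfolding eq c_def by (simp add: limI)
qed

text \<open>Already true for the truncated sums: a square of index pairs consists of two triangles and the
  diagonal, on which the signs multiply.\<close>

lemma euler_sum_stuffle:
  assumes "e \<in> {1, -1}" "s \<ge> 2" "e' \<in> {1, -1}" "s' \<ge> 2"
  shows "euler_sum [(s, e)] * euler_sum [(s', e')] =
    euler_sum [(s, e), (s', e')] + euler_sum [(s', e'), (s, e)] + euler_sum [(s + s', e * e')]"
proof (rule LIMSEQ_unique)
  let ?x = "euler_term s e" and ?y = "euler_term s' e'"
  show "(\<lambda>N. (\<Sum>n\<in>{1..N}. ?x n) * (\<Sum>n\<in>{1..N}. ?y n)) \<longlonglongrightarrow> euler_sum [(s, e)] * euler_sum [(s', e')]"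
    by (intro tendsto_mult euler_sum_depth_1 assms)
  have ee: "e * e' \<in> {1, -1}" using assms by auto
  have "(\<Sum>n\<in>{1..N}. ?x n) * (\<Sum>n\<in>{1..N}. ?y n) =
      (\<Sum>n\<in>{1..N}. \<Sum>m\<in>{1..<n}. ?x n * ?y m) + (\<Sum>n\<in>{1..N}. \<Sum>m\<in>{1..<n}. ?y n * ?x m) +
      (\<Sum>n\<in>{1..N}. euler_term (s + s') (e * e') n)" for N
  proof (induction N)
    case (Suc N)
    have "euler_term (s + s') (e * e') (Suc N) = ?x (Suc N) * ?y (Suc N)"
      by (simp add: euler_term_def power_add power_mult_distrib)
    moreover have "{1..<Suc N} = {1..N}" by auto
    ultimately show ?case using Suc
      by (simp add: sum_distrib_left[symmetric] distrib_left distrib_right mult.commute[of "sum ?x _" "?y _"])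
  qed simp
  moreover have "(\<lambda>N. (\<Sum>n\<in>{1..N}. \<Sum>m\<in>{1..<n}. ?x n * ?y m) + (\<Sum>n\<in>{1..N}. \<Sum>m\<in>{1..<n}. ?y n * ?x m) +
      (\<Sum>n\<in>{1..N}. euler_term (s + s') (e * e') n)) \<longlonglongrightarrow>
      euler_sum [(s, e), (s', e')] + euler_sum [(s', e'), (s, e)] + euler_sum [(s + s', e * e')]"
    by (intro tendsto_add euler_sum_depth_1 euler_sum_depth_2 assms ee) (use assms in auto)
  ultimately show "(\<lambda>N. (\<Sum>n\<in>{1..N}. ?x n) * (\<Sum>n\<in>{1..N}. ?y n)) \<longlonglongrightarrow>
      euler_sum [(s, e), (s', e')] + euler_sum [(s', e'), (s, e)] + euler_sum [(s + s', e * e')]"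
    by simp
qed

lemma ES_stuffle:
  assumes "e \<in> {1, -1}" "s \<ge> 2" "e' \<in> {1, -1}" "s' \<ge> 2"
  shows "euler_sum [(s, e)] * euler_sum [(s', e')] \<in> ES (s + s')"
  unfolding euler_sum_stuffle[OF assms]
  by (intro ES_add ES_base) (use assms in \<open>auto simp: euler_index_def\<close>)

lemma zeta_val_euler_sum:
  assumes "m \<ge> 2"
  shows "zeta_val m = euler_sum [(m, 1)]"
proof (rule LIMSEQ_unique)
  show "(\<lambda>N. \<Sum>n\<in>{1..N}. euler_term m 1 n) \<longlonglongrightarrow> euler_sum [(m, 1)]"
    by (rule euler_sum_depth_1) (use assms in auto)
  have "(\<lambda>N. \<Sum>n\<le>N. 1 / real n ^ m) \<longlonglongrightarrow> zeta_val m"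
    using zeta_val_sums[OF assms] by (simp add: sums_def_le)
  moreover have "(\<Sum>n\<le>N. 1 / real n ^ m) = (\<Sum>n\<in>{1..N}. euler_term m 1 n)" for N
  proof -
    have "{..N} = insert 0 {1..N}" by auto
    then show ?thesis using assms by (simp add: euler_term_def)
  qed
  ultimately show "(\<lambda>N. \<Sum>n\<in>{1..N}. euler_term m 1 n) \<longlonglongrightarrow> zeta_val m" by simp
qed

lemma T_val_euler_sum:
  assumes "m \<ge> 2"
  shows "T_val m = euler_sum [(m, 1)] - euler_sum [(m, -1)]"
proof (rule LIMSEQ_unique)
  show "(\<lambda>N. (\<Sum>n\<in>{1..N}. euler_term m 1 n) - (\<Sum>n\<in>{1..N}. euler_term m (-1) n)) \<longlonglongrightarrow> euler_sum [(m, 1)] - euler_sum [(m, -1)]"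
    by (intro tendsto_diff euler_sum_depth_1) (use assms in auto)
  have "(\<lambda>N. \<Sum>n\<le>N. 2 * ((if odd n then 1 else 0) / real n ^ m)) \<longlonglongrightarrow> 2 * (T_val m / 2)"
    using sums_mult[OF T_val_sums_odd[OF assms], of 2] unfolding sums_def_le .
  moreover have "(\<Sum>n\<le>N. 2 * ((if odd n then 1 else 0) / real n ^ m)) =
      (\<Sum>n\<in>{1..N}. euler_term m 1 n) - (\<Sum>n\<in>{1..N}. euler_term m (-1) n)" for N
  proof -
    have "{..N} = insert 0 {1..N}" by auto
    then have "(\<Sum>n\<le>N. 2 * ((if odd n then 1 else 0) / real n ^ m)) = (\<Sum>n\<in>{1..N}. 2 * ((if odd n then 1 else 0) / real n ^ m))"
      by simp
    also have "\<dots> = (\<Sum>n\<in>{1..N}. euler_term m 1 n - euler_term m (-1) n)"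
      by (intro sum.cong) (auto simp: euler_term_def)
    finally show ?thesis by (simp add: sum_subtractf)
  qed
  ultimately show "(\<lambda>N. (\<Sum>n\<in>{1..N}. euler_term m 1 n) - (\<Sum>n\<in>{1..N}. euler_term m (-1) n)) \<longlonglongrightarrow> T_val m" by simp
qed

lemma zeta_val_ES: "m \<ge> 2 \<Longrightarrow> zeta_val m \<in> ES m"
  by (subst zeta_val_euler_sum) (auto intro!: ES_base simp: euler_index_def)

lemma T_val_ES: "m \<ge> 2 \<Longrightarrow> T_val m \<in> ES m"
  by (subst T_val_euler_sum) (auto intro!: ES_diff ES_base simp: euler_index_def)

lemma zeta_val_T_val_ES:
  assumes "s \<ge> 2" "m \<ge> 2"
  shows "zeta_val s * T_val m \<in> ES (s + m)"
proof -
  have "zeta_val s * T_val m = euler_sum [(s, 1)] * euler_sum [(m, 1)] - euler_sum [(s, 1)] * euler_sum [(m, -1)]"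
    by (simp add: zeta_val_euler_sum[OF assms(1)] T_val_euler_sum[OF assms(2)] right_diff_distrib)
  also have "\<dots> \<in> ES (s + m)"
    by (intro ES_diff ES_stuffle) (use assms in auto)
  finally show ?thesis .
qed

section \<open>Rationality and the congruence\<close>

text \<open>Removing the even terms from the zeta series.\<close>

lemma T_val_eq_zeta_val:
  assumes "m \<ge> 2"
  shows "T_val m = 2 * (1 - 1 / 2 ^ m) * zeta_val m"
proof -
  have "(\<lambda>N. 1 / 2 ^ m * (1 / real N ^ m)) sums (1 / 2 ^ m * zeta_val m)"
    by (intro sums_mult zeta_val_sums assms)
  then have "(\<lambda>N. if even N then 1 / real N ^ m else 0) sums (1 / 2 ^ m * zeta_val m)"
    by (intro sums_even_reindex[where f = "\<lambda>N. if even N then 1 / real N ^ m else 0"]) (simp_all add: power_mult_distrib)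
  from sums_diff[OF zeta_val_sums[OF assms] this]
  have "(\<lambda>N. 1 / real N ^ m - (if even N then 1 / real N ^ m else 0)) sums (zeta_val m - 1 / 2 ^ m * zeta_val m)" .
  also have "(\<lambda>N. 1 / real N ^ m - (if even N then 1 / real N ^ m else 0)) = (\<lambda>N. (if odd N then 1 else 0) / real N ^ m)"
    by auto
  finally have "T_val m / 2 = zeta_val m - 1 / 2 ^ m * zeta_val m"
    using T_val_sums_odd[OF assms] by (metis sums_unique2)
  then show ?thesis by (simp add: field_simps)
qed

text \<open>By induction on Euler's convolution formula.  Positivity of the factor is carried along because the
  factors are inverted in the next lemma.\<close>

lemma zeta_val_even_rational:
  assumes "n \<ge> 1"
  shows "\<exists>q\<in>\<rat>. q > 0 \<and> zeta_val (2 * n) = q * zeta_val 2 ^ n"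
  using assms
proof (induction n rule: less_induct)
  case (less n)
  show ?case
  proof (cases "n = 1")
    case True
    then show ?thesis by (intro bexI[of _ 1]) auto
  next
    case False
    then obtain r where r: "n = r + 1" "r \<ge> 1" using less.prems by (cases n) auto
    have "\<forall>i\<in>{1..r}. \<exists>q\<in>\<rat>. q > 0 \<and> zeta_val (2 * i) = q * zeta_val 2 ^ i"
      using less.IH r by auto
    then obtain q where q: "\<And>i. i \<in> {1..r} \<Longrightarrow> q i \<in> \<rat> \<and> q i > 0 \<and> zeta_val (2 * i) = q i * zeta_val 2 ^ i"
      by metis
    have qz: "zeta_val (2 * i) = q i * zeta_val 2 ^ i" if "i \<in> {1..r}" for i
      using q[OF that] by blast
    define c where "c = (\<Sum>i = 1..r. q i * q (r + 1 - i)) / (real r + 3 / 2)"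
    have sum: "(\<Sum>i = 1..r. zeta_val (2 * i) * zeta_val (2 * (r + 1 - i))) = (\<Sum>i = 1..r. q i * q (r + 1 - i)) * zeta_val 2 ^ n"
      unfolding sum_distrib_right
    proof (rule sum.cong)
      fix i assume i: "i \<in> {1..r}"
      then have i': "r + 1 - i \<in> {1..r}" by auto
      have "zeta_val 2 ^ i * zeta_val 2 ^ (r + 1 - i) = zeta_val 2 ^ n"
        using i r by (simp add: power_add[symmetric])
      moreover have "zeta_val (2 * i) * zeta_val (2 * (r + 1 - i)) =
          (q i * zeta_val 2 ^ i) * (q (r + 1 - i) * zeta_val 2 ^ (r + 1 - i))"
        by (rule arg_cong2[where f = "(*)", OF qz[OF i] qz[OF i']])
      ultimately show "zeta_val (2 * i) * zeta_val (2 * (r + 1 - i)) = q i * q (r + 1 - i) * zeta_val 2 ^ n"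
        by (metis mult.assoc mult.left_commute)
    qed simp
    have "(real r + 3 / 2) * zeta_val (2 * n) = (\<Sum>i = 1..r. q i * q (r + 1 - i)) * zeta_val 2 ^ n"
      using zeta_even_convolution[OF r(2)] sum unfolding r(1) by argo
    moreover have "real r + 3 / 2 > 0" by (simp add: add_nonneg_pos)
    ultimately have "zeta_val (2 * n) = c * zeta_val 2 ^ n"
      by (simp only: c_def) (simp add: field_simps)
    moreover have "c \<in> \<rat>"
    proof -
      have "(\<Sum>i = 1..r. q i * q (r + 1 - i)) \<in> \<rat>"
      proof (intro Rats_sum Rats_mult)
        fix i assume i: "i \<in> {1..r}"
        then have i': "r + 1 - i \<in> {1..r}" by auto
        show "q i \<in> \<rat>" "q (r + 1 - i) \<in> \<rat>"
          using q[OF i] q[OF i'] by blast+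
      qed
      then show ?thesis unfolding c_def by (intro Rats_divide Rats_add) auto
    qed
    moreover have "c > 0" unfolding c_def
    proof (intro divide_pos_pos sum_pos mult_pos_pos)
      show "{1..r} \<noteq> {}" using r(2) by simp
      show "0 < q i" if "i \<in> {1..r}" for i using q[OF that] by simp
      show "0 < q (r + 1 - i)" if "i \<in> {1..r}" for i
      proof -
        from that have i': "r + 1 - i \<in> {1..r}" by auto
        from q[OF i'] show ?thesis by blast
      qed
    qed auto
    ultimately show ?thesis by blast
  qed
qed

lemma zeta_val_even_step:
  assumes "n \<ge> 1"
  shows "\<exists>q\<in>\<rat>. zeta_val (2 * n + 2) = q * zeta_val 2 * zeta_val (2 * n)"
proof -
  obtain q where q: "q \<in> \<rat>" "q > 0" "zeta_val (2 * n) = q * zeta_val 2 ^ n"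
    using zeta_val_even_rational[OF assms] by blast
  obtain q' where q': "q' \<in> \<rat>" "zeta_val (2 * (n + 1)) = q' * zeta_val 2 ^ (n + 1)"
    using zeta_val_even_rational[of "n + 1"] by auto
  have "zeta_val (2 * n + 2) = q' / q * zeta_val 2 * zeta_val (2 * n)"
    using q q' by (simp add: field_simps)
  moreover have "q' / q \<in> \<rat>" using q q' by (intro Rats_divide)
  ultimately show ?thesis by blast
qed

theorem theorem3p3:
  fixes k :: nat
  assumes "k \<ge> 1"
  shows "T_sym (2 # replicate k 1) - (-1) ^ k * T_sym [1, k + 1] =
           (if odd k
            then 2 * (\<Sum>n = 1..(k - 1) div 2. zeta_val (2 * n) * T_val (k + 2 - 2 * n))
            else real (k + 2) * T_val (k + 2))
       \<and> cong_mod_zeta2 (T_sym (2 # replicate k 1)) ((-1) ^ k * T_sym [1, k + 1]) (ES k)"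
proof (cases "odd k")
  case True
  then obtain r where r: "k = 2 * r + 1" by (rule oddE)
  let ?S = "\<Sum>n = 1..r. zeta_val (2 * n) * T_val (k + 2 - 2 * n)"
  have eq: "T_sym (2 # replicate k 1) - (-1) ^ k * T_sym [1, k + 1] = 2 * ?S"
  proof -
    have "T_sym (2 # replicate k 1) - (-1) ^ k * T_sym [1, k + 1] =
        real (k + 2) * T_val (k + 2) - (odd_harm_odd k + odd_harm_even k)"
      unfolding T_sym_2_replicate_1_odd[OF True] T_sym_1_single[OF assms] using True by simp
    then show ?thesis
      using odd_harm_series_value[of r, folded r] by linarith
  qed
  have "\<exists>v\<in>ES k. zeta_val (2 * n) * T_val (k + 2 - 2 * n) = zeta_val 2 * v" if n: "n \<in> {1..r}" for n
  proof (cases "n = 1")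
    case True
    then show ?thesis using T_val_ES[of k] n r by (intro bexI[of _ "T_val k"]) auto
  next
    case False
    then obtain i where i: "n = i + 1" "i \<ge> 1" using n by (cases n) auto
    obtain q where q: "q \<in> \<rat>" "zeta_val (2 * i + 2) = q * zeta_val 2 * zeta_val (2 * i)"
      using zeta_val_even_step[OF i(2)] by blast
    have "zeta_val (2 * i) * T_val (k + 2 - 2 * n) \<in> ES (2 * i + (k + 2 - 2 * n))"
      by (rule zeta_val_T_val_ES) (use n r i in auto)
    also have "2 * i + (k + 2 - 2 * n) = k" using n r i by auto
    finally have "q * (zeta_val (2 * i) * T_val (k + 2 - 2 * n)) \<in> ES k"
      by (rule ES_rat_mult[OF q(1)])
    moreover have "zeta_val (2 * n) * T_val (k + 2 - 2 * n) = zeta_val 2 * (q * (zeta_val (2 * i) * T_val (k + 2 - 2 * n)))"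
      using q(2) i(1) by simp
    ultimately show ?thesis by blast
  qed
  then obtain v where v: "\<And>n. n \<in> {1..r} \<Longrightarrow> v n \<in> ES k \<and> zeta_val (2 * n) * T_val (k + 2 - 2 * n) = zeta_val 2 * v n"
    by metis
  have "?S = (\<Sum>n = 1..r. zeta_val 2 * v n)"
    by (intro sum.cong) (use v in auto)
  then have "2 * ?S = zeta_val 2 * (2 * (\<Sum>n = 1..r. v n))"
    by (simp only: sum_distrib_left mult.left_commute)
  moreover have "2 * (\<Sum>n = 1..r. v n) \<in> ES k"
    by (intro ES_rat_mult ES_sum) (use v in auto)
  ultimately have "cong_mod_zeta2 (T_sym (2 # replicate k 1)) ((-1) ^ k * T_sym [1, k + 1]) (ES k)"
    unfolding cong_mod_zeta2_def eq by blast
  with eq True show ?thesis by (simp add: r)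
next
  case False
  have eq: "T_sym (2 # replicate k 1) - (-1) ^ k * T_sym [1, k + 1] = real (k + 2) * T_val (k + 2)"
    using T_sym_2_replicate_1_even[of k] T_sym_1_single[OF assms] False assms by simp
  obtain i where i: "k = 2 * i" "i \<ge> 1" using False assms by (cases "even k") (auto simp: dvd_def)
  obtain q where q: "q \<in> \<rat>" "zeta_val (2 * i + 2) = q * zeta_val 2 * zeta_val (2 * i)"
    using zeta_val_even_step[OF i(2)] by blast
  have "real (k + 2) * T_val (k + 2) = zeta_val 2 * (real (k + 2) * (2 * (1 - 1 / 2 ^ (k + 2))) * q * zeta_val k)"
    using T_val_eq_zeta_val[of "k + 2"] q(2) i(1) by simp
  moreover have "real (k + 2) * (2 * (1 - 1 / 2 ^ (k + 2))) * q * zeta_val k \<in> ES k"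
    by (intro ES_rat_mult zeta_val_ES Rats_mult Rats_diff Rats_divide Rats_power) (use q i in auto)
  ultimately have "cong_mod_zeta2 (T_sym (2 # replicate k 1)) ((-1) ^ k * T_sym [1, k + 1]) (ES k)"
    unfolding cong_mod_zeta2_def eq by blast
  with eq False show ?thesis by simp
qed

end
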